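(* Let $\Omega\subseteq\mathbb R^N$ be open, let $\mathbf A\in DM^\infty(\Omega;\mathbb R^{N\times N}_{\rm sym})$ and $\mathbf u\in BD(\Omega)\cap L^\infty(\Omega;\mathbb R^N)$ satisfy $|\mathrm{Div}^s\mathbf A|(S_{\mathbf u}\setminus J_{\mathbf u})=0$. Then the distribution $(\mathbf A:E\mathbf u)$ defined by $$\langle(\mathbf A:E\mathbf u),\varphi\rangle:=-\int_\Omega\varphi\,\mathbf u^*\cdot d\,\mathrm{Div}\,\mathbf A-\int_\Omega\mathbf A:(\mathbf u\odot\nabla\varphi)\,dx,\qquad\varphi\in C_c^\infty(\Omega),$$ is a Radon measure in $\Omega$, absolutely continuous with respect to $|E\mathbf u|$, and $$|(\mathbf A:E\mathbf u)|(B)\le\|\mathbf A\|_{L^\infty(U)}|E\mathbf u|(B)\quad\text{for every Borel set }B\subset U\Subset\Omega\ (U\text{ open}).$$ Moreover, $\mathrm{div}(\mathbf A\mathbf u)\in\mathcal M(\Omega)$ and $$\mathrm{div}(\mathbf A\mathbf u)=\mathbf u^*\cdot\mathrm{Div}\,\mathbf A+(\mathbf A:E\mathbf u)$$ in the sense of measures in $\Omega$.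
   Context: $\mathbb R^{N\times N}_{\rm sym}$: real symmetric matrices, with $\mathbf A:\mathbf B=\mathrm{tr}(\mathbf A^T\mathbf B)$ and the associated Frobenius norm; $\mathbf a\odot\mathbf b=\frac12(\mathbf a\otimes\mathbf b+\mathbf b\otimes\mathbf a)$. $\mathcal M(\Omega;\mathbb R^m)$: finite $\mathbb R^m$-valued Radon measures. $DM^\infty(\Omega;\mathbb R^{N\times N}_{\rm sym})=\{\mathbf A\in L^\infty(\Omega;\mathbb R^{N\times N}_{\rm sym}):\mathrm{Div}\,\mathbf A\in\mathcal M(\Omega;\mathbb R^N)\}$, where $(\mathrm{Div}\,\mathbf A)_j=\sum_i\partial_iA_{ij}$ distributionally; $\mathrm{Div}^s\mathbf A$ is the singular part of $\mathrm{Div}\,\mathbf A$ with respect to $\mathscr L^N$. $BD(\Omega)$: functions $\mathbf u\in L^1(\Omega;\mathbb R^N)$ such that $E\mathbf u=\frac12(D\mathbf u+D\mathbf u^T)$ is a finite Radon measure. $S_{\mathbf u}$ is the set of points of $\Omega$ that are not Lebesgue points of $\mathbf u$, $\widetilde{\mathbf u}$ the approximate limit on $\Omega\setminus S_{\mathbf u}$, $J_{\mathbf u}\subset S_{\mathbf u}$ the set of approximate jump points with one-sided approximate limits $\mathbf u^\pm$. The precise representative is $\mathbf u^*=\widetilde{\mathbf u}$ on $\Omega\setminus S_{\mathbf u}$, $\mathbf u^*=\frac{\mathbf u^++\mathbf u^-}2$ on $J_{\mathbf u}$. Since $\mathscr L^N(S_{\mathbf u})=0$, the assumption $|\mathrm{Div}^s\mathbf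 A|(S_{\mathbf u}\setminus J_{\mathbf u})=0$ ensures that $\mathbf u^*$ is defined $|\mathrm{Div}\,\mathbf A|$-a.e. *)

theory Defs
  imports "HOL-Probability.Essential_Supremum"
begin

section \<open>Finite vector-valued Radon measures on an open set\<close>

text \<open>
  A finite Radon measure on \<open>\<Omega>\<close> with values in a Euclidean space is a countably additive set
  function on the Borel subsets of \<open>\<Omega>\<close>; its total variation is then automatically finite.
  It is extended by \<open>0\<close> to all other sets, so that equality of measures is equality of functions.
\<close>

definition Radon_measure :: "'a::euclidean_space set \<Rightarrow> ('a set \<Rightarrow> 'b::euclidean_space) \<Rightarrow> bool" where
  "Radon_measure \<Omega> \<mu> \<longleftrightarrow>
     (\<forall>F :: nat \<Rightarrow> 'a set. range F \<subseteq> sets (restrict_space borel \<Omega>) \<longrightarrow> disjoint_family F \<longrightarrow>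
        (\<lambda>i. \<mu> (F i)) sums \<mu> (\<Union>i. F i)) \<and>
     (\<forall>B. B \<notin> sets (restrict_space borel \<Omega>) \<longrightarrow> \<mu> B = 0)"

text \<open>Total variation \<open>|\<mu>|\<close>, as a positive measure.\<close>

definition total_variation ::
    "'a::euclidean_space set \<Rightarrow> ('a set \<Rightarrow> 'b::euclidean_space) \<Rightarrow> 'a measure" where
  "total_variation \<Omega> \<mu> =
     measure_of \<Omega> (sets (restrict_space borel \<Omega>))
       (\<lambda>B. SUP F \<in> {F :: nat \<Rightarrow> 'a set. range F \<subseteq> sets (restrict_space borel \<Omega>) \<and>
                       disjoint_family F \<and> (\<Union>i. F i) = B}.
              \<Sum>i. ennreal (norm (\<mu> (F i))))"

text \<open>Jordan decomposition: \<open>\<mu>\<^sup>+ = (|\<mu>| + \<mu>) / 2\<close>, and \<open>\<mu>\<^sup>- = (- \<mu>)\<^sup>+\<close>.\<close>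

definition positive_part :: "'a::euclidean_space set \<Rightarrow> ('a set \<Rightarrow> real) \<Rightarrow> 'a measure" where
  "positive_part \<Omega> \<mu> =
     measure_of \<Omega> (sets (restrict_space borel \<Omega>))
       (\<lambda>B. ennreal ((measure (total_variation \<Omega> \<mu>) B + \<mu> B) / 2))"

definition signed_integral ::
    "'a::euclidean_space set \<Rightarrow> ('a set \<Rightarrow> real) \<Rightarrow> ('a \<Rightarrow> real) \<Rightarrow> real" where
  "signed_integral \<Omega> \<mu> f =
     (LINT x|positive_part \<Omega> \<mu>. f x) - (LINT x|positive_part \<Omega> (\<lambda>B. - \<mu> B). f x)"

text \<open>\<open>\<integral> f \<cdot> d\<mu>\<close> for a vector field \<open>f\<close> and a vector measure \<open>\<mu>\<close>, and the real measure
  \<open>f \<cdot> \<mu>\<close>.\<close>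

definition dot_integral ::
    "'a::euclidean_space set \<Rightarrow> ('a set \<Rightarrow> 'b::euclidean_space) \<Rightarrow> ('a \<Rightarrow> 'b) \<Rightarrow> real" where
  "dot_integral \<Omega> \<mu> f = (\<Sum>b\<in>Basis. signed_integral \<Omega> (\<lambda>B. \<mu> B \<bullet> b) (\<lambda>x. f x \<bullet> b))"

definition dot_measure ::
    "'a::euclidean_space set \<Rightarrow> ('a \<Rightarrow> 'b) \<Rightarrow> ('a set \<Rightarrow> 'b::euclidean_space) \<Rightarrow> 'a set \<Rightarrow> real" where
  "dot_measure \<Omega> f \<mu> B =
     (if B \<in> sets (restrict_space borel \<Omega>)
      then dot_integral \<Omega> \<mu> (\<lambda>x. indicator B x *\<^sub>R f x) else 0)"

text \<open>The singular part in the Lebesgue decomposition with respect to Lebesgue measure (which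
  exists and is unique).\<close>

definition singular_part ::
    "'a::euclidean_space set \<Rightarrow> ('a set \<Rightarrow> 'b::euclidean_space) \<Rightarrow> 'a set \<Rightarrow> 'b" where
  "singular_part \<Omega> \<mu> =
     (SOME \<mu>s. Radon_measure \<Omega> \<mu>s \<and>
        (\<exists>N. N \<in> null_sets (restrict_space lborel \<Omega>) \<and>
             \<Omega> - N \<in> null_sets (total_variation \<Omega> \<mu>s)) \<and>
        (\<exists>\<mu>a. Radon_measure \<Omega> \<mu>a \<and>
              absolutely_continuous (restrict_space lborel \<Omega>) (total_variation \<Omega> \<mu>a) \<and>
              (\<forall>B. \<mu> B = \<mu>a B + \<mu>s B)))"


section \<open>Test functions and distributions\<close>

text \<open>For a differentiable function these are the partial derivatives.\<close>

definition grad :: "(real^'n \<Rightarrow> real) \<Rightarrow> real^'n \<Rightarrow> real^'n" where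
  "grad \<phi> x = (\<chi> i. frechet_derivative \<phi> (at x) (axis i 1))"

text \<open>\<open>\<phi>\<close> is of class \<open>C\<^sup>k\<close> on the whole space.\<close>

primrec Ck :: "nat \<Rightarrow> (real^'n \<Rightarrow> real) \<Rightarrow> bool" where
  "Ck 0 \<phi> \<longleftrightarrow> continuous_on UNIV \<phi>"
| "Ck (Suc k) \<phi> \<longleftrightarrow> (\<forall>x. \<phi> differentiable (at x)) \<and> (\<forall>i. Ck k (\<lambda>x. grad \<phi> x $ i))"

definition test_functions :: "(real^'n) set \<Rightarrow> (real^'n \<Rightarrow> real) set" where
  "test_functions \<Omega> =
     {\<phi>. (\<forall>k. Ck k \<phi>) \<and> compact (closure {x. \<phi> x \<noteq> 0}) \<and> closure {x. \<phi> x \<noteq> 0} \<subseteq> \<Omega>}"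

text \<open>
  A (vector-valued) distribution on \<open>\<Omega>\<close> is given by its values on the test functions. The
  following says that the distribution \<open>T\<close> is the finite Radon measure \<open>\<mu>\<close>, that is
  \<open>\<langle>T, \<phi>\<rangle> = \<integral> \<phi> d\<mu>\<close>, componentwise. For open \<open>\<Omega>\<close> such a measure is unique.
\<close>

definition represents ::
    "(real^'n) set \<Rightarrow> ((real^'n \<Rightarrow> real) \<Rightarrow> 'b::euclidean_space) \<Rightarrow> ((real^'n) set \<Rightarrow> 'b) \<Rightarrow> bool" where
  "represents \<Omega> T \<mu> \<longleftrightarrow> Radon_measure \<Omega> \<mu> \<and>
     (\<forall>\<phi>\<in>test_functions \<Omega>. \<forall>b\<in>Basis. T \<phi> \<bullet> b = signed_integral \<Omega> (\<lambda>B. \<mu> B \<bullet> b) \<phi>)"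

definition is_Radon_measure ::
    "(real^'n) set \<Rightarrow> ((real^'n \<Rightarrow> real) \<Rightarrow> 'b::euclidean_space) \<Rightarrow> bool" where
  "is_Radon_measure \<Omega> T \<longleftrightarrow> (\<exists>\<mu>. represents \<Omega> T \<mu>)"

definition the_measure ::
    "(real^'n) set \<Rightarrow> ((real^'n \<Rightarrow> real) \<Rightarrow> 'b::euclidean_space) \<Rightarrow> (real^'n) set \<Rightarrow> 'b" where
  "the_measure \<Omega> T = (SOME \<mu>. represents \<Omega> T \<mu>)"

definition div_distr ::
    "(real^'n) set \<Rightarrow> (real^'n \<Rightarrow> real^'n) \<Rightarrow> (real^'n \<Rightarrow> real) \<Rightarrow> real" where
  "div_distr \<Omega> v \<phi> = - (LINT x|lebesgue_on \<Omega>. v x \<bullet> grad \<phi> x)"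

definition Div_distr ::
    "(real^'n) set \<Rightarrow> (real^'n \<Rightarrow> real^'n^'n) \<Rightarrow> (real^'n \<Rightarrow> real) \<Rightarrow> real^'n" where
  "Div_distr \<Omega> A \<phi> = (\<chi> j. - (LINT x|lebesgue_on \<Omega>. (\<Sum>i\<in>UNIV. A x $ i $ j * grad \<phi> x $ i)))"

definition D_distr ::
    "(real^'n) set \<Rightarrow> (real^'n \<Rightarrow> real^'n) \<Rightarrow> (real^'n \<Rightarrow> real) \<Rightarrow> real^'n^'n" where
  "D_distr \<Omega> u \<phi> = (\<chi> i j. - (LINT x|lebesgue_on \<Omega>. u x $ i * grad \<phi> x $ j))"

definition E_distr ::
    "(real^'n) set \<Rightarrow> (real^'n \<Rightarrow> real^'n) \<Rightarrow> (real^'n \<Rightarrow> real) \<Rightarrow> real^'n^'n" where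
  "E_distr \<Omega> u \<phi> = (1/2) *\<^sub>R (D_distr \<Omega> u \<phi> + transpose (D_distr \<Omega> u \<phi>))"

abbreviation Div_measure :: "(real^'n) set \<Rightarrow> (real^'n \<Rightarrow> real^'n^'n) \<Rightarrow> (real^'n) set \<Rightarrow> real^'n" where
  "Div_measure \<Omega> A \<equiv> the_measure \<Omega> (Div_distr \<Omega> A)"

abbreviation E_measure :: "(real^'n) set \<Rightarrow> (real^'n \<Rightarrow> real^'n) \<Rightarrow> (real^'n) set \<Rightarrow> real^'n^'n" where
  "E_measure \<Omega> u \<equiv> the_measure \<Omega> (E_distr \<Omega> u)"


section \<open>Function spaces\<close>

text \<open>
  Elements of these spaces are represented by functions on the whole space, of which only the
  restriction to \<open>\<Omega>\<close>, up to Lebesgue null sets, matters. The norm of \<^typ>\<open>real^'n^'n\<close> is the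
  Frobenius norm and its inner product is \<open>tr (A\<^sup>T B)\<close>.
\<close>

definition Linf_norm :: "'a::euclidean_space set \<Rightarrow> ('a \<Rightarrow> 'b::euclidean_space) \<Rightarrow> ennreal" where
  "Linf_norm \<Omega> f = esssup (lebesgue_on \<Omega>) (\<lambda>x. ennreal (norm (f x)))"

definition L_infty :: "'a::euclidean_space set \<Rightarrow> ('a \<Rightarrow> 'b::euclidean_space) set" where
  "L_infty \<Omega> = {f \<in> borel_measurable (lebesgue_on \<Omega>). Linf_norm \<Omega> f < \<infinity>}"

definition DM_infty :: "(real^'n) set \<Rightarrow> (real^'n \<Rightarrow> real^'n^'n) set" where
  "DM_infty \<Omega> = {A \<in> L_infty \<Omega>. (AE x in lebesgue_on \<Omega>. transpose (A x) = A x) \<and>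
                                  is_Radon_measure \<Omega> (Div_distr \<Omega> A)}"

definition BD :: "(real^'n) set \<Rightarrow> (real^'n \<Rightarrow> real^'n) set" where
  "BD \<Omega> = {u. integrable (lebesgue_on \<Omega>) u \<and> is_Radon_measure \<Omega> (E_distr \<Omega> u)}"


section \<open>Approximate limits and the precise representative\<close>

definition mean_value :: "'a::euclidean_space set \<Rightarrow> ('a \<Rightarrow> real) \<Rightarrow> real" where
  "mean_value S f = (LINT y|lebesgue_on S. f y) / measure lebesgue S"

definition approx_limit ::
    "('a::euclidean_space \<Rightarrow> 'b::euclidean_space) \<Rightarrow> 'a \<Rightarrow> 'b \<Rightarrow> bool" where
  "approx_limit u x z \<longleftrightarrow>
     ((\<lambda>r. mean_value (ball x r) (\<lambda>y. norm (u y - z))) \<longlongrightarrow> 0) (at_right 0)"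

definition half_ball :: "'a::euclidean_space \<Rightarrow> real \<Rightarrow> 'a \<Rightarrow> 'a set" where
  "half_ball x r \<nu> = {y \<in> ball x r. (y - x) \<bullet> \<nu> > 0}"

text \<open>One-sided approximate limits \<open>a\<close> (on the side of \<open>\<nu>\<close>) and \<open>b\<close> (on the opposite side).
  The triple \<open>(a, b, \<nu>)\<close> is unique up to a change to \<open>(b, a, - \<nu>)\<close>.\<close>

definition approx_jump ::
    "('a::euclidean_space \<Rightarrow> 'b::euclidean_space) \<Rightarrow> 'a \<Rightarrow> 'b \<Rightarrow> 'b \<Rightarrow> 'a \<Rightarrow> bool" where
  "approx_jump u x a b \<nu> \<longleftrightarrow> a \<noteq> b \<and> norm \<nu> = 1 \<and>
     ((\<lambda>r. mean_value (half_ball x r \<nu>) (\<lambda>y. norm (u y - a))) \<longlongrightarrow> 0) (at_right 0) \<and>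
     ((\<lambda>r. mean_value (half_ball x r (- \<nu>)) (\<lambda>y. norm (u y - b))) \<longlongrightarrow> 0) (at_right 0)"

text \<open>The set \<open>S\<^sub>u\<close> of points without approximate limit and the jump set \<open>J\<^sub>u\<close>; neither
  depends on the representative of \<open>u\<close>.\<close>

definition disc_set :: "'a::euclidean_space set \<Rightarrow> ('a \<Rightarrow> 'b::euclidean_space) \<Rightarrow> 'a set" where
  "disc_set \<Omega> u = {x \<in> \<Omega>. \<not> (\<exists>z. approx_limit u x z)}"

definition jump_set :: "'a::euclidean_space set \<Rightarrow> ('a \<Rightarrow> 'b::euclidean_space) \<Rightarrow> 'a set" where
  "jump_set \<Omega> u = {x \<in> \<Omega>. \<exists>a b \<nu>. approx_jump u x a b \<nu>}"

definition jump_values :: "('a::euclidean_space \<Rightarrow> 'b::euclidean_space) \<Rightarrow> 'a \<Rightarrow> 'b \<times> 'b" where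
  "jump_values u x = (SOME (a, b). \<exists>\<nu>. approx_jump u x a b \<nu>)"

text \<open>The precise representative \<open>u\<^sup>*\<close>; the value \<open>0\<close> off its domain
  \<open>\<Omega> - (S\<^sub>u - J\<^sub>u)\<close> is a convention.\<close>

definition precise_rep ::
    "'a::euclidean_space set \<Rightarrow> ('a \<Rightarrow> 'b::euclidean_space) \<Rightarrow> 'a \<Rightarrow> 'b" where
  "precise_rep \<Omega> u x =
     (if x \<in> \<Omega> - disc_set \<Omega> u then (SOME z. approx_limit u x z)
      else if x \<in> jump_set \<Omega> u then (1/2) *\<^sub>R (fst (jump_values u x) + snd (jump_values u x))
      else 0)"


section \<open>The pairing\<close>

definition sym_prod :: "real^'n \<Rightarrow> real^'n \<Rightarrow> real^'n^'n"  (infixl \<open>\<odot>\<close> 70) where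
  "a \<odot> b = (\<chi> i j. (a $ i * b $ j + b $ i * a $ j) / 2)"

definition pairing ::
    "(real^'n) set \<Rightarrow> (real^'n \<Rightarrow> real^'n^'n) \<Rightarrow> (real^'n \<Rightarrow> real^'n) \<Rightarrow> (real^'n \<Rightarrow> real) \<Rightarrow> real" where
  "pairing \<Omega> A u \<phi> =
     - dot_integral \<Omega> (Div_measure \<Omega> A) (\<lambda>x. \<phi> x *\<^sub>R precise_rep \<Omega> u x)
     - (LINT x|lebesgue_on \<Omega>. A x \<bullet> (u x \<odot> grad \<phi> x))"

end

theory Submission
  imports Defs
begin

text \<open>
  Let \<open>K\<^sub>r\<close> be an even smooth kernel supported in the ball of radius \<open>r\<close>, and let \<open>u\<^sub>r\<close> be the
  mollification of \<open>u\<close> with it. For a test function \<open>\<phi>\<close> the definition of \<open>Div A\<close>, applied to the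
  test functions \<open>x \<mapsto> \<phi> x * K\<^sub>r x y\<close> and integrated against \<open>u y\<close>, gives by Fubini
  \<open>\<integral> \<phi> u\<^sub>r \<cdot> dDiv A = - \<integral> A : (u\<^sub>r \<odot> \<nabla>\<phi>) - \<integral> \<phi> A : W\<^sub>r\<close>, where \<open>W\<^sub>r x\<close> is the distribution \<open>E u\<close> evaluated at
  \<open>K\<^sub>r x\<close> as soon as that kernel is supported in \<open>\<Omega>\<close> (\<open>mollified_identity\<close>, \<open>W_eq_E_distr\<close>). The mollified field itself is
  never differentiated.

  Now let \<open>r\<close> tend to \<open>0\<close>. At a Lebesgue point \<open>u\<^sub>r\<close> converges to the approximate limit, and at a
  jump point to the mean of the one-sided limits, because an even kernel puts mass \<open>1/2\<close> on each side of a
  hyperplane (\<open>mollify_tendsto_precise_rep\<close>). The exceptional set \<open>S\<^sub>u - J\<^sub>u\<close> is Lebesgue null by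
  Lebesgue's differentiation theorem (\<open>AE_Lebesgue_point\<close>) and null for the singular part of \<open>Div A\<close> by hypothesis, hence null
  for \<open>|Div A|\<close> (\<open>null_set_of_singular_and_Lebesgue\<close>). Dominated convergence turns the identity into
  \<open>\<langle>(A : Eu), \<phi>\<rangle> = lim \<integral> \<phi> A : W\<^sub>r\<close> (\<open>pairing_limit\<close>).

  Since \<open>|W\<^sub>r x| \<le> \<integral> K\<^sub>r x y d|Eu| y\<close>, another application of Fubini bounds the right-hand side by
  \<open>\<parallel>A\<parallel> \<integral> (K\<^sub>r * |\<phi>|) d|Eu|\<close>, with the \<open>L\<^sup>\<infinity>\<close> norm over any open subset of \<open>\<Omega>\<close> that contains
  the support of \<open>\<phi>\<close>; in the limit \<open>|\<langle>(A : Eu), \<phi>\<rangle>| \<le> \<parallel>A\<parallel> \<integral> |\<phi>| d|Eu|\<close> (\<open>pairing_bound\<close>). A functional with such a bound extends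
  from the test functions, which are dense in \<open>L\<^sup>1(|Eu|)\<close>, to indicator functions and so defines a measure
  (\<open>dominated_functional_extension\<close>); the same bound for smaller open sets gives the local estimate, and absolute continuity with
  it (\<open>pairing_measure\<close>). The product rule for \<open>div (A u)\<close> is then a rearrangement of the definition of the pairing,
  because \<open>A : (u \<odot> \<nabla>\<phi>) = (A u) \<cdot> \<nabla>\<phi>\<close> for symmetric \<open>A\<close>, together with the uniqueness of representing measures
  (\<open>represents_unique\<close>).
\<close>

section \<open>Vector-valued Radon measures\<close>

lemma disjoint_family_UN_lessThan_Int:
  fixes F :: "nat \<Rightarrow> 'a set"
  assumes "disjoint_family F"
  shows "(\<Union>i<n. F i) \<inter> F n = {}"
proof (rule equals0I)
  fix x assume "x \<in> (\<Union>i<n. F i) \<inter> F n"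
  then obtain i where i: "i < n" "x \<in> F i" "x \<in> F n" by blast
  have "F i \<inter> F n = {}" by (rule disjoint_family_onD[OF assms]) (use i in auto)
  then show False using i by blast
qed

abbreviation borel_on :: "'a::euclidean_space set \<Rightarrow> 'a set set" where
  "borel_on \<Omega> \<equiv> sets (restrict_space borel \<Omega>)"

lemma sigma_algebra_borel_on: "sigma_algebra \<Omega> (borel_on \<Omega>)"
  using sets.sigma_algebra_axioms[of "restrict_space borel \<Omega>"] by (simp add: space_restrict_space)

lemma Radon_measureD:
  assumes "Radon_measure \<Omega> \<mu>" "range F \<subseteq> borel_on \<Omega>" "disjoint_family F"
  shows "(\<lambda>i. \<mu> (F i)) sums \<mu> (\<Union>i. F i)"
  using assms unfolding Radon_measure_def by blast

lemma Radon_measure_outside: "Radon_measure \<Omega> \<mu> \<Longrightarrow> B \<notin> borel_on \<Omega> \<Longrightarrow> \<mu> B = 0"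
  unfolding Radon_measure_def by blast

lemma Radon_measure_empty:
  assumes "Radon_measure \<Omega> \<mu>"
  shows "\<mu> {} = 0"
proof -
  have "(\<lambda>i::nat. \<mu> {}) sums \<mu> (\<Union>i::nat. {})"
    by (rule Radon_measureD[OF assms]) (auto simp: disjoint_family_on_def)
  then have "(\<lambda>i::nat. \<mu> {}) \<longlonglongrightarrow> 0"
    by (intro summable_LIMSEQ_zero sums_summable)
  then show ?thesis by (simp add: LIMSEQ_const_iff)
qed

lemma Radon_measure_Un:
  assumes \<mu>: "Radon_measure \<Omega> \<mu>" and "A \<in> borel_on \<Omega>" "B \<in> borel_on \<Omega>" "A \<inter> B = {}"
  shows "\<mu> (A \<union> B) = \<mu> A + \<mu> B"
proof -
  have "(\<lambda>i. \<mu> (binaryset A B i)) sums \<mu> (\<Union>i. binaryset A B i)"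
    using assms by (intro Radon_measureD[OF \<mu>])
      (auto simp: range_binaryset_eq disjoint_family_on_def binaryset_def)
  moreover have "(\<lambda>i. \<mu> (binaryset A B i)) sums (\<mu> A + \<mu> B)"
    by (rule binaryset_sums) (rule Radon_measure_empty[OF \<mu>])
  ultimately show ?thesis by (simp add: UN_binaryset_eq sums_unique2)
qed

lemma Radon_measure_Diff:
  assumes \<mu>: "Radon_measure \<Omega> \<mu>" and "A \<in> borel_on \<Omega>" "B \<in> borel_on \<Omega>" "A \<subseteq> B"
  shows "\<mu> (B - A) = \<mu> B - \<mu> A"
  using Radon_measure_Un[OF \<mu>, of A "B - A"] assms by (auto simp: Un_absorb1)

lemma Radon_measure_UN:
  assumes \<mu>: "Radon_measure \<Omega> \<mu>" and "finite I"
    and "\<And>i. i \<in> I \<Longrightarrow> F i \<in> borel_on \<Omega>" "disjoint_family_on F I"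
  shows "\<mu> (\<Union>i\<in>I. F i) = (\<Sum>i\<in>I. \<mu> (F i))"
  using assms(2,3,4)
proof (induction I rule: finite_induct)
  case empty
  then show ?case by (simp add: Radon_measure_empty[OF \<mu>])
next
  case (insert i I)
  have "\<mu> (F i \<union> (\<Union>i\<in>I. F i)) = \<mu> (F i) + \<mu> (\<Union>i\<in>I. F i)"
  proof (rule Radon_measure_Un[OF \<mu>])
    show "F i \<inter> (\<Union>i\<in>I. F i) = {}"
      using insert.hyps(2) insert.prems(2) by (auto simp: disjoint_family_on_def)
  qed (use insert in auto)
  moreover have "\<mu> (\<Union>i\<in>I. F i) = (\<Sum>i\<in>I. \<mu> (F i))"
    using insert by (auto simp: disjoint_family_on_def)
  ultimately show ?case using insert by simp
qed

lemma Radon_measure_linear_image: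
  assumes \<mu>: "Radon_measure \<Omega> \<mu>" and h: "bounded_linear h"
  shows "Radon_measure \<Omega> (\<lambda>B. h (\<mu> B))"
  using \<mu> bounded_linear.sums[OF h] linear_simps(3)[OF h] unfolding Radon_measure_def by auto

lemma Radon_measure_inner: "Radon_measure \<Omega> \<mu> \<Longrightarrow> Radon_measure \<Omega> (\<lambda>B. \<mu> B \<bullet> b)"
  by (rule Radon_measure_linear_image[OF _ bounded_linear_inner_left])

lemma Radon_measure_add:
  assumes "Radon_measure \<Omega> \<mu>" "Radon_measure \<Omega> \<nu>"
  shows "Radon_measure \<Omega> (\<lambda>B. \<mu> B + \<nu> B)"
  using assms unfolding Radon_measure_def by (auto intro!: sums_add)

lemma Radon_measure_scale:
  "Radon_measure \<Omega> \<mu> \<Longrightarrow> Radon_measure \<Omega> (\<lambda>B. c *\<^sub>R \<mu> B)"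
  by (rule Radon_measure_linear_image[OF _ bounded_linear_scaleR_right])

lemma Radon_measure_uminus: "Radon_measure \<Omega> \<mu> \<Longrightarrow> Radon_measure \<Omega> (\<lambda>B. - \<mu> B)"
  using Radon_measure_scale[of \<Omega> \<mu> "-1"] by simp

lemma Radon_measure_sum:
  assumes "finite I" "\<And>i. i \<in> I \<Longrightarrow> Radon_measure \<Omega> (\<mu> i)"
  shows "Radon_measure \<Omega> (\<lambda>B. \<Sum>i\<in>I. \<mu> i B)"
  using assms by (auto simp: Radon_measure_def intro!: sums_sum)

lemma Radon_measure_diff_measures:
  assumes "finite_measure P" "finite_measure Q" "sets P = borel_on \<Omega>" "sets Q = borel_on \<Omega>"
  shows "Radon_measure \<Omega> (\<lambda>B. measure P B - measure Q B)"
proof -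
  interpret P: finite_measure P by fact
  interpret Q: finite_measure Q by fact
  show ?thesis
    unfolding Radon_measure_def
    using assms(3,4) by (auto intro!: sums_diff P.finite_measure_UNION Q.finite_measure_UNION
        simp: measure_notin_sets)
qed

section \<open>Total variation\<close>

abbreviation partitions :: "'a::euclidean_space set \<Rightarrow> 'a set \<Rightarrow> (nat \<Rightarrow> 'a set) set" where
  "partitions \<Omega> B \<equiv> {F. range F \<subseteq> borel_on \<Omega> \<and> disjoint_family F \<and> (\<Union>i. F i) = B}"

text \<open>
  The set function that \<open>total_variation\<close> turns into a measure. It is kept apart because it has to be shown
  countably additive before it is known to be the values of that measure.
\<close>

definition variation :: "'a::euclidean_space set \<Rightarrow> ('a set \<Rightarrow> 'b::euclidean_space) \<Rightarrow> 'a set \<Rightarrow> ennreal"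
  where "variation \<Omega> \<mu> B = (SUP F \<in> partitions \<Omega> B. \<Sum>i. ennreal (norm (\<mu> (F i))))"

lemma trivial_partition:
  "B \<in> borel_on \<Omega> \<Longrightarrow> (\<lambda>i::nat. if i = 0 then B else {}) \<in> partitions \<Omega> B"
  by (auto simp: disjoint_family_on_def split: if_splits)

lemma sum_le_variation:
  "F \<in> partitions \<Omega> B \<Longrightarrow> (\<Sum>i. ennreal (norm (\<mu> (F i)))) \<le> variation \<Omega> \<mu> B"
  unfolding variation_def by (rule SUP_upper)

lemma norm_le_variation:
  assumes "Radon_measure \<Omega> \<mu>" "B \<in> borel_on \<Omega>"
  shows "ennreal (norm (\<mu> B)) \<le> variation \<Omega> \<mu> B"
proof -
  have "(\<Sum>i. ennreal (norm (\<mu> (if i = 0 then B else {})))) = (\<Sum>i\<in>{0::nat}. ennreal (norm (\<mu> (if i = 0 then B else {}))))"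
    by (rule suminf_finite) (auto simp: Radon_measure_empty[OF assms(1)])
  then show ?thesis using sum_le_variation[OF trivial_partition[OF assms(2)], of \<mu>] by simp
qed

lemma norm_sums_le_suminf:
  fixes x :: "nat \<Rightarrow> 'b::banach"
  assumes "x sums s"
  shows "ennreal (norm s) \<le> (\<Sum>i. ennreal (norm (x i)))"
proof (cases "(\<Sum>i. ennreal (norm (x i))) = top")
  case False
  then have s: "summable (\<lambda>i. norm (x i))"
    by (intro summable_suminf_not_top) auto
  then have "norm s \<le> (\<Sum>i. norm (x i))"
    using summable_norm[OF s] assms by (simp add: sums_iff)
  then show ?thesis by (simp add: suminf_ennreal2[OF _ s] ennreal_leI)
qed simp

lemma suminf_swap_ennreal:
  fixes f :: "nat \<Rightarrow> nat \<Rightarrow> ennreal"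
  shows "(\<Sum>i. \<Sum>j. f i j) = (\<Sum>j. \<Sum>i. f i j)"
  using nn_integral_suminf[of "\<lambda>i j. f i j" "count_space UNIV"]
  by (simp add: nn_integral_count_space_nat)

text \<open>
  A partition of \<open>A\<close> and a partition of \<open>B\<close> together, renumbered by the pairing function on the natural numbers,
  form a partition of \<open>A \<union> B\<close>.
\<close>

lemma variation_superadditive:
  assumes \<mu>: "\<mu> {} = 0" and "A \<inter> B = {}" and AB: "A \<in> borel_on \<Omega>" "B \<in> borel_on \<Omega>"
  shows "variation \<Omega> \<mu> A + variation \<Omega> \<mu> B \<le> variation \<Omega> \<mu> (A \<union> B)"
proof -
  have *: "(\<Sum>i. ennreal (norm (\<mu> (F i)))) + (\<Sum>i. ennreal (norm (\<mu> (G i)))) \<le> variation \<Omega> \<mu> (A \<union> B)"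
    if F: "F \<in> partitions \<Omega> A" and G: "G \<in> partitions \<Omega> B" for F G
  proof -
    define K where "K p = (if fst p = (0::nat) then F (snd p) else if fst p = 1 then G (snd p) else {})" for p
    have K: "(\<lambda>n. K (prod_decode n)) \<in> partitions \<Omega> (A \<union> B)"
    proof safe
      show "K (prod_decode n) \<in> borel_on \<Omega>" for n
        using F G by (auto simp: K_def)
      have "K p \<inter> K q = {}" if "p \<noteq> q" for p q
        using that F G assms(2) unfolding K_def disjoint_family_on_def
        by (cases p; cases q) (fastforce split: if_splits)
      then show "disjoint_family (\<lambda>n. K (prod_decode n))"
        by (auto simp: disjoint_family_on_def)
      fix x
      { fix n assume "x \<in> K (prod_decode n)" "x \<notin> B" then show "x \<in> A"
          using F G by (auto simp: K_def split: if_splits) }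
      { assume "x \<in> A" then obtain j where "x \<in> F j" using F by auto
        then have "x \<in> K (prod_decode (prod_encode (0,j)))" by (simp add: K_def)
        then show "x \<in> (\<Union>n. K (prod_decode n))" by blast }
      { assume "x \<in> B" then obtain j where "x \<in> G j" using G by auto
        then have "x \<in> K (prod_decode (prod_encode (1,j)))" by (simp add: K_def)
        then show "x \<in> (\<Union>n. K (prod_decode n))" by blast }
    qed
    define g where "g i = (\<Sum>j. ennreal (norm (\<mu> (K (i, j)))))" for i
    have "(\<Sum>n. ennreal (norm (\<mu> (K (prod_decode n))))) = suminf g"
      by (rule suminf_ennreal_2dimen) (simp add: g_def)
    also have "\<dots> = (\<Sum>i\<in>{0,1}. g i)"
      by (rule suminf_finite) (auto simp: g_def K_def \<mu>)
    also have "\<dots> = (\<Sum>i. ennreal (norm (\<mu> (F i)))) + (\<Sum>i. ennreal (norm (\<mu> (G i))))"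
      by (simp add: g_def K_def)
    finally show ?thesis using sum_le_variation[OF K, of \<mu>] by simp
  qed
  have ne: "partitions \<Omega> A \<noteq> {}" "partitions \<Omega> B \<noteq> {}"
    by (rule ex_in_conv[THEN iffD1, OF exI], rule trivial_partition, rule AB)+
  have "(SUP F\<in>partitions \<Omega> A. \<Sum>i. ennreal (norm (\<mu> (F i)))) + (\<Sum>i. ennreal (norm (\<mu> (G i)))) \<le> variation \<Omega> \<mu> (A \<union> B)"
    if G: "G \<in> partitions \<Omega> B" for G
    unfolding ennreal_SUP_add_left[OF ne(1), symmetric] by (rule SUP_least, rule *, assumption, rule G)
  then have "variation \<Omega> \<mu> A + (SUP G\<in>partitions \<Omega> B. \<Sum>i. ennreal (norm (\<mu> (G i)))) \<le> variation \<Omega> \<mu> (A \<union> B)"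
    unfolding variation_def[of _ _ A]
    by (subst ennreal_SUP_add_right[OF ne(2)]) (rule SUP_least)
  then show ?thesis
    by (simp only: variation_def[of _ _ B])
qed

lemma variation_mono:
  assumes "\<mu> {} = 0" "A \<in> borel_on \<Omega>" "B \<in> borel_on \<Omega>" "A \<subseteq> B"
  shows "variation \<Omega> \<mu> A \<le> variation \<Omega> \<mu> B"
proof -
  have "variation \<Omega> \<mu> A \<le> variation \<Omega> \<mu> A + variation \<Omega> \<mu> (B - A)" by simp
  also have "\<dots> \<le> variation \<Omega> \<mu> (A \<union> (B - A))"
    by (rule variation_superadditive) (use assms in auto)
  also have "A \<union> (B - A) = B" using assms by auto
  finally show ?thesis .
qed

lemma variation_empty: "\<mu> {} = 0 \<Longrightarrow> variation \<Omega> \<mu> {} = 0"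
  unfolding variation_def by (intro antisym SUP_least) auto

text \<open>
  One inequality is superadditivity and monotonicity. For the other, cut the pieces of a partition of the
  union along the sets \<open>E i\<close> and exchange the order of summation.
\<close>

lemma variation_countably_additive:
  assumes \<mu>: "Radon_measure \<Omega> \<mu>"
  shows "countably_additive (borel_on \<Omega>) (variation \<Omega> \<mu>)"
  unfolding countably_additive_def
proof (intro allI impI antisym)
  fix E :: "nat \<Rightarrow> 'a set"
  assume E: "range E \<subseteq> borel_on \<Omega>" "disjoint_family E" "(\<Union>i. E i) \<in> borel_on \<Omega>"
  note \<mu>0 = Radon_measure_empty[OF \<mu>]
  have disj: "E i \<inter> E j = {}" if "i \<noteq> j" for i j
    using E(2) that by (simp add: disjoint_family_on_def)
  have disj': "(\<Union>i<n. E i) \<inter> E n = {}" for n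
    by (rule disjoint_family_UN_lessThan_Int[OF E(2)])
  have "(\<Sum>i<n. variation \<Omega> \<mu> (E i)) \<le> variation \<Omega> \<mu> (\<Union>i<n. E i)" for n
  proof (induction n)
    case (Suc n)
    have "(\<Sum>i<Suc n. variation \<Omega> \<mu> (E i)) \<le> variation \<Omega> \<mu> (\<Union>i<n. E i) + variation \<Omega> \<mu> (E n)"
      using Suc by (simp add: add_right_mono)
    also have "\<dots> \<le> variation \<Omega> \<mu> ((\<Union>i<n. E i) \<union> E n)"
      by (rule variation_superadditive) (use \<mu>0 E disj' in auto)
    finally show ?case by (simp add: lessThan_Suc Un_commute)
  qed (simp add: variation_empty \<mu>0)
  also have "variation \<Omega> \<mu> (\<Union>i<n. E i) \<le> variation \<Omega> \<mu> (\<Union>i. E i)" for n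
    by (rule variation_mono) (use \<mu>0 E in auto)
  finally show "(\<Sum>i. variation \<Omega> \<mu> (E i)) \<le> variation \<Omega> \<mu> (\<Union>i. E i)"
    by (intro suminf_le_const) auto
  show "variation \<Omega> \<mu> (\<Union>i. E i) \<le> (\<Sum>i. variation \<Omega> \<mu> (E i))"
    unfolding variation_def[of _ _ "\<Union>i. E i"]
  proof (rule SUP_least)
    fix F assume F: "F \<in> partitions \<Omega> (\<Union>i. E i)"
    have "ennreal (norm (\<mu> (F j))) \<le> (\<Sum>i. ennreal (norm (\<mu> (F j \<inter> E i))))" for j
    proof -
      have "(\<lambda>i. \<mu> (F j \<inter> E i)) sums \<mu> (\<Union>i. F j \<inter> E i)"
        by (rule Radon_measureD[OF \<mu>]) (use E F disj in \<open>auto simp: disjoint_family_on_def\<close>)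
      moreover have "(\<Union>i. F j \<inter> E i) = F j" using F by auto
      ultimately show ?thesis using norm_sums_le_suminf by metis
    qed
    then have "(\<Sum>j. ennreal (norm (\<mu> (F j)))) \<le> (\<Sum>j. \<Sum>i. ennreal (norm (\<mu> (F j \<inter> E i))))"
      by (intro suminf_le) auto
    also have "\<dots> = (\<Sum>i. \<Sum>j. ennreal (norm (\<mu> (F j \<inter> E i))))"
      by (rule suminf_swap_ennreal)
    also have "\<dots> \<le> (\<Sum>i. variation \<Omega> \<mu> (E i))"
    proof (intro suminf_le sum_le_variation)
      show "(\<lambda>j. F j \<inter> E i) \<in> partitions \<Omega> (E i)" for i
      proof safe
        show "F j \<inter> E i \<in> borel_on \<Omega>" for j using E F by auto
        show "disjoint_family (\<lambda>j. F j \<inter> E i)"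
          using F by (elim CollectE conjE) (rule disjoint_family_subset, assumption, blast)
        fix x assume "x \<in> E i"
        then have "x \<in> (\<Union>j. F j)" using F by auto
        then show "x \<in> (\<Union>j. F j \<inter> E i)" using \<open>x \<in> E i\<close> by auto
      qed
    qed auto
    finally show "(\<Sum>j. ennreal (norm (\<mu> (F j)))) \<le> (\<Sum>i. variation \<Omega> \<mu> (E i))" .
  qed
qed

lemma total_variation_eq: "total_variation \<Omega> \<mu> = measure_of \<Omega> (borel_on \<Omega>) (variation \<Omega> \<mu>)"
  unfolding total_variation_def variation_def ..

lemma sets_measure_of_borel_on [simp]: "sets (measure_of \<Omega> (borel_on \<Omega>) f) = borel_on \<Omega>"
  by (rule sigma_algebra.sets_measure_of_eq[OF sigma_algebra_borel_on])

lemma space_measure_of_borel_on [simp]: "space (measure_of \<Omega> (borel_on \<Omega>) f) = \<Omega>"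
  by (simp add: space_measure_of_conv)

lemma sets_total_variation [simp]: "sets (total_variation \<Omega> \<mu>) = borel_on \<Omega>"
  by (simp add: total_variation_eq)

lemma space_total_variation [simp]: "space (total_variation \<Omega> \<mu>) = \<Omega>"
  by (simp add: total_variation_eq)

lemma emeasure_total_variation:
  assumes "Radon_measure \<Omega> \<mu>" "B \<in> borel_on \<Omega>"
  shows "emeasure (total_variation \<Omega> \<mu>) B = variation \<Omega> \<mu> B"
  unfolding total_variation_eq
  by (rule emeasure_measure_of_sigma)
    (auto simp: sigma_algebra_borel_on positive_def variation_empty Radon_measure_empty[OF assms(1)]
      variation_countably_additive assms)

lemma variation_le_sum_components:
  fixes \<mu> :: "'a::euclidean_space set \<Rightarrow> 'b::euclidean_space"
  shows "variation \<Omega> \<mu> B \<le> (\<Sum>b\<in>Basis. variation \<Omega> (\<lambda>B. \<mu> B \<bullet> b) B)"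
  unfolding variation_def[of _ \<mu>]
proof (rule SUP_least)
  fix F assume F: "F \<in> partitions \<Omega> B"
  have "(\<Sum>i. ennreal (norm (\<mu> (F i)))) \<le> (\<Sum>i. \<Sum>b\<in>Basis. ennreal (norm (\<mu> (F i) \<bullet> b)))"
    by (intro suminf_le) (auto simp: norm_le_l1 intro!: ennreal_leI)
  also have "\<dots> = (\<Sum>b\<in>Basis. \<Sum>i. ennreal (norm (\<mu> (F i) \<bullet> b)))"
    by (rule suminf_sum) auto
  also have "\<dots> \<le> (\<Sum>b\<in>Basis. variation \<Omega> (\<lambda>B. \<mu> B \<bullet> b) B)"
    by (intro sum_mono sum_le_variation[OF F])
  finally show "(\<Sum>i. ennreal (norm (\<mu> (F i)))) \<le> (\<Sum>b\<in>Basis. variation \<Omega> (\<lambda>B. \<mu> B \<bullet> b) B)" .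
qed

text \<open>
  If the variation of \<open>E\<close> is infinite, the terms \<open>\<mu> (F i)\<close> of one sign in a finite part of some partition add
  up to more than \<open>1 + \<bar>\<mu> E\<bar>\<close> in absolute value. The union of these pieces and its complement in \<open>E\<close> both have
  measure larger than \<open>1\<close> in absolute value, and one of the two still has infinite variation.
\<close>

lemma infinite_variation_split:
  fixes \<mu> :: "'a::euclidean_space set \<Rightarrow> real"
  assumes \<mu>: "Radon_measure \<Omega> \<mu>" and E: "E \<in> borel_on \<Omega>" "variation \<Omega> \<mu> E = \<infinity>"
  obtains A where "A \<in> borel_on \<Omega>" "A \<subseteq> E" "1 < \<bar>\<mu> A\<bar>" "variation \<Omega> \<mu> (E - A) = \<infinity>"
proof -
  \<comment> \<open>The terms of one sign make up more than half of it, \<open>1 + \<bar>\<mu> E\<bar>\<close>, which leaves more than \<open>1\<close> for the complement.\<close>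
  let ?t = "2 * (1 + \<bar>\<mu> E\<bar>)"
  have "ennreal ?t < variation \<Omega> \<mu> E" using E by simp
  then obtain F where F: "F \<in> partitions \<Omega> E" and "ennreal ?t < (\<Sum>i. ennreal (norm (\<mu> (F i))))"
    unfolding variation_def less_SUP_iff by blast
  then obtain n where "ennreal ?t < (\<Sum>i<n. ennreal (norm (\<mu> (F i))))"
    unfolding suminf_eq_SUP less_SUP_iff by blast
  then have n: "?t < (\<Sum>i<n. \<bar>\<mu> (F i)\<bar>)"
    using ennreal_less_iff[of ?t "\<Sum>i<n. \<bar>\<mu> (F i)\<bar>"] by (simp del: ennreal_plus add: sum_ennreal)
  let ?P = "{i. i < n \<and> 0 \<le> \<mu> (F i)}" and ?N = "{i. i < n \<and> \<not> 0 \<le> \<mu> (F i)}"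
  have "(\<Sum>i<n. \<bar>\<mu> (F i)\<bar>) = (\<Sum>i\<in>?P. \<bar>\<mu> (F i)\<bar>) + (\<Sum>i\<in>?N. \<bar>\<mu> (F i)\<bar>)"
    by (subst sum.union_disjoint[symmetric]) (auto intro!: sum.cong)
  also have "\<dots> = (\<Sum>i\<in>?P. \<mu> (F i)) - (\<Sum>i\<in>?N. \<mu> (F i))"
    by (simp add: sum_negf)
  finally have "?t / 2 < (\<Sum>i\<in>?P. \<mu> (F i)) \<or> ?t / 2 < - (\<Sum>i\<in>?N. \<mu> (F i))"
    using n by linarith
  then obtain I where I: "finite I" "?t / 2 < \<bar>\<Sum>i\<in>I. \<mu> (F i)\<bar>"
  proof
    assume "?t / 2 < (\<Sum>i\<in>?P. \<mu> (F i))" then show ?thesis by (intro that[of ?P]) auto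
  next
    assume "?t / 2 < - (\<Sum>i\<in>?N. \<mu> (F i))" then show ?thesis by (intro that[of ?N]) auto
  qed
  define A where "A = (\<Union>i\<in>I. F i)"
  have A: "A \<in> borel_on \<Omega>" "A \<subseteq> E"
    using F I by (auto simp: A_def)
  have "\<mu> A = (\<Sum>i\<in>I. \<mu> (F i))"
    unfolding A_def using F I
    by (intro Radon_measure_UN[OF \<mu>]) (auto simp: disjoint_family_on_def)
  then have \<mu>A: "1 + \<bar>\<mu> E\<bar> < \<bar>\<mu> A\<bar>" using I by simp
  have \<mu>B: "1 < \<bar>\<mu> (E - A)\<bar>"
    using \<mu>A by (subst Radon_measure_Diff[OF \<mu> A(1) E(1) A(2)]) linarith
  have add: "variation \<Omega> \<mu> E = variation \<Omega> \<mu> A + variation \<Omega> \<mu> (E - A)"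
    using plus_emeasure[of A "total_variation \<Omega> \<mu>" "E - A"] A E(1)
    by (simp add: emeasure_total_variation[OF \<mu>] Un_absorb1)
  show ?thesis
  proof (cases "variation \<Omega> \<mu> (E - A) = \<infinity>")
    case True
    then show ?thesis using that[of A] A \<mu>A by auto
  next
    case False
    then have "variation \<Omega> \<mu> A = \<infinity>" using add E(2) by (metis ennreal_add_eq_top infinity_ennreal_def)
    moreover have "E - (E - A) = A" using A by auto
    ultimately show ?thesis using that[of "E - A"] A E \<mu>B by auto
  qed
qed

text \<open>
  Repeated splitting produces disjoint sets whose measures exceed \<open>1\<close> in absolute value, so their series cannot
  converge.
\<close>

lemma variation_finite_real:
  fixes \<mu> :: "'a::euclidean_space set \<Rightarrow> real"
  assumes \<mu>: "Radon_measure \<Omega> \<mu>" and "E \<in> borel_on \<Omega>"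
  shows "variation \<Omega> \<mu> E < \<infinity>"
proof (rule ccontr)
  assume "\<not> ?thesis"
  then have inf: "variation \<Omega> \<mu> E = \<infinity>" by (simp add: not_less top_unique)
  have "\<exists>f. \<forall>n. (fst (f n) \<in> borel_on \<Omega> \<and> snd (f n) \<in> borel_on \<Omega> \<and> fst (f n) \<inter> snd (f n) = {} \<and>
        (n > 0 \<longrightarrow> 1 < \<bar>\<mu> (snd (f n))\<bar>) \<and> variation \<Omega> \<mu> (fst (f n)) = \<infinity>) \<and>
        (fst (f (Suc n)) \<subseteq> fst (f n) \<and> snd (f (Suc n)) \<subseteq> fst (f n))"
  proof (rule dependent_nat_choice[where P="\<lambda>n p. fst p \<in> borel_on \<Omega> \<and> snd p \<in> borel_on \<Omega> \<and> fst p \<inter> snd p = {} \<and>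
        (n > 0 \<longrightarrow> 1 < \<bar>\<mu> (snd p)\<bar>) \<and> variation \<Omega> \<mu> (fst p) = \<infinity>"
        and Q="\<lambda>n p q. fst q \<subseteq> fst p \<and> snd q \<subseteq> fst p"])
    show "\<exists>p. fst p \<in> borel_on \<Omega> \<and> snd p \<in> borel_on \<Omega> \<and> fst p \<inter> snd p = {} \<and>
        (0 < (0::nat) \<longrightarrow> 1 < \<bar>\<mu> (snd p)\<bar>) \<and> variation \<Omega> \<mu> (fst p) = \<infinity>"
      using inf assms(2) by (intro exI[of _ "(E, {})"]) auto
    fix p and n :: nat
    assume p: "fst p \<in> borel_on \<Omega> \<and> snd p \<in> borel_on \<Omega> \<and> fst p \<inter> snd p = {} \<and>
        (0 < n \<longrightarrow> 1 < \<bar>\<mu> (snd p)\<bar>) \<and> variation \<Omega> \<mu> (fst p) = \<infinity>"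
    then obtain A where "A \<in> borel_on \<Omega>" "A \<subseteq> fst p" "1 < \<bar>\<mu> A\<bar>" "variation \<Omega> \<mu> (fst p - A) = \<infinity>"
      using infinite_variation_split[OF \<mu>] by blast
    with p show "\<exists>q. (fst q \<in> borel_on \<Omega> \<and> snd q \<in> borel_on \<Omega> \<and> fst q \<inter> snd q = {} \<and>
        (0 < Suc n \<longrightarrow> 1 < \<bar>\<mu> (snd q)\<bar>) \<and> variation \<Omega> \<mu> (fst q) = \<infinity>) \<and> fst q \<subseteq> fst p \<and> snd q \<subseteq> fst p"
      by (intro exI[of _ "(fst p - A, A)"]) auto
  qed
  then obtain f where f: "\<And>n. fst (f n) \<in> borel_on \<Omega>" "\<And>n. snd (f n) \<in> borel_on \<Omega>"
    "\<And>n. fst (f n) \<inter> snd (f n) = {}" "\<And>n. n > 0 \<Longrightarrow> 1 < \<bar>\<mu> (snd (f n))\<bar>"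
    "\<And>n. fst (f (Suc n)) \<subseteq> fst (f n)" "\<And>n. snd (f (Suc n)) \<subseteq> fst (f n)" by blast
  define A where "A n = snd (f (Suc n))" for n
  have dec: "fst (f n) \<subseteq> fst (f m)" if "m \<le> n" for m n
    using that f(5) by (rule lift_Suc_antimono_le[rotated])
  have "A m \<inter> A n = {}" if "m < n" for m n
  proof -
    have "A n \<subseteq> fst (f n)" "fst (f n) \<subseteq> fst (f (Suc m))"
      using f(6) dec[of "Suc m" n] that by (auto simp: A_def)
    then show ?thesis using f(3)[of "Suc m"] by (auto simp: A_def)
  qed
  then have "disjoint_family A"
    unfolding disjoint_family_on_def by (metis Int_commute linorder_neqE_nat)
  then have "(\<lambda>n. \<mu> (A n)) sums \<mu> (\<Union>n. A n)"
    using f(2) by (intro Radon_measureD[OF \<mu>]) (auto simp: A_def[abs_def])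
  then have "(\<lambda>n. \<mu> (A n)) \<longlonglongrightarrow> 0" by (intro summable_LIMSEQ_zero sums_summable)
  then have "eventually (\<lambda>n. \<bar>\<mu> (A n)\<bar> < 1) sequentially"
    using LIMSEQ_D[of "\<lambda>n. \<mu> (A n)" 0 1] unfolding eventually_sequentially by auto
  then show False
    using f(4) unfolding A_def eventually_sequentially by (meson less_asym le_refl zero_less_Suc)
qed

lemma variation_finite:
  assumes "Radon_measure \<Omega> \<mu>" "E \<in> borel_on \<Omega>"
  shows "variation \<Omega> \<mu> E < \<infinity>"
  using variation_le_sum_components[of \<Omega> \<mu> E]
  by (rule le_less_trans) (use variation_finite_real[OF Radon_measure_inner[OF assms(1)] assms(2)] in auto)

lemma finite_measure_total_variation:
  assumes "Radon_measure \<Omega> \<mu>"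
  shows "finite_measure (total_variation \<Omega> \<mu>)"
proof (rule finite_measureI)
  have "\<Omega> \<in> borel_on \<Omega>" using sets.top[of "restrict_space borel \<Omega>"] by (simp add: space_restrict_space)
  then show "emeasure (total_variation \<Omega> \<mu>) (space (total_variation \<Omega> \<mu>)) \<noteq> \<infinity>"
    using variation_finite[OF assms] by (auto simp: emeasure_total_variation[OF assms] less_top)
qed

lemma norm_le_total_variation:
  assumes "Radon_measure \<Omega> \<mu>"
  shows "norm (\<mu> B) \<le> measure (total_variation \<Omega> \<mu>) B"
proof (cases "B \<in> borel_on \<Omega>")
  case True
  interpret finite_measure "total_variation \<Omega> \<mu>" by (rule finite_measure_total_variation[OF assms])
  show ?thesis
    using norm_le_variation[OF assms True] emeasure_total_variation[OF assms True]
    by (simp add: emeasure_eq_measure flip: ennreal_le_iff)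
qed (simp add: Radon_measure_outside[OF assms] measure_notin_sets)

text \<open>
  The total variation is the smallest positive measure that dominates \<open>norm \<circ> \<nu>\<close>. Asking for the bound on the
  subsets of \<open>B\<close> alone lets the constant depend on a neighbourhood of \<open>B\<close>.
\<close>

lemma total_variation_least:
  assumes \<nu>: "Radon_measure \<Omega> \<nu>" and "sets M = borel_on \<Omega>" and B: "B \<in> borel_on \<Omega>"
    and le: "\<And>C. C \<in> borel_on \<Omega> \<Longrightarrow> C \<subseteq> B \<Longrightarrow> ennreal (norm (\<nu> C)) \<le> c * emeasure M C"
  shows "emeasure (total_variation \<Omega> \<nu>) B \<le> c * emeasure M B"
  unfolding emeasure_total_variation[OF \<nu> B] variation_def
proof (rule SUP_least)
  fix F assume F: "F \<in> partitions \<Omega> B"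
  have "(\<Sum>i. ennreal (norm (\<nu> (F i)))) \<le> (\<Sum>i. c * emeasure M (F i))"
    using F by (intro suminf_le le) auto
  also have "\<dots> = c * emeasure M B"
    using F suminf_emeasure[of F M] assms(2) by simp
  finally show "(\<Sum>i. ennreal (norm (\<nu> (F i)))) \<le> c * emeasure M B" .
qed

section \<open>Integrals with respect to signed measures\<close>

lemma bounded_integrable:
  fixes f :: "'a \<Rightarrow> 'b::{banach, second_countable_topology}"
  assumes "finite_measure M" "f \<in> borel_measurable M" "\<And>x. x \<in> space M \<Longrightarrow> norm (f x) \<le> K"
  shows "integrable M f"
  by (rule finite_measure.integrable_const_bound[OF assms(1), where B=K]) (use assms in auto)

text \<open>
  A linear relation between finite measures carries over to the integrals of bounded functions. Sums, differences
  and multiples of measures thereby become relations between real numbers, and the linearity of signed integrals in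
  the measure is an instance.
\<close>

lemma integral_lincomb_eq_0:
  fixes f :: "'a \<Rightarrow> real" and M :: "'i \<Rightarrow> 'a measure"
  assumes I: "finite I" and fin: "\<And>i. i \<in> I \<Longrightarrow> finite_measure (M i)"
    and sets: "\<And>i. i \<in> I \<Longrightarrow> sets (M i) = sets N"
    and zero: "\<And>B. B \<in> sets N \<Longrightarrow> (\<Sum>i\<in>I. c i * measure (M i) B) = 0"
    and f: "f \<in> borel_measurable N" "\<And>x. x \<in> space N \<Longrightarrow> \<bar>f x\<bar> \<le> K"
  shows "(\<Sum>i\<in>I. c i * (LINT x|M i. f x)) = 0"
proof -
  have space: "space (M i) = space N" if "i \<in> I" for i
    using sets_eq_imp_space_eq[OF sets[OF that]] .
  have meas: "g \<in> borel_measurable (M i) \<longleftrightarrow> g \<in> borel_measurable N" if "i \<in> I" for i and g :: "'a \<Rightarrow> real"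
    using measurable_cong_sets[OF sets[OF that] refl] by auto
  have int: "integrable (M i) g" if "i \<in> I" "g \<in> borel_measurable N" "\<And>x. x \<in> space N \<Longrightarrow> \<bar>g x\<bar> \<le> C" for i C and g :: "'a \<Rightarrow> real"
    using bounded_integrable[OF fin[OF that(1)], of g C] that meas space by auto
  have pos: "(\<forall>C. (\<forall>x\<in>space N. g x \<le> C) \<longrightarrow> (\<Sum>i\<in>I. c i * (LINT x|M i. g x)) = 0)"
    if g: "g \<in> borel_measurable N" "\<And>x. 0 \<le> g x" for g :: "'a \<Rightarrow> real"
    using g
  proof (induction g rule: borel_measurable_induct_real)
    case (set A)
    then show ?case using zero[OF set] by (simp add: sets space)
  next
    case (mult u d)
    show ?case
    proof (intro allI impI)
      fix C assume C: "\<forall>x\<in>space N. d * u x \<le> C"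
      show "(\<Sum>i\<in>I. c i * (LINT x|M i. d * u x)) = 0"
      proof (cases "d = 0")
        case False
        then have "\<forall>x\<in>space N. u x \<le> C / d" using C mult by (auto simp: field_simps)
        then have "(\<Sum>i\<in>I. c i * (LINT x|M i. u x)) = 0" using mult by blast
        then have "d * (\<Sum>i\<in>I. c i * (LINT x|M i. u x)) = 0" by simp
        then show ?thesis by (simp add: sum_distrib_left mult_ac)
      qed simp
    qed
  next
    case (add u v)
    show ?case
    proof (intro allI impI)
      fix C assume C: "\<forall>x\<in>space N. v x + u x \<le> C"
      have b: "u x \<le> C" "v x \<le> C" if "x \<in> space N" for x
      proof -
        have "v x + u x \<le> C" "0 \<le> u x" "0 \<le> v x" using C add that by blast+
        then show "u x \<le> C" "v x \<le> C" by linarith+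
      qed
      have iu: "integrable (M i) u" "integrable (M i) v" if "i \<in> I" for i
        by (rule int[OF that, where C=C]; use add b in auto)+
      have "(\<Sum>i\<in>I. c i * (LINT x|M i. u x)) = 0" "(\<Sum>i\<in>I. c i * (LINT x|M i. v x)) = 0"
        using add b by blast+
      then show "(\<Sum>i\<in>I. c i * (LINT x|M i. v x + u x)) = 0"
        by (simp add: iu algebra_simps sum.distrib)
    qed
  next
    case (seq U)
    have U_meas: "U n \<in> borel_measurable N" and U_nonneg: "0 \<le> U n x"
      and U_IH: "\<forall>C. (\<forall>x\<in>space N. U n x \<le> C) \<longrightarrow> (\<Sum>i\<in>I. c i * (LINT x|M i. U n x)) = 0"
      and U_lim: "x \<in> space N \<Longrightarrow> (\<lambda>n. U n x) \<longlonglongrightarrow> g x" for n x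
      using seq by blast+
    show ?case
    proof (intro allI impI)
      fix C assume C: "\<forall>x\<in>space N. g x \<le> C"
      have inc: "incseq (\<lambda>i. U i x)" for x
        using \<open>incseq U\<close> by (auto simp: incseq_def le_fun_def)
      have U: "U n x \<le> g x" if "x \<in> space N" for n x
        by (rule incseq_le[OF inc U_lim[OF that]])
      have [measurable]: "g \<in> borel_measurable N"
        by (rule borel_measurable_LIMSEQ_real[OF U_lim U_meas])
      have "(\<lambda>n. \<Sum>i\<in>I. c i * (LINT x|M i. U n x)) \<longlonglongrightarrow> (\<Sum>i\<in>I. c i * (LINT x|M i. g x))"
      proof (intro tendsto_sum tendsto_mult_left)
        fix i assume i: "i \<in> I"
        show "(\<lambda>n. LINT x|M i. U n x) \<longlonglongrightarrow> (LINT x|M i. g x)"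
        proof (rule integral_dominated_convergence[where w="\<lambda>_. C"])
          show "integrable (M i) (\<lambda>_. C)" by (rule int[OF i]) auto
          show "AE x in M i. (\<lambda>n. U n x) \<longlonglongrightarrow> g x" using U_lim by (auto simp: space i)
          show "AE x in M i. norm (U n x) \<le> C" for n
            using U C U_nonneg by (intro AE_I2) (auto simp: space i intro: order_trans[OF U])
        qed (use U_meas seq meas[OF i] in auto)
      qed
      moreover have "(\<Sum>i\<in>I. c i * (LINT x|M i. U n x)) = 0" for n
        using U_IH U C by (meson order_trans)
      ultimately show "(\<Sum>i\<in>I. c i * (LINT x|M i. g x)) = 0"
        by (simp add: LIMSEQ_const_iff)
    qed
  qed
  define g where "g s x = indicator (space N) x * max 0 (s * f x)" for s x
  have g: "g s \<in> borel_measurable N" "0 \<le> g s x" for s x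
    using f(1) by (auto simp: g_def[abs_def])
  have gK: "g s x \<le> K" if "x \<in> space N" "s = 1 \<or> s = -1" for s x
    using f(2)[OF that(1)] that by (auto simp: g_def)
  have "(\<Sum>i\<in>I. c i * (LINT x|M i. g s x)) = 0" if "s = 1 \<or> s = -1" for s
    using pos[OF g] gK that by blast
  then have 0: "(\<Sum>i\<in>I. c i * (LINT x|M i. g 1 x)) = 0" "(\<Sum>i\<in>I. c i * (LINT x|M i. g (-1) x)) = 0"
    by blast+
  have "(LINT x|M i. f x) = (LINT x|M i. g 1 x) - (LINT x|M i. g (-1) x)" if i: "i \<in> I" for i
  proof -
    have ig: "integrable (M i) (g s)" if "s = 1 \<or> s = -1" for s
      by (rule int[OF i, where C=K]) (use g gK that in auto)
    have "(LINT x|M i. f x) = (LINT x|M i. g 1 x - g (-1) x)"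
      by (intro Bochner_Integration.integral_cong) (auto simp: g_def space i)
    then show ?thesis using ig by simp
  qed
  then have "(\<Sum>i\<in>I. c i * (LINT x|M i. f x)) =
      (\<Sum>i\<in>I. c i * (LINT x|M i. g 1 x)) - (\<Sum>i\<in>I. c i * (LINT x|M i. g (-1) x))"
    by (simp add: right_diff_distrib sum_subtractf cong: sum.cong)
  then show ?thesis using 0 by simp
qed

text \<open>
  The set function \<open>(|\<mu>| + \<mu>) / 2\<close> is nonnegative and countably additive, hence it is a measure.
\<close>

lemma
  fixes \<mu> :: "'a::euclidean_space set \<Rightarrow> real"
  assumes \<mu>: "Radon_measure \<Omega> \<mu>"
  shows measure_positive_part: "B \<in> borel_on \<Omega> \<Longrightarrow>
      measure (positive_part \<Omega> \<mu>) B = (measure (total_variation \<Omega> \<mu>) B + \<mu> B) / 2"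
    and finite_measure_positive_part: "finite_measure (positive_part \<Omega> \<mu>)"
proof -
  let ?f = "\<lambda>B. (measure (total_variation \<Omega> \<mu>) B + \<mu> B) / 2"
  have pos: "0 \<le> ?f B" for B
    using norm_le_total_variation[OF \<mu>, of B] by (auto simp: real_norm_def)
  interpret tv: finite_measure "total_variation \<Omega> \<mu>" by (rule finite_measure_total_variation[OF \<mu>])
  have ca: "countably_additive (borel_on \<Omega>) (\<lambda>B. ennreal (?f B))"
    unfolding countably_additive_def
  proof (intro allI impI)
    fix F :: "nat \<Rightarrow> 'a set" assume F: "range F \<subseteq> borel_on \<Omega>" "disjoint_family F"
    have s: "(\<lambda>i. ?f (F i)) sums ?f (\<Union>i. F i)"
      using F by (intro sums_divide sums_add Radon_measureD[OF \<mu>] tv.finite_measure_UNION) auto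
    show "(\<Sum>i. ennreal (?f (F i))) = ennreal (?f (\<Union>i. F i))"
      unfolding suminf_ennreal2[OF pos sums_summable[OF s]] sums_unique[OF s] ..
  qed
  have em: "emeasure (positive_part \<Omega> \<mu>) B = ennreal (?f B)" if "B \<in> borel_on \<Omega>" for B
    unfolding positive_part_def
    by (rule emeasure_measure_of_sigma)
      (auto simp: sigma_algebra_borel_on positive_def ca that Radon_measure_empty[OF \<mu>])
  then show "B \<in> borel_on \<Omega> \<Longrightarrow> measure (positive_part \<Omega> \<mu>) B = ?f B"
    using pos by (simp add: measure_def)
  show "finite_measure (positive_part \<Omega> \<mu>)"
  proof (rule finite_measureI)
    have "\<Omega> \<in> borel_on \<Omega>" using sets.top[of "restrict_space borel \<Omega>"] by (simp add: space_restrict_space)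
    then show "emeasure (positive_part \<Omega> \<mu>) (space (positive_part \<Omega> \<mu>)) \<noteq> \<infinity>"
      by (simp add: em space_measure_of_conv positive_part_def[of \<Omega> \<mu>, THEN arg_cong, of space])
  qed
qed

lemma sets_positive_part [simp]: "sets (positive_part \<Omega> \<mu>) = borel_on \<Omega>"
  by (simp add: positive_part_def)

lemma space_positive_part [simp]: "space (positive_part \<Omega> \<mu>) = \<Omega>"
  by (simp add: positive_part_def)

lemma total_variation_uminus [simp]: "total_variation \<Omega> (\<lambda>B. - \<mu> B) = total_variation \<Omega> \<mu>"
  by (simp add: total_variation_def)

lemma Jordan_decomposition:
  fixes \<mu> :: "'a::euclidean_space set \<Rightarrow> real"
  assumes \<mu>: "Radon_measure \<Omega> \<mu>" and B: "B \<in> borel_on \<Omega>"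
  shows "measure (positive_part \<Omega> \<mu>) B - measure (positive_part \<Omega> (\<lambda>B. - \<mu> B)) B = \<mu> B"
    and "measure (positive_part \<Omega> \<mu>) B + measure (positive_part \<Omega> (\<lambda>B. - \<mu> B)) B
          = measure (total_variation \<Omega> \<mu>) B"
  using measure_positive_part[OF \<mu> B] measure_positive_part[OF Radon_measure_uminus[OF \<mu>] B]
  by (auto simp: field_simps)

text \<open>
  Signed integrals are linear in the measure. Stated as a relation, the result covers sums and components of
  vector measures at once.
\<close>

lemma signed_integral_lincomb_eq_0:
  fixes \<mu> :: "'i \<Rightarrow> 'a::euclidean_space set \<Rightarrow> real"
  assumes J: "finite J" and \<mu>: "\<And>j. j \<in> J \<Longrightarrow> Radon_measure \<Omega> (\<mu> j)"
    and zero: "\<And>B. B \<in> borel_on \<Omega> \<Longrightarrow> (\<Sum>j\<in>J. c j * \<mu> j B) = 0"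
    and f: "f \<in> borel_measurable (restrict_space borel \<Omega>)" "\<And>x. x \<in> \<Omega> \<Longrightarrow> \<bar>f x\<bar> \<le> K"
  shows "(\<Sum>j\<in>J. c j * signed_integral \<Omega> (\<mu> j) f) = 0"
proof -
  define M where "M p = (if snd p then positive_part \<Omega> (\<mu> (fst p)) else positive_part \<Omega> (\<lambda>B. - \<mu> (fst p) B))" for p
  define d where "d p = (if snd p then c (fst p) else - c (fst p))" for p
  have split: "(\<Sum>p\<in>J \<times> UNIV. d p * F (M p)) = (\<Sum>j\<in>J. c j * (F (positive_part \<Omega> (\<mu> j)) - F (positive_part \<Omega> (\<lambda>B. - \<mu> j B))))"
    for F :: "'a measure \<Rightarrow> real"
  proof -
    have "(\<Sum>p\<in>J \<times> UNIV. d p * F (M p)) = (\<Sum>j\<in>J. \<Sum>s\<in>UNIV. d (j, s) * F (M (j, s)))"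
      by (simp add: sum.cartesian_product)
    then show ?thesis by (simp add: UNIV_bool d_def M_def algebra_simps)
  qed
  have "(\<Sum>p\<in>J \<times> UNIV. d p * (LINT x|M p. f x)) = 0"
  proof (rule integral_lincomb_eq_0[where N="restrict_space borel \<Omega>" and K=K])
    show "finite_measure (M p)" if "p \<in> J \<times> UNIV" for p
      using finite_measure_positive_part[OF \<mu>] finite_measure_positive_part[OF Radon_measure_uminus[OF \<mu>]] that
      by (auto simp: M_def)
    show "sets (M i) = borel_on \<Omega>" for i by (simp add: M_def)
    show "(\<Sum>p\<in>J \<times> UNIV. d p * measure (M p) B) = 0" if B: "B \<in> borel_on \<Omega>" for B
      using zero[OF B] by (simp add: split[of "\<lambda>M. measure M B"] Jordan_decomposition(1)[OF \<mu> B])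
  qed (use f J in \<open>auto simp: space_restrict_space\<close>)
  then show ?thesis by (simp add: split[of "\<lambda>M. LINT x|M. f x"] signed_integral_def)
qed

text \<open>
  The positive and the negative part add up to the total variation.
\<close>

lemma abs_signed_integral_le:
  fixes \<mu> :: "'a::euclidean_space set \<Rightarrow> real"
  assumes \<mu>: "Radon_measure \<Omega> \<mu>"
    and f: "f \<in> borel_measurable (restrict_space borel \<Omega>)" "\<And>x. x \<in> \<Omega> \<Longrightarrow> \<bar>f x\<bar> \<le> K"
  shows "\<bar>signed_integral \<Omega> \<mu> f\<bar> \<le> (LINT x|total_variation \<Omega> \<mu>. \<bar>f x\<bar>)"
proof -
  define M where "M i = (if i = 0 then positive_part \<Omega> \<mu> else if i = 1 then positive_part \<Omega> (\<lambda>B. - \<mu> B)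
      else total_variation \<Omega> \<mu>)" for i :: nat
  define c where "c i = (if i \<le> 1 then 1 else -1 :: real)" for i :: nat
  have "(\<Sum>i\<in>{0,1,2}. c i * (LINT x|M i. \<bar>f x\<bar>)) = 0"
  proof (rule integral_lincomb_eq_0[where N="restrict_space borel \<Omega>" and K=K])
    show "finite_measure (M i)" for i
      using finite_measure_positive_part[OF \<mu>] finite_measure_positive_part[OF Radon_measure_uminus[OF \<mu>]]
        finite_measure_total_variation[OF \<mu>]
      by (simp add: M_def)
    show "sets (M i) = borel_on \<Omega>" for i by (simp add: M_def)
    show "(\<Sum>i\<in>{0,1,2}. c i * measure (M i) B) = 0" if B: "B \<in> borel_on \<Omega>" for B
      using Jordan_decomposition(2)[OF \<mu> B] by (simp add: M_def c_def)
  qed (use f in \<open>auto simp: space_restrict_space\<close>)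
  moreover have bd: "\<bar>\<integral>x. f x \<partial>N\<bar> \<le> (\<integral>x. \<bar>f x\<bar> \<partial>N)" for N
    using integral_norm_bound[of N f] by simp
  have
    "\<bar>signed_integral \<Omega> \<mu> f\<bar> \<le> (\<integral>x. \<bar>f x\<bar> \<partial>M 0) + (\<integral>x. \<bar>f x\<bar> \<partial>M 1)"
  proof -
    have "signed_integral \<Omega> \<mu> f = (\<integral>x. f x \<partial>M 0) - (\<integral>x. f x \<partial>M 1)"
      by (simp add: signed_integral_def M_def)
    then show ?thesis using bd[of "M 0"] bd[of "M 1"] by linarith
  qed
  ultimately show ?thesis by (simp add: M_def c_def)
qed

lemma integral_dominated_measure:
  fixes f :: "'a \<Rightarrow> real"
  assumes sets: "sets M = sets N" and le: "\<And>B. B \<in> sets N \<Longrightarrow> emeasure M B \<le> ennreal c * emeasure N B"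
    and c: "0 \<le> c" and f: "integrable N f"
  shows "integrable M f" and "(LINT x|M. \<bar>f x\<bar>) \<le> c * (LINT x|N. \<bar>f x\<bar>)"
proof -
  have fM: "f \<in> borel_measurable M"
    using f measurable_cong_sets[OF sets refl] by auto
  have nn: "(\<integral>\<^sup>+x. ennreal \<bar>f x\<bar> \<partial>M) \<le> ennreal c * (\<integral>\<^sup>+x. ennreal \<bar>f x\<bar> \<partial>N)"
  proof -
    have "M \<le> scale_measure (ennreal c) N"
      using sets le by (subst le_measure) (auto simp: sets_scale_measure)
    then have "(\<integral>\<^sup>+x. ennreal \<bar>f x\<bar> \<partial>M) \<le> (\<integral>\<^sup>+x. ennreal \<bar>f x\<bar> \<partial>scale_measure (ennreal c) N)"
      by (rule nn_integral_mono_measure[rotated]) (simp add: sets)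
    also have "\<dots> = ennreal c * (\<integral>\<^sup>+x. ennreal \<bar>f x\<bar> \<partial>N)"
      by (rule nn_integral_scale_measure) (use f in auto)
    finally show ?thesis .
  qed
  have "(\<integral>\<^sup>+x. ennreal \<bar>f x\<bar> \<partial>N) = ennreal (LINT x|N. \<bar>f x\<bar>)"
    by (rule nn_integral_eq_integral) (use f in auto)
  with nn have nn': "(\<integral>\<^sup>+x. ennreal \<bar>f x\<bar> \<partial>M) \<le> ennreal (c * (LINT x|N. \<bar>f x\<bar>))"
    using c by (simp add: ennreal_mult)
  then show i: "integrable M f"
    using fM by (intro integrableI_bounded) (auto intro: le_less_trans)
  have "(\<integral>\<^sup>+x. ennreal \<bar>f x\<bar> \<partial>M) = ennreal (LINT x|M. \<bar>f x\<bar>)"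
    by (rule nn_integral_eq_integral) (use i in auto)
  with nn' show "(LINT x|M. \<bar>f x\<bar>) \<le> c * (LINT x|N. \<bar>f x\<bar>)"
    using c by (simp add: ennreal_le_iff)
qed

text \<open>
  Here \<open>T\<close> is the vector \<open>\<integral> f d\<mu>\<close>. Its square \<open>T \<bullet> T\<close> is the integral of \<open>f\<close> against the scalar measure
  \<open>\<mu> \<bullet> T\<close>, whose total variation is at most \<open>norm T\<close> times that of \<open>\<mu>\<close>.
\<close>

lemma norm_vector_integral_le:
  fixes \<mu> :: "'a::euclidean_space set \<Rightarrow> 'b::euclidean_space"
  assumes \<mu>: "Radon_measure \<Omega> \<mu>"
    and f: "f \<in> borel_measurable (restrict_space borel \<Omega>)" "\<And>x. x \<in> \<Omega> \<Longrightarrow> \<bar>f x\<bar> \<le> K"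
    and T: "\<And>b. b \<in> Basis \<Longrightarrow> T \<bullet> b = signed_integral \<Omega> (\<lambda>B. \<mu> B \<bullet> b) f"
  shows "norm T \<le> (LINT x|total_variation \<Omega> \<mu>. \<bar>f x\<bar>)"
proof -
  let ?I = "LINT x|total_variation \<Omega> \<mu>. \<bar>f x\<bar>"
  \<comment> \<open>The index \<open>None\<close> stands for \<open>\<mu> \<bullet> T\<close>, the others for the coordinates of \<open>\<mu>\<close>.\<close>
  have comb: "signed_integral \<Omega> (\<lambda>B. \<mu> B \<bullet> T) f = (\<Sum>b\<in>Basis. (T \<bullet> b) * signed_integral \<Omega> (\<lambda>B. \<mu> B \<bullet> b) f)"
  proof -
    define J where "J = insert None (Some ` (Basis :: 'b set))"
    define \<nu> where "\<nu> j = (case j of None \<Rightarrow> (\<lambda>B. \<mu> B \<bullet> T) | Some b \<Rightarrow> (\<lambda>B. \<mu> B \<bullet> b))" for j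
    define c where "c j = (case j of None \<Rightarrow> -1 | Some b \<Rightarrow> T \<bullet> b)" for j
    have "(\<Sum>j\<in>J. c j * signed_integral \<Omega> (\<nu> j) f) = 0"
    proof (rule signed_integral_lincomb_eq_0[OF _ _ _ f])
      show "Radon_measure \<Omega> (\<nu> j)" for j
        by (auto simp: \<nu>_def Radon_measure_inner[OF \<mu>] split: option.split)
      show "(\<Sum>j\<in>J. c j * \<nu> j B) = 0" for B
        by (simp add: J_def sum.reindex c_def \<nu>_def euclidean_inner[of "\<mu> B" T] mult.commute)
    qed (auto simp: J_def)
    then show ?thesis by (simp add: J_def sum.reindex c_def \<nu>_def)
  qed
  have "norm T * norm T = T \<bullet> T" by (metis power2_norm_eq_inner power2_eq_square)
  also have "\<dots> = (\<Sum>b\<in>Basis. (T \<bullet> b) * (T \<bullet> b))" by (rule euclidean_inner)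
  also have "\<dots> = signed_integral \<Omega> (\<lambda>B. \<mu> B \<bullet> T) f" unfolding comb by (simp add: T)
  also have "\<dots> \<le> (LINT x|total_variation \<Omega> (\<lambda>B. \<mu> B \<bullet> T). \<bar>f x\<bar>)"
    using abs_signed_integral_le[OF Radon_measure_inner[OF \<mu>] f] by (simp add: abs_le_iff)
  also have "\<dots> \<le> norm T * ?I"
  proof (rule integral_dominated_measure(2))
    show "emeasure (total_variation \<Omega> (\<lambda>B. \<mu> B \<bullet> T)) B \<le> ennreal (norm T) * emeasure (total_variation \<Omega> \<mu>) B"
      if "B \<in> sets (total_variation \<Omega> \<mu>)" for B
    proof (rule total_variation_least[OF Radon_measure_inner[OF \<mu>]])
      fix C assume C: "C \<in> borel_on \<Omega>"
      interpret finite_measure "total_variation \<Omega> \<mu>" by (rule finite_measure_total_variation[OF \<mu>])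
      have "norm (\<mu> C \<bullet> T) \<le> norm T * measure (total_variation \<Omega> \<mu>) C"
        using Cauchy_Schwarz_ineq2[of "\<mu> C" T] mult_left_mono[OF norm_le_total_variation[OF \<mu>, of C] norm_ge_zero[of T]]
        by (simp add: mult.commute)
      then show "ennreal (norm (\<mu> C \<bullet> T)) \<le> ennreal (norm T) * emeasure (total_variation \<Omega> \<mu>) C"
        by (simp add: emeasure_eq_measure ennreal_leI flip: ennreal_mult)
    qed (use that in auto)
    show "integrable (total_variation \<Omega> \<mu>) f"
      by (rule bounded_integrable[OF finite_measure_total_variation[OF \<mu>], of _ K])
        (use f in \<open>auto simp: measurable_cong_sets[OF sets_total_variation refl]\<close>)
  qed auto
  finally have "norm T * norm T \<le> norm T * ?I" .
  moreover have "0 \<le> ?I" by (rule integral_nonneg_AE) auto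
  ultimately show ?thesis by (cases "norm T = 0") auto
qed

section \<open>Smooth functions\<close>

lemma grad_eqI:
  assumes "(f has_derivative (\<lambda>h. g \<bullet> h)) (at x)"
  shows "f differentiable (at x)" "grad f x = g"
proof -
  show "f differentiable (at x)" using assms by (auto simp: differentiable_def)
  have "frechet_derivative f (at x) = (\<lambda>h. g \<bullet> h)"
    using frechet_derivative_at[OF assms] by simp
  then show "grad f x = g" by (simp add: grad_def inner_axis vec_eq_iff)
qed

lemma has_derivative_grad:
  fixes f :: "real^'n \<Rightarrow> real"
  assumes "f differentiable (at x)"
  shows "(f has_derivative (\<lambda>h. grad f x \<bullet> h)) (at x)"
proof -
  let ?D = "frechet_derivative f (at x)"
  have D: "(f has_derivative ?D) (at x)" using assms by (simp add: frechet_derivative_works)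
  then interpret bounded_linear ?D by (rule has_derivative_bounded_linear)
  have "?D h = grad f x \<bullet> h" for h
  proof -
    have "h = (\<Sum>i\<in>UNIV. h $ i *\<^sub>R axis i 1)"
      by (simp add: basis_expansion flip: scalar_mult_eq_scaleR)
    then have "?D h = ?D (\<Sum>i\<in>UNIV. h $ i *\<^sub>R axis i 1)" by simp
    also have "\<dots> = (\<Sum>i\<in>UNIV. h $ i * ?D (axis i 1))" by (simp add: sum scaleR)
    finally show ?thesis by (simp add: inner_vec_def grad_def mult.commute)
  qed
  then have "?D = (\<lambda>h. grad f x \<bullet> h)" by auto
  with D show ?thesis by simp
qed

lemma grad_add:
  fixes f g :: "real^'n \<Rightarrow> real"
  assumes "f differentiable (at x)" "g differentiable (at x)"
  shows "grad (\<lambda>x. f x + g x) x = grad f x + grad g x"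
  by (rule grad_eqI(2))
    (use has_derivative_add[OF assms[THEN has_derivative_grad]] in \<open>simp add: inner_add_left\<close>)

lemma grad_mult:
  fixes f g :: "real^'n \<Rightarrow> real"
  assumes "f differentiable (at x)" "g differentiable (at x)"
  shows "grad (\<lambda>x. f x * g x) x = f x *\<^sub>R grad g x + g x *\<^sub>R grad f x"
  by (rule grad_eqI(2))
    (use has_derivative_mult[OF assms[THEN has_derivative_grad]] in \<open>simp add: inner_add_left algebra_simps\<close>)

lemma grad_const [simp]: "grad (\<lambda>x. c) = (\<lambda>x. 0)"
  by (intro ext grad_eqI(2)) (auto intro!: derivative_eq_intros)

lemma Ck_SucD: "Ck (Suc k) f \<Longrightarrow> Ck k f"
proof (induction k arbitrary: f)
  case 0
  then show ?case
    by (auto intro!: continuous_at_imp_continuous_on differentiable_imp_continuous_within)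
qed auto

lemma Ck_const: "Ck k (\<lambda>x. c)"
  by (induction k arbitrary: c) auto

lemma Ck_add: "Ck k f \<Longrightarrow> Ck k g \<Longrightarrow> Ck k (\<lambda>x. f x + g x)"
proof (induction k arbitrary: f g)
  case 0 then show ?case by (auto intro!: continuous_on_add)
next
  case (Suc k)
  then show ?case by (auto simp: grad_add differentiable_add)
qed

lemma Ck_mult: "Ck k f \<Longrightarrow> Ck k g \<Longrightarrow> Ck k (\<lambda>x. f x * g x)"
proof (induction k arbitrary: f g)
  case 0 then show ?case by (auto intro!: continuous_on_mult)
next
  case (Suc k)
  have fg: "Ck k f" "Ck k g" using Suc.prems by (auto dest!: Ck_SucD simp del: Ck.simps)
  have "grad (\<lambda>x. f x * g x) x $ i = f x * grad g x $ i + g x * grad f x $ i" for x i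
    using Suc.prems by (simp add: grad_mult)
  then show ?case using Suc.prems Suc.IH fg by (auto intro!: Ck_add)
qed

lemma in_closure_support: "\<phi> x \<noteq> 0 \<Longrightarrow> x \<in> closure {x. \<phi> x \<noteq> (0::real)}"
  by (rule subsetD[OF closure_subset]) simp

lemma test_functionsD:
  assumes "\<phi> \<in> test_functions \<Omega>"
  shows "Ck k \<phi>" "compact (closure {x. \<phi> x \<noteq> 0})" "closure {x. \<phi> x \<noteq> 0} \<subseteq> \<Omega>"
    "\<phi> differentiable (at x)" "continuous_on S \<phi>" "continuous_on S (\<lambda>x. grad \<phi> x $ i)"
    "\<phi> x \<noteq> 0 \<Longrightarrow> x \<in> \<Omega>"
proof -
  have C: "Ck k \<phi>" for k using assms by (simp add: test_functions_def)
  then show "Ck k \<phi>" .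
  show c: "compact (closure {x. \<phi> x \<noteq> 0})" "closure {x. \<phi> x \<noteq> 0} \<subseteq> \<Omega>"
    using assms by (auto simp: test_functions_def)
  show "\<phi> differentiable (at x)" using C[of 1] by simp
  show "continuous_on S \<phi>" using C[of 0] continuous_on_subset by auto
  show "continuous_on S (\<lambda>x. grad \<phi> x $ i)" using C[of "Suc 0"] continuous_on_subset[of UNIV _ S] by auto
  show "\<phi> x \<noteq> 0 \<Longrightarrow> x \<in> \<Omega>" using in_closure_support[of \<phi>] c(2) by auto
qed

lemma test_functionsI:
  assumes "\<And>k. Ck k \<phi>" "compact K" "K \<subseteq> \<Omega>" "\<And>x. \<phi> x \<noteq> 0 \<Longrightarrow> x \<in> K"
  shows "\<phi> \<in> test_functions \<Omega>"
proof -
  have "closure {x. \<phi> x \<noteq> 0} \<subseteq> K"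
    using assms by (intro closure_minimal compact_imp_closed) auto
  moreover from this have "compact (closure {x. \<phi> x \<noteq> 0})"
    using compact_Int_closed[OF assms(2) closed_closure] by (metis Int_absorb1)
  ultimately show ?thesis using assms(1,3) unfolding test_functions_def by blast
qed

lemma test_functions_mono: "U \<subseteq> \<Omega> \<Longrightarrow> test_functions U \<subseteq> test_functions \<Omega>"
  by (auto simp: test_functions_def)

lemma test_functions_zero: "(\<lambda>x. 0) \<in> test_functions \<Omega>"
  by (rule test_functionsI[of _ "{}"]) (auto simp: Ck_const)

lemma test_functions_add:
  assumes "\<phi> \<in> test_functions \<Omega>" "\<psi> \<in> test_functions \<Omega>"
  shows "(\<lambda>x. \<phi> x + \<psi> x) \<in> test_functions \<Omega>"
proof (rule test_functionsI[of _ "closure {x. \<phi> x \<noteq> 0} \<union> closure {x. \<psi> x \<noteq> 0}"])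
  fix x assume "\<phi> x + \<psi> x \<noteq> 0"
  then have "\<phi> x \<noteq> 0 \<or> \<psi> x \<noteq> 0" by auto
  then show "x \<in> closure {x. \<phi> x \<noteq> 0} \<union> closure {x. \<psi> x \<noteq> 0}"
    using in_closure_support by blast
qed (use test_functionsD(1-3)[OF assms(1)] test_functionsD(1-3)[OF assms(2)] in
      \<open>auto intro!: Ck_add compact_Un simp del: compact_closure\<close>)

lemma test_functions_mult:
  assumes "\<phi> \<in> test_functions \<Omega>" "\<And>k. Ck k \<psi>"
  shows "(\<lambda>x. \<phi> x * \<psi> x) \<in> test_functions \<Omega>"
  by (rule test_functionsI[of _ "closure {x. \<phi> x \<noteq> 0}"])
    (use test_functionsD(1-3)[OF assms(1)] assms(2) in_closure_support[of \<phi>] in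
      \<open>auto intro!: Ck_mult simp del: compact_closure\<close>)

lemma test_functions_scale:
  assumes "\<phi> \<in> test_functions \<Omega>"
  shows "(\<lambda>x. c * \<phi> x) \<in> test_functions \<Omega>"
  using test_functions_mult[OF assms Ck_const, of c] by (simp add: mult.commute)

lemma test_functions_diff:
  assumes "\<phi> \<in> test_functions \<Omega>" "\<psi> \<in> test_functions \<Omega>"
  shows "(\<lambda>x. \<phi> x - \<psi> x) \<in> test_functions \<Omega>"
  using test_functions_add[OF assms(1) test_functions_scale[OF assms(2), of "-1"]] by simp

lemma grad_test_function_outside:
  assumes "\<phi> \<in> test_functions \<Omega>" "x \<notin> closure {x. \<phi> x \<noteq> 0}"
  shows "grad \<phi> x = 0"
proof (rule grad_eqI(2))
  have "((\<lambda>x. 0) has_derivative (\<lambda>h. 0)) (at x)" by simp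
  then have "(\<phi> has_derivative (\<lambda>h. 0)) (at x)"
    by (rule has_derivative_transform_within_open[where s="- closure {x. \<phi> x \<noteq> 0}"])
      (use assms(2) in_closure_support[of \<phi>] in \<open>auto simp: open_Compl\<close>)
  then show "(\<phi> has_derivative (\<lambda>h. 0 \<bullet> h)) (at x)" by simp
qed

lemma test_function_bounded:
  assumes "\<phi> \<in> test_functions \<Omega>"
  obtains K where "\<And>x. \<bar>\<phi> x\<bar> \<le> K" "\<And>x i. \<bar>grad \<phi> x $ i\<bar> \<le> K" "0 \<le> K"
proof -
  let ?S = "closure {x. \<phi> x \<noteq> 0}"
  have bd: "\<exists>K. \<forall>x. \<bar>f x\<bar> \<le> K" if f: "continuous_on ?S f" "\<And>x. x \<notin> ?S \<Longrightarrow> f x = 0" for f :: "real^'a \<Rightarrow> real"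
  proof -
    have "bounded (f ` ?S)"
      by (intro compact_imp_bounded compact_continuous_image f test_functionsD[OF assms])
    then obtain K where K: "\<And>x. x \<in> ?S \<Longrightarrow> \<bar>f x\<bar> \<le> K" by (auto simp: bounded_iff)
    then have "\<bar>f x\<bar> \<le> max K 0" for x using f(2)[of x] K[of x] by (cases "x \<in> ?S") (auto intro: order_trans[OF _ max.cobounded1])
    then show ?thesis by blast
  qed
  have "\<exists>K. \<forall>x. \<bar>\<phi> x\<bar> \<le> K"
    using closure_subset[of "{x. \<phi> x \<noteq> 0}"] by (intro bd test_functionsD[OF assms]) auto
  then obtain K0 where K0: "\<And>x. \<bar>\<phi> x\<bar> \<le> K0" by blast
  have "\<forall>i. \<exists>K. \<forall>x. \<bar>grad \<phi> x $ i\<bar> \<le> K"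
    by (intro allI bd test_functionsD[OF assms]) (simp add: grad_test_function_outside[OF assms])
  then obtain K where K: "\<And>i x. \<bar>grad \<phi> x $ i\<bar> \<le> K i" by metis
  show ?thesis
  proof (rule that)
    show "\<bar>\<phi> x\<bar> \<le> K0 + (\<Sum>i\<in>UNIV. K i)" "0 \<le> K0 + (\<Sum>i\<in>UNIV. K i)" for x
      using K0[of x] sum_nonneg[of UNIV K] K order_trans[OF abs_ge_zero] by fastforce+
    have "K i \<le> (\<Sum>i\<in>UNIV. K i)" for i
      using K order_trans[OF abs_ge_zero] by (intro member_le_sum) auto
    moreover have "0 \<le> K0" using K0[of 0] by simp
    ultimately show "\<bar>grad \<phi> x $ i\<bar> \<le> K0 + (\<Sum>i\<in>UNIV. K i)" for x i
      using K[where i=i and x=x] by (smt (verit))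
  qed
qed

section \<open>Bump functions\<close>

text \<open>
  All derivatives of \<open>exp (- 1/t)\<close>, extended by \<open>0\<close> to \<open>t \<le> 0\<close>, are linear combinations of these functions.
\<close>

definition flat :: "nat \<Rightarrow> real \<Rightarrow> real" where
  "flat m t = (if 0 < t then exp (- (1 / t)) / t ^ m else 0)"

lemma flat_tendsto_0: "(flat m \<longlongrightarrow> 0) (at_right 0)"
proof -
  have "((\<lambda>t::real. exp (- (1 / t)) / t ^ m) \<longlongrightarrow> 0) (at_right 0)"
  proof -
    have "((\<lambda>s::real. s ^ m / exp s) \<longlongrightarrow> 0) at_top" by (rule tendsto_power_div_exp_0)
    then have "((\<lambda>t::real. inverse t ^ m / exp (inverse t)) \<longlongrightarrow> 0) (at_right 0)"
      by (rule filterlim_compose[OF _ filterlim_inverse_at_top_right])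
    then show ?thesis
      by (simp add: exp_minus field_simps power_inverse)
  qed
  then show ?thesis
    by (rule filterlim_cong[THEN iffD1, rotated -1])
      (auto simp: flat_def eventually_at_filter)
qed

text \<open>
  At \<open>0\<close> the difference quotient of \<open>flat m\<close> is \<open>flat (Suc m)\<close>, which tends to \<open>0\<close>.
\<close>

lemma flat_has_real_derivative:
  "(flat m has_real_derivative (flat (m + 2) t - real m * flat (m + 1) t)) (at t)"
proof -
  consider "t > 0" | "t < 0" | "t = 0" by linarith
  then show ?thesis
  proof cases
    case 1
    have "((\<lambda>t. exp (- (1 / t)) / t ^ m) has_real_derivative (flat (m + 2) t - real m * flat (m + 1) t)) (at t)"
    proof -
      let ?e = "exp (- (1 / t))"
      have "((\<lambda>t. exp (- (1 / t)) / t ^ m) has_real_derivative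
          (?e * (1 / t\<^sup>2) * t ^ m - ?e * (real m * t ^ (m - 1))) / (t ^ m * t ^ m)) (at t)"
        using 1 by (auto intro!: derivative_eq_intros simp: power2_eq_square)
      moreover have "(?e * (1 / t\<^sup>2) * t ^ m - ?e * (real m * t ^ (m - 1))) / (t ^ m * t ^ m)
          = flat (m + 2) t - real m * flat (m + 1) t"
      proof (cases m)
        case (Suc k)
        have "t ^ k \<noteq> 0" using 1 by simp
        then show ?thesis using 1 Suc by (simp add: flat_def power2_eq_square divide_simps) (simp add: algebra_simps)
      qed (use 1 in \<open>simp add: flat_def power2_eq_square\<close>)
      ultimately show ?thesis by simp
    qed
    then show ?thesis
      by (rule has_field_derivative_transform_within_open[where S="{0<..}"])
        (use 1 in \<open>auto simp: flat_def\<close>)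
  next
    case 2
    have "((\<lambda>t. 0) has_real_derivative (flat (m + 2) t - real m * flat (m + 1) t)) (at t)"
      using 2 by (auto simp: flat_def)
    then show ?thesis
      by (rule has_field_derivative_transform_within_open[where S="{..<0}"])
        (use 2 in \<open>auto simp: flat_def\<close>)
  next
    case 3
    have "((\<lambda>h. flat m h / h) \<longlongrightarrow> 0) (at 0)"
      unfolding filterlim_at_split
    proof
      show "((\<lambda>h. flat m h / h) \<longlongrightarrow> 0) (at_left 0)"
        by (rule tendsto_eventually) (auto simp: eventually_at_filter flat_def)
      have "flat m h / h = flat (Suc m) h" for h by (simp add: flat_def)
      then show "((\<lambda>h. flat m h / h) \<longlongrightarrow> 0) (at_right 0)" using flat_tendsto_0 by simp
    qed
    then show ?thesis using 3 by (simp add: DERIV_def flat_def)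
  qed
qed

lemma flat_nonneg: "0 \<le> flat m t"
  by (simp add: flat_def)

lemma flat_0_le_1: "flat 0 t \<le> 1"
  by (simp add: flat_def)

lemma flat_pos: "0 < t \<Longrightarrow> 0 < flat m t"
  by (simp add: flat_def)

lemma flat_nonpos: "t \<le> 0 \<Longrightarrow> flat m t = 0"
  by (simp add: flat_def)

text \<open>
  The radius enters by scaling the argument. The bump is then comparable to its maximum on the ball of half the
  radius, so that the normalised bump is bounded by a constant over the volume of the ball.
\<close>

definition bump :: "nat \<Rightarrow> real \<Rightarrow> real^'n \<Rightarrow> real^'n \<Rightarrow> real" where
  "bump m r a x = flat m (1 - (norm (x - a))\<^sup>2 / r\<^sup>2)"

text \<open>
  A class of functions that is closed under partial derivatives. Membership gives differentiability of every order
  by one induction on the order, without formulas for higher derivatives.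
\<close>

inductive bump_algebra :: "real \<Rightarrow> real^'n \<Rightarrow> (real^'n \<Rightarrow> real) \<Rightarrow> bool" for r a where
  bump: "bump_algebra r a (bump m r a)"
| const: "bump_algebra r a (\<lambda>x. c)"
| coord: "bump_algebra r a (\<lambda>x. x $ i)"
| add: "bump_algebra r a f \<Longrightarrow> bump_algebra r a g \<Longrightarrow> bump_algebra r a (\<lambda>x. f x + g x)"
| mult: "bump_algebra r a f \<Longrightarrow> bump_algebra r a g \<Longrightarrow> bump_algebra r a (\<lambda>x. f x * g x)"

lemma bump_has_derivative:
  "(bump m r a has_derivative (\<lambda>h. ((- 2 / r\<^sup>2 * (bump (m + 2) r a x - real m * bump (m + 1) r a x)) *\<^sub>R (x - a)) \<bullet> h)) (at x)"
proof -
  have "((\<lambda>x. 1 - (x - a) \<bullet> (x - a) * c) has_derivative (\<lambda>h. - 2 * c * ((x - a) \<bullet> h))) (at x)" for c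
    by (auto intro!: derivative_eq_intros simp: inner_commute)
  from this[of "inverse (r\<^sup>2)"] have "((\<lambda>x. 1 - (norm (x - a))\<^sup>2 / r\<^sup>2) has_derivative (\<lambda>h. - 2 / r\<^sup>2 * ((x - a) \<bullet> h))) (at x)"
    by (simp add: power2_norm_eq_inner divide_inverse)
  from has_derivative_compose[OF this flat_has_real_derivative[unfolded has_field_derivative_def]]
  show ?thesis
    unfolding bump_def[abs_def] by (rule has_derivative_eq_rhs) (simp add: fun_eq_iff mult_ac)
qed

lemma grad_bump: "grad (bump m r a) x = (- 2 / r\<^sup>2 * (bump (m + 2) r a x - real m * bump (m + 1) r a x)) *\<^sub>R (x - a)"
  by (rule grad_eqI(2)[OF bump_has_derivative])

lemma bump_algebra_closed:
  assumes "bump_algebra r a f"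
  shows "(\<forall>x. f differentiable (at x)) \<and> (\<forall>i. bump_algebra r a (\<lambda>x. grad f x $ i))"
  using assms
proof (induction rule: bump_algebra.induct)
  case (bump m)
  have "bump_algebra r a (\<lambda>x. (- 2 / r\<^sup>2 * (bump (m + 2) r a x + (- real m) * bump (m + 1) r a x)) * (x $ i + (- a $ i)))" for i
    by (intro bump_algebra.intros)
  then show ?case using grad_eqI(1)[OF bump_has_derivative] by (auto simp: grad_bump)
next
  case (const c)
  then show ?case by (auto intro: bump_algebra.intros)
next
  case (coord j)
  have "((\<lambda>x. x $ j) has_derivative (\<lambda>h. axis j 1 \<bullet> h)) (at x)" for x :: "real^'a"
    by (auto simp: inner_axis' intro!: bounded_linear_imp_has_derivative bounded_linear_vec_nth)
  from grad_eqI[OF this] show ?case by (auto intro: bump_algebra.intros)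
next
  case (add f g)
  then have "(\<lambda>x. grad (\<lambda>x. f x + g x) x $ i) = (\<lambda>x. grad f x $ i + grad g x $ i)" for i
    by (auto simp: grad_add)
  then show ?case using add by (auto intro!: bump_algebra.intros differentiable_add)
next
  case (mult f g)
  then have "(\<lambda>x. grad (\<lambda>x. f x * g x) x $ i) = (\<lambda>x. f x * grad g x $ i + g x * grad f x $ i)" for i
    by (auto simp: grad_mult)
  then show ?case using mult by (auto intro!: bump_algebra.intros differentiable_mult)
qed

lemma bump_algebra_Ck: "bump_algebra r a f \<Longrightarrow> Ck k f"
proof (induction k arbitrary: f)
  case 0
  then show ?case using bump_algebra_closed[OF 0]
    by (auto intro!: continuous_at_imp_continuous_on differentiable_imp_continuous_within)
next
  case (Suc k)
  then show ?case using bump_algebra_closed[OF Suc.prems] by auto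
qed

lemma Ck_bump: "Ck k (bump m r a)"
  by (rule bump_algebra_Ck[OF bump_algebra.bump])

lemma bump_commute: "bump m r a x = bump m r x a"
  by (simp add: bump_def norm_minus_commute)

lemma bump_nonneg: "0 \<le> bump m r a x"
  by (simp add: bump_def flat_nonneg)

lemma bump_0_le_1: "bump 0 r a x \<le> 1"
  by (simp add: bump_def flat_0_le_1)

lemma bump_outside: "0 < r \<Longrightarrow> r \<le> norm (x - a) \<Longrightarrow> bump m r a x = 0"
  unfolding bump_def by (rule flat_nonpos) (simp add: power_mono)

lemma bump_pos: "norm (x - a) < r \<Longrightarrow> 0 < bump m r a x"
  unfolding bump_def using norm_ge_zero[of "x - a"]
  by (intro flat_pos) (simp add: power_strict_mono divide_less_eq)

lemma bump_test_function:
  assumes "0 < r" "cball a r \<subseteq> \<Omega>"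
  shows "bump m r a \<in> test_functions \<Omega>"
  by (rule test_functionsI[of _ "cball a r"])
    (use assms bump_outside[OF assms(1), where a=a] linear[of r] in
      \<open>auto simp: Ck_bump dist_norm norm_minus_commute[of a]\<close>)

text \<open>
  If \<open>1 - f\<close> and \<open>1 - g\<close> have compact support, so has
  \<open>1 - f g = (1 - f) + (1 - g) - (1 - f) (1 - g)\<close>.
\<close>

lemma test_functions_one_minus_mult:
  assumes "(\<lambda>x. 1 - f x) \<in> test_functions V" "(\<lambda>x. 1 - g x) \<in> test_functions V"
  shows "(\<lambda>x. 1 - f x * g x) \<in> test_functions V"
proof -
  have "(\<lambda>x. (1 - f x) + ((1 - g x) - (1 - f x) * (1 - g x))) \<in> test_functions V"
    by (rule test_functions_add[OF assms(1) test_functions_diff[OF assms(2)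
          test_functions_mult[OF assms(1) test_functionsD(1)[OF assms(2)]]]])
  then show ?thesis by (simp add: algebra_simps)
qed

lemma test_functions_one_minus_power:
  "(\<lambda>x. 1 - f x) \<in> test_functions V \<Longrightarrow> (\<lambda>x. 1 - f x ^ n) \<in> test_functions V"
  by (induction n) (auto intro: test_functions_one_minus_mult simp: test_functions_zero)

lemma test_functions_one_minus_prod:
  fixes f :: "nat \<Rightarrow> real^'n \<Rightarrow> real"
  shows "(\<And>i. (\<lambda>x. 1 - f i x) \<in> test_functions V) \<Longrightarrow> (\<lambda>x. 1 - (\<Prod>i<n. f i x)) \<in> test_functions V"
  by (induction n) (auto intro: test_functions_one_minus_mult simp: test_functions_zero)

text \<open>
  The open set is a countable union of balls. If \<open>\<psi> i\<close> is the bump on the \<open>i\<close>-th ball, then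
  \<open>1 - (\<Prod>i<n. (1 - \<psi> i)^n)\<close> is a polynomial in finitely many bumps without constant term, lies between \<open>0\<close> and \<open>1\<close>, and
  tends to \<open>1\<close> wherever some \<open>\<psi> i\<close> is positive.
\<close>

lemma open_indicator_limit_of_test_functions:
  fixes V :: "(real^'n) set"
  assumes "open V"
  obtains \<phi> where "\<And>n::nat. \<phi> n \<in> test_functions V" "\<And>n x. 0 \<le> \<phi> n x" "\<And>n x. \<phi> n x \<le> 1"
    "\<And>x. (\<lambda>n. \<phi> n x) \<longlonglongrightarrow> indicator V x"
proof (cases "V = {}")
  case True
  then show ?thesis by (intro that[of "\<lambda>_ _. 0"]) (auto simp: test_functions_zero)
next
  case False
  define F where "F = {ball a r | a r. 0 < r \<and> cball a r \<subseteq> V}"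
  obtain F' where F': "F' \<subseteq> F" "countable F'" "\<Union>F' = \<Union>F"
    by (rule Lindelof[of F]) (auto simp: F_def)
  have "x \<in> \<Union>F" if x: "x \<in> V" for x
  proof -
    obtain r where "0 < r" "cball x r \<subseteq> V" using assms x open_contains_cball by blast
    then have "ball x r \<in> F" "x \<in> ball x r" by (auto simp: F_def)
    then show ?thesis by blast
  qed
  moreover have "\<Union>F \<subseteq> V" using ball_subset_cball unfolding F_def by blast
  ultimately have V: "\<Union>F' = V" using F' by blast
  then have ne: "F' \<noteq> {}" using False by auto
  have "\<forall>n. \<exists>a r. from_nat_into F' n = ball a r \<and> 0 < r \<and> cball a r \<subseteq> V"
    using from_nat_into[OF ne] F'(1) unfolding F_def by blast
  then obtain a r where ar: "\<And>n. from_nat_into F' n = ball (a n) (r n)" "\<And>n. 0 < r n" "\<And>n. cball (a n) (r n) \<subseteq> V"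
    by metis
  define \<psi> where "\<psi> n = bump 0 (r n) (a n)" for n
  \<comment> \<open>The exponent grows with the number of factors, so that one sequence does for all points.\<close>
  define q where "q n x = (\<Prod>i<n. (1 - \<psi> i x) ^ n)" for n :: nat and x
  have \<psi>: "\<psi> n \<in> test_functions V" "0 \<le> \<psi> n x" "\<psi> n x \<le> 1" for n x
    using bump_test_function[OF ar(2) ar(3)] by (auto simp: \<psi>_def bump_nonneg bump_0_le_1)
  have q: "0 \<le> q n x" "q n x \<le> 1" for n x
    using \<psi> by (auto simp: q_def intro!: prod_nonneg prod_le_1 power_le_one)
  show ?thesis
  proof (rule that[of "\<lambda>n x. 1 - q n x"])
    show "(\<lambda>x. 1 - q n x) \<in> test_functions V" for n
      unfolding q_def by (intro test_functions_one_minus_prod test_functions_one_minus_power) (simp add: \<psi>)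
    show "(\<lambda>n. 1 - q n x) \<longlonglongrightarrow> indicator V x" for x
    proof (cases "x \<in> V")
      case True
      then obtain B where "B \<in> F'" "x \<in> B" using V by auto
      then obtain i where "x \<in> ball (a i) (r i)"
        using from_nat_into_surj[OF F'(2)] ar(1) by metis
      then have pos: "0 < \<psi> i x" unfolding \<psi>_def by (intro bump_pos) (simp add: dist_norm norm_minus_commute)
      have "(\<lambda>n. q n x) \<longlonglongrightarrow> 0"
      proof (rule tendsto_sandwich[of "\<lambda>_. 0"])
        show "(\<lambda>n. (1 - \<psi> i x) ^ n) \<longlonglongrightarrow> 0" using pos \<psi>(2,3)[where n=i and x=x] by (intro LIMSEQ_realpow_zero) auto
        have "q n x \<le> (1 - \<psi> i x) ^ n" if "i < n" for n
        proof -
          have "q n x = (1 - \<psi> i x) ^ n * (\<Prod>j\<in>{..<n} - {i}. (1 - \<psi> j x) ^ n)"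
            unfolding q_def using that by (intro prod.remove) auto
          also have "\<dots> \<le> (1 - \<psi> i x) ^ n * 1"
            using \<psi> by (intro mult_left_mono prod_le_1) (auto intro!: power_le_one)
          finally show ?thesis by simp
        qed
        then show "\<forall>\<^sub>F n in sequentially. q n x \<le> (1 - \<psi> i x) ^ n"
          by (rule eventually_mono[OF eventually_gt_at_top[of i]])
      qed (use q in auto)
      then have "(\<lambda>n. 1 - q n x) \<longlonglongrightarrow> 1 - 0" by (intro tendsto_diff tendsto_const)
      then show ?thesis using True by simp
    next
      case False
      then have "\<psi> i x = 0" for i using test_functionsD(7)[OF \<psi>(1)] by blast
      then show ?thesis using False by (simp add: q_def)
    qed
  qed (use q in auto)
qed

section \<open>Approximating Borel sets by test functions\<close>

lemma borel_on_iff: "open \<Omega> \<Longrightarrow> B \<in> borel_on \<Omega> \<longleftrightarrow> B \<in> sets borel \<and> B \<subseteq> \<Omega>"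
  by (auto simp: sets_restrict_space_iff)

lemma borel_on_sigma_sets:
  assumes "open U"
  shows "borel_on U = sigma_sets U {V. open V \<and> V \<subseteq> U}"
proof -
  have "borel_on U = (\<inter>) U ` sigma_sets UNIV {S. open S}"
    by (simp add: sets_restrict_space borel_def)
  also have "\<dots> = sigma_sets U ((\<inter>) U ` {S. open S})"
    using assms by (intro sigma_sets_Int) auto
  also have "(\<inter>) U ` {S. open S} = {V. open V \<and> V \<subseteq> U}"
    using assms by (auto simp: image_iff)
  finally show ?thesis .
qed

lemma borel_measurable_continuous_on_restrict_UNIV:
  "continuous_on UNIV f \<Longrightarrow> f \<in> borel_measurable (restrict_space borel \<Omega>)"
  by (intro measurable_restrict_space1 borel_measurable_continuous_onI)

lemma test_function_measurable:
  "\<phi> \<in> test_functions \<Omega> \<Longrightarrow> \<phi> \<in> borel_measurable (restrict_space borel S)"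
  "\<phi> \<in> test_functions \<Omega> \<Longrightarrow> \<phi> \<in> borel_measurable borel"
  by (auto intro!: borel_measurable_continuous_on_restrict_UNIV borel_measurable_continuous_onI
      test_functionsD(5))

lemma test_function_integrable:
  assumes "finite_measure M" "sets M = borel_on S" "\<phi> \<in> test_functions \<Omega>"
  shows "integrable M \<phi>"
proof -
  obtain K where "\<And>x. \<bar>\<phi> x\<bar> \<le> K" using test_function_bounded[OF assms(3)] by metis
  then show ?thesis
    using assms test_function_measurable(1)[OF assms(3)] measurable_cong_sets[OF assms(2) refl]
    by (intro bounded_integrable[of M \<phi> K]) auto
qed

text \<open>
  The sets whose indicators are limits of test functions in \<open>L\<^sup>1(m)\<close> contain the open sets and form a Dynkin
  system. The approximating functions are supported in \<open>U\<close>, so that estimates which hold on \<open>U\<close> only apply to them.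
\<close>

lemma test_functions_approximate_indicator:
  fixes U :: "(real^'n) set"
  assumes U: "open U" "U \<subseteq> \<Omega>" and m: "finite_measure m" "sets m = borel_on \<Omega>"
    and B: "B \<in> borel_on U" and e: "0 < (e::real)"
  shows "\<exists>\<phi>\<in>test_functions U. (LINT x|m. \<bar>\<phi> x - indicator B x\<bar>) < e"
proof -
  interpret finite_measure m by fact
  have UB: "C \<in> sets m" if "C \<in> borel_on U" for C
  proof -
    have "C \<in> sets borel" "\<Omega> \<inter> C = C" using that U by (auto simp: borel_on_iff)
    then show ?thesis unfolding m(2) sets_restrict_space by (metis image_eqI)
  qed
  have int: "integrable m \<phi>" if "\<phi> \<in> test_functions U" for \<phi>
    by (rule test_function_integrable[OF m that])
  define P where "P C \<longleftrightarrow> (\<forall>e>0. \<exists>\<phi>\<in>test_functions U. (LINT x|m. \<bar>\<phi> x - indicator C x\<bar>) < e)" for C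
  have Iint: "integrable m (indicat_real C)" if "C \<in> borel_on U" for C
    by (rule integrable_real_indicator[OF UB[OF that]]) (simp add: emeasure_eq_measure)
  have Pint: "integrable m (\<lambda>x. \<bar>\<phi> x - indicator C x\<bar>)" if "\<phi> \<in> test_functions U" "C \<in> borel_on U" for \<phi> C
    using int[OF that(1)] Iint[OF that(2)] by (intro integrable_abs Bochner_Integration.integrable_diff)
  have open_P: "P V" if V: "open V" "V \<subseteq> U" for V
    unfolding P_def
  proof (intro allI impI)
    fix e :: real assume "0 < e"
    obtain \<phi> where \<phi>: "\<And>n::nat. \<phi> n \<in> test_functions V" "\<And>n x. 0 \<le> \<phi> n x" "\<And>n x. \<phi> n x \<le> 1"
      "\<And>x. (\<lambda>n. \<phi> n x) \<longlonglongrightarrow> indicator V x"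
      using open_indicator_limit_of_test_functions[OF V(1)] by blast
    have \<phi>U: "\<phi> n \<in> test_functions U" for n using \<phi>(1) test_functions_mono[OF V(2)] by blast
    have VU: "V \<in> borel_on U" using V U by (simp add: borel_on_iff)
    have "(\<lambda>n. LINT x|m. \<bar>\<phi> n x - indicator V x\<bar>) \<longlonglongrightarrow> (LINT x|m. 0)"
    proof (rule integral_dominated_convergence[where w="\<lambda>_. 1"])
      show "AE x in m. (\<lambda>n. \<bar>\<phi> n x - indicator V x\<bar>) \<longlonglongrightarrow> 0"
        using \<phi>(4) by (intro AE_I2 tendsto_rabs_zero) (simp add: LIM_zero)
      show "AE x in m. norm \<bar>\<phi> n x - indicator V x\<bar> \<le> 1" for n
      proof (rule AE_I2)
        fix x show "norm \<bar>\<phi> n x - indicator V x\<bar> \<le> 1"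
          using \<phi>(2)[of n x] \<phi>(3)[of n x] by (cases "x \<in> V") auto
      qed
    qed (use Pint[OF \<phi>U VU] in auto)
    then have "eventually (\<lambda>n. (LINT x|m. \<bar>\<phi> n x - indicator V x\<bar>) < e) sequentially"
      using \<open>0 < e\<close> by (auto dest: order_tendstoD(2))
    then show "\<exists>\<phi>\<in>test_functions U. (LINT x|m. \<bar>\<phi> x - indicator V x\<bar>) < e"
      using \<phi>U by (auto simp: eventually_sequentially)
  qed
  have le_add: "(LINT x|m. f x) \<le> (LINT x|m. g x) + (LINT x|m. h x)"
    if "integrable m f" "integrable m g" "integrable m h" "\<And>x. f x \<le> g x + h x" for f g h :: "_ \<Rightarrow> real"
    using integral_mono[OF that(1) Bochner_Integration.integrable_add[OF that(2,3)] that(4)] that(2,3) by simp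
  have "Int_stable {V. open V \<and> V \<subseteq> U}" "{V. open V \<and> V \<subseteq> U} \<subseteq> Pow U"
    "B \<in> sigma_sets U {V. open V \<and> V \<subseteq> U}"
    using B by (auto simp: Int_stable_def borel_on_sigma_sets[OF U(1)])
  then have "P B"
  proof (induction rule: sigma_sets_induct_disjoint)
    case (basic A) then show ?case using open_P by auto
  next
    case empty then show ?case using open_P by auto
  next
    case (compl A)
    have A: "A \<in> borel_on U" using compl borel_on_sigma_sets[OF U(1)] by auto
    have UU: "U \<in> borel_on U" using U by (simp add: borel_on_iff)
    then have UA: "U - A \<in> borel_on U" using A by auto
    have AU: "A \<subseteq> U" using A U by (auto simp: borel_on_iff)
    show ?case unfolding P_def
    proof (intro allI impI)
      fix e :: real assume "0 < e"
      then have "0 < e/2" by simp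
      obtain \<phi> where \<phi>: "\<phi> \<in> test_functions U" "(LINT x|m. \<bar>\<phi> x - indicator A x\<bar>) < e/2"
        using compl(2) \<open>0 < e/2\<close> unfolding P_def by blast
      obtain \<psi> where \<psi>: "\<psi> \<in> test_functions U" "(LINT x|m. \<bar>\<psi> x - indicator U x\<bar>) < e/2"
        using open_P[OF U(1) order_refl] \<open>0 < e/2\<close> unfolding P_def by blast
      have d: "(\<lambda>x. \<psi> x - \<phi> x) \<in> test_functions U" by (rule test_functions_diff[OF \<psi>(1) \<phi>(1)])
      have "(LINT x|m. \<bar>(\<psi> x - \<phi> x) - indicator (U - A) x\<bar>)
          \<le> (LINT x|m. \<bar>\<psi> x - indicator U x\<bar>) + (LINT x|m. \<bar>\<phi> x - indicator A x\<bar>)"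
        using AU by (intro le_add Pint[OF d UA] Pint[OF \<psi>(1) UU] Pint[OF \<phi>(1) A]) (auto simp: indicator_def)
      then show "\<exists>\<phi>\<in>test_functions U. (LINT x|m. \<bar>\<phi> x - indicator (U - A) x\<bar>) < e"
        using d \<phi> \<psi> by (intro bexI[OF _ d]) linarith
    qed
  next
    case (union A)
    have A: "A i \<in> borel_on U" for i using union borel_on_sigma_sets[OF U(1)] by auto
    have UA: "(\<Union>i<n. A i) \<in> borel_on U" "(\<Union>i. A i) \<in> borel_on U" for n :: nat using A by auto
    have fin: "P (\<Union>i<n. A i)" for n
    proof (induction n)
      case 0 then show ?case using open_P[of "{}"] by auto
    next
      case (Suc n)
      have disj: "(\<Union>i<n. A i) \<inter> A n = {}"
        by (rule disjoint_family_UN_lessThan_Int[OF union(1)])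
      show ?case unfolding P_def
      proof (intro allI impI)
        fix e :: real assume "0 < e"
        then have "0 < e/2" by simp
        obtain \<phi> where \<phi>: "\<phi> \<in> test_functions U" "(LINT x|m. \<bar>\<phi> x - indicator (\<Union>i<n. A i) x\<bar>) < e/2"
          using Suc \<open>0 < e/2\<close> unfolding P_def by blast
        obtain \<psi> where \<psi>: "\<psi> \<in> test_functions U" "(LINT x|m. \<bar>\<psi> x - indicator (A n) x\<bar>) < e/2"
          using union(3) \<open>0 < e/2\<close> unfolding P_def by blast
        have d: "(\<lambda>x. \<phi> x + \<psi> x) \<in> test_functions U" by (rule test_functions_add[OF \<phi>(1) \<psi>(1)])
        have ieq: "indicator (\<Union>i<Suc n. A i) x = (indicator (\<Union>i<n. A i) x + indicator (A n) x :: real)" for x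
          using disj by (simp add: lessThan_Suc Un_commute indicator_add)
        have "\<bar>(\<phi> x + \<psi> x) - indicator (\<Union>i<Suc n. A i) x\<bar>
            \<le> \<bar>\<phi> x - indicator (\<Union>i<n. A i) x\<bar> + \<bar>\<psi> x - indicator (A n) x\<bar>" for x
          unfolding ieq by linarith
        then have "(LINT x|m. \<bar>(\<phi> x + \<psi> x) - indicator (\<Union>i<Suc n. A i) x\<bar>)
            \<le> (LINT x|m. \<bar>\<phi> x - indicator (\<Union>i<n. A i) x\<bar>) + (LINT x|m. \<bar>\<psi> x - indicator (A n) x\<bar>)"
          by (intro le_add Pint[OF d UA(1)] Pint[OF \<psi>(1) A] Pint[OF \<phi>(1) UA(1)])
        then show "\<exists>\<phi>\<in>test_functions U. (LINT x|m. \<bar>\<phi> x - indicator (\<Union>i<Suc n. A i) x\<bar>) < e"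
          using d \<phi> \<psi> by (intro bexI[OF _ d]) linarith
      qed
    qed
    show ?case unfolding P_def
    proof (intro allI impI)
      fix e :: real assume "0 < e"
      then have "0 < e/2" by simp
      have L: "(\<lambda>n. LINT x|m. \<bar>indicator (\<Union>i<n. A i) x - indicator (\<Union>i. A i) x\<bar>) \<longlonglongrightarrow> (LINT x|m. (0::real))"
      proof (rule integral_dominated_convergence[where w="\<lambda>_. 1"])
        show "AE x in m. (\<lambda>n. \<bar>indicator (\<Union>i<n. A i) x - indicator (\<Union>i. A i) x\<bar>) \<longlonglongrightarrow> (0::real)"
        proof (intro AE_I2)
          fix x
          have "eventually (\<lambda>n. \<bar>indicator (\<Union>i<n. A i) x - indicator (\<Union>i. A i) x\<bar> = (0::real)) sequentially"
          proof (cases "x \<in> (\<Union>i. A i)")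
            case True
            then obtain i where "x \<in> A i" by auto
            then show ?thesis by (intro eventually_mono[OF eventually_gt_at_top[of i]]) (auto simp: indicator_def)
          qed (auto simp: indicator_def)
          then show "(\<lambda>n. \<bar>indicator (\<Union>i<n. A i) x - indicator (\<Union>i. A i) x\<bar>) \<longlonglongrightarrow> (0::real)"
            by (rule tendsto_eventually)
        qed
        show "(\<lambda>x. \<bar>indicator (\<Union>i<n. A i) x - indicator (\<Union>i. A i) x\<bar> :: real) \<in> borel_measurable m" for n
          using UA UB by (intro borel_measurable_abs borel_measurable_diff borel_measurable_indicator) auto
        show "AE x in m. norm \<bar>indicator (\<Union>i<n. A i) x - indicator (\<Union>i. A i) x :: real\<bar> \<le> 1" for n
          by (auto simp: indicator_def)
      qed auto
      have "eventually (\<lambda>n. (LINT x|m. \<bar>indicator (\<Union>i<n. A i) x - indicator (\<Union>i. A i) x\<bar>) < e/2) sequentially"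
        by (rule order_tendstoD(2)[OF L[unfolded Bochner_Integration.integral_zero] \<open>0 < e/2\<close>])
      then obtain n where n: "(LINT x|m. \<bar>indicator (\<Union>i<n. A i) x - indicator (\<Union>i. A i) x\<bar>) < e/2"
        by (auto simp: eventually_sequentially)
      obtain \<phi> where \<phi>: "\<phi> \<in> test_functions U" "(LINT x|m. \<bar>\<phi> x - indicator (\<Union>i<n. A i) x\<bar>) < e/2"
        using fin \<open>0 < e/2\<close> unfolding P_def by blast
      have "(LINT x|m. \<bar>\<phi> x - indicator (\<Union>i. A i) x\<bar>)
          \<le> (LINT x|m. \<bar>\<phi> x - indicator (\<Union>i<n. A i) x\<bar>) + (LINT x|m. \<bar>indicator (\<Union>i<n. A i) x - indicator (\<Union>i. A i) x\<bar>)"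
        using Iint[OF UA(1)] Iint[OF UA(2)]
        by (intro le_add Pint[OF \<phi>(1) UA(2)] Pint[OF \<phi>(1) UA(1)]) auto
      then show "\<exists>\<phi>\<in>test_functions U. (LINT x|m. \<bar>\<phi> x - indicator (\<Union>i. A i) x\<bar>) < e"
        using n \<phi> by (intro bexI[OF _ \<phi>(1)]) linarith
    qed
  qed
  then show ?thesis using e by (auto simp: P_def)
qed

section \<open>Linearity of signed integrals in the integrand\<close>

lemma signed_integral_indicator:
  assumes "Radon_measure \<Omega> \<mu>" "B \<in> borel_on \<Omega>"
  shows "signed_integral \<Omega> \<mu> (indicator B) = \<mu> B"
  using Jordan_decomposition(1)[OF assms] assms(2) sets.sets_into_space[OF assms(2)]
  by (simp add: signed_integral_def space_restrict_space Int_absorb2)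

lemma signed_integral_diff_integrand:
  assumes \<mu>: "Radon_measure \<Omega> \<mu>"
    and f: "f \<in> borel_measurable (restrict_space borel \<Omega>)" "\<And>x. x \<in> \<Omega> \<Longrightarrow> \<bar>f x\<bar> \<le> K"
    and g: "g \<in> borel_measurable (restrict_space borel \<Omega>)" "\<And>x. x \<in> \<Omega> \<Longrightarrow> \<bar>g x\<bar> \<le> L"
  shows "signed_integral \<Omega> \<mu> (\<lambda>x. f x - g x) = signed_integral \<Omega> \<mu> f - signed_integral \<Omega> \<mu> g"
proof -
  have "integrable (positive_part \<Omega> \<nu>) f" "integrable (positive_part \<Omega> \<nu>) g" if "Radon_measure \<Omega> \<nu>" for \<nu>
    by (rule bounded_integrable[OF finite_measure_positive_part[OF that]];
        use f g in \<open>auto simp: measurable_cong_sets[OF sets_positive_part refl]\<close>)+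
  from this[OF \<mu>] this[OF Radon_measure_uminus[OF \<mu>]] show ?thesis
    by (simp add: signed_integral_def)
qed

section \<open>Uniqueness of the representing measure\<close>

lemma Radon_measure_eq_0:
  fixes \<mu> :: "(real^'n) set \<Rightarrow> real"
  assumes \<Omega>: "open \<Omega>" and \<mu>: "Radon_measure \<Omega> \<mu>"
    and zero: "\<And>\<phi>. \<phi> \<in> test_functions \<Omega> \<Longrightarrow> signed_integral \<Omega> \<mu> \<phi> = 0"
  shows "\<mu> B = 0"
proof (cases "B \<in> borel_on \<Omega>")
  case B: True
  have "\<bar>\<mu> B\<bar> \<le> e" if e: "0 < e" for e
  proof -
    obtain \<phi> where \<phi>: "\<phi> \<in> test_functions \<Omega>" "(LINT x|total_variation \<Omega> \<mu>. \<bar>\<phi> x - indicator B x\<bar>) < e"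
      using test_functions_approximate_indicator[OF \<Omega> order_refl finite_measure_total_variation[OF \<mu>]
          sets_total_variation B e] by blast
    obtain K where K: "\<And>x. \<bar>\<phi> x\<bar> \<le> K" using test_function_bounded[OF \<phi>(1)] by metis
    have ind: "(indicator B :: _ \<Rightarrow> real) \<in> borel_measurable (restrict_space borel \<Omega>)" "\<bar>indicator B x :: real\<bar> \<le> 1" for x
      using B by auto
    have "\<mu> B = signed_integral \<Omega> \<mu> (indicator B) - signed_integral \<Omega> \<mu> \<phi>"
      by (simp add: signed_integral_indicator[OF \<mu> B] zero[OF \<phi>(1)])
    also have "\<dots> = signed_integral \<Omega> \<mu> (\<lambda>x. indicator B x - \<phi> x)"
      by (rule signed_integral_diff_integrand[OF \<mu> ind test_function_measurable(1)[OF \<phi>(1)] K, symmetric])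
    also have "\<bar>\<dots>\<bar> \<le> (LINT x|total_variation \<Omega> \<mu>. \<bar>indicator B x - \<phi> x\<bar>)"
    proof (rule abs_signed_integral_le[OF \<mu>, where K="1 + K"])
      show "(\<lambda>x. indicator B x - \<phi> x) \<in> borel_measurable (restrict_space borel \<Omega>)"
        by (intro borel_measurable_diff ind test_function_measurable(1)[OF \<phi>(1)])
      show "\<bar>indicator B x - \<phi> x\<bar> \<le> 1 + K" for x
        using abs_triangle_ineq4[of "indicator B x" "\<phi> x"] ind(2)[of x] K[of x] by linarith
    qed
    also have "\<dots> < e" using \<phi>(2) by (simp add: abs_minus_commute)
    finally show ?thesis by simp
  qed
  then have "\<bar>\<mu> B\<bar> \<le> 0" by (rule field_le_epsilon[of _ 0, simplified])
  then show ?thesis by simp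
qed (rule Radon_measure_outside[OF \<mu>])

lemma represents_unique:
  fixes T :: "(real^'n \<Rightarrow> real) \<Rightarrow> 'b::euclidean_space"
  assumes \<Omega>: "open \<Omega>" and \<mu>: "represents \<Omega> T \<mu>" and \<nu>: "represents \<Omega> T \<nu>"
  shows "\<mu> = \<nu>"
proof (rule ext, rule euclidean_eqI)
  fix B and b :: 'b assume b: "b \<in> Basis"
  have R: "Radon_measure \<Omega> (\<lambda>B. \<mu> B \<bullet> b)" "Radon_measure \<Omega> (\<lambda>B. \<nu> B \<bullet> b)"
    using \<mu> \<nu> unfolding represents_def by (blast intro: Radon_measure_inner)+
  define \<rho> where "\<rho> = (\<lambda>B. \<mu> B \<bullet> b - \<nu> B \<bullet> b)"
  have \<rho>: "Radon_measure \<Omega> \<rho>"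
    using Radon_measure_add[OF R(1) Radon_measure_uminus[OF R(2)]] by (simp add: \<rho>_def)
  have "\<rho> B = 0"
  proof (rule Radon_measure_eq_0[OF \<Omega> \<rho>])
    fix \<phi> assume \<phi>: "\<phi> \<in> test_functions \<Omega>"
    obtain K where K: "\<And>x. \<bar>\<phi> x\<bar> \<le> K" using test_function_bounded[OF \<phi>] by metis
    define \<sigma> where "\<sigma> i = (if i = 0 then \<rho> else if i = 1 then (\<lambda>B. \<mu> B \<bullet> b) else (\<lambda>B. \<nu> B \<bullet> b))" for i :: nat
    define c where "c i = (if i = 1 then 1 else if i = 0 then -1 else - 1 :: real)" for i :: nat
    have "(\<Sum>i\<in>{0,1,2}. c i * signed_integral \<Omega> (\<sigma> i) \<phi>) = 0"
      by (rule signed_integral_lincomb_eq_0[OF _ _ _ test_function_measurable(1)[OF \<phi>] K])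
        (use R \<rho> in \<open>auto simp: \<sigma>_def c_def \<rho>_def\<close>)
    moreover have "signed_integral \<Omega> (\<lambda>B. \<mu> B \<bullet> b) \<phi> = signed_integral \<Omega> (\<lambda>B. \<nu> B \<bullet> b) \<phi>"
      using \<mu> \<nu> \<phi> b unfolding represents_def by metis
    ultimately show "signed_integral \<Omega> \<rho> \<phi> = 0" by (simp add: \<sigma>_def c_def)
  qed
  then show "\<mu> B \<bullet> b = \<nu> B \<bullet> b" by (simp add: \<rho>_def)
qed

lemma the_measure_eqI: "open \<Omega> \<Longrightarrow> represents \<Omega> T \<mu> \<Longrightarrow> the_measure \<Omega> T = \<mu>"
  unfolding the_measure_def by (rule some_equality) (auto intro: represents_unique)

lemma represents_the_measure: "is_Radon_measure \<Omega> T \<Longrightarrow> represents \<Omega> T (the_measure \<Omega> T)"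
  unfolding is_Radon_measure_def the_measure_def by (erule exE) (rule someI[of "represents \<Omega> T"])

section \<open>Functionals dominated by a finite measure\<close>

lemma integral_abs_triangle:
  fixes f g h :: "'a \<Rightarrow> real"
  assumes "integrable m f" "integrable m g" "integrable m h"
  shows "(LINT x|m. \<bar>f x - h x\<bar>) \<le> (LINT x|m. \<bar>f x - g x\<bar>) + (LINT x|m. \<bar>g x - h x\<bar>)"
proof -
  have "(LINT x|m. \<bar>f x - h x\<bar>) \<le> (LINT x|m. \<bar>f x - g x\<bar> + \<bar>g x - h x\<bar>)"
    using assms by (intro integral_mono) auto
  then show ?thesis using assms by simp
qed

lemma tendsto_L1_of_dominated:
  fixes f :: "'a \<Rightarrow> real" and s :: "nat \<Rightarrow> 'a \<Rightarrow> real"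
  assumes f: "integrable m f" and s: "\<And>i. integrable m (s i)"
    and lim: "\<And>x. x \<in> space m \<Longrightarrow> (\<lambda>i. s i x) \<longlonglongrightarrow> f x"
    and bound: "\<And>i x. x \<in> space m \<Longrightarrow> norm (s i x) \<le> 2 * norm (f x)"
  shows "(\<lambda>i. LINT x|m. \<bar>s i x - f x\<bar>) \<longlonglongrightarrow> 0"
proof -
  have "(\<lambda>i. LINT x|m. \<bar>s i x - f x\<bar>) \<longlonglongrightarrow> (LINT x|m. 0)"
  proof (rule integral_dominated_convergence[where w="\<lambda>x. 3 * \<bar>f x\<bar>"])
    show "AE x in m. (\<lambda>i. \<bar>s i x - f x\<bar>) \<longlonglongrightarrow> 0"
      using lim by (intro AE_I2 tendsto_rabs_zero) (simp add: LIM_zero)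
    show "AE x in m. norm \<bar>s i x - f x\<bar> \<le> 3 * \<bar>f x\<bar>" for i
    proof (rule AE_I2)
      fix x assume "x \<in> space m"
      then have "norm (s i x) \<le> 2 * norm (f x)" by (rule bound)
      then show "norm \<bar>s i x - f x\<bar> \<le> 3 * \<bar>f x\<bar>" by simp
    qed
  qed (use f s in auto)
  then show ?thesis by simp
qed

lemma test_functions_dense_L1:
  fixes f :: "real^'n \<Rightarrow> real"
  assumes \<Omega>: "open \<Omega>" and m: "finite_measure m" "sets m = borel_on \<Omega>"
    and f: "integrable m f" and e: "0 < (e::real)"
  shows "\<exists>\<phi>\<in>test_functions \<Omega>. (LINT x|m. \<bar>\<phi> x - f x\<bar>) < e"
proof -
  let ?T = "test_functions \<Omega>"
  have int: "integrable m \<phi>" if "\<phi> \<in> ?T" for \<phi>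
    by (rule test_function_integrable[OF m that])
  from f e show ?thesis
    proof (induction f arbitrary: e rule: integrable_induct)
    case (base A c)
    have "0 < e / (1 + \<bar>c\<bar>)" using base by simp
    then obtain \<phi> where \<phi>: "\<phi> \<in> ?T" "(LINT x|m. \<bar>\<phi> x - indicator A x\<bar>) < e / (1 + \<bar>c\<bar>)"
      using test_functions_approximate_indicator[OF \<Omega> order_refl m] base(1) m(2) by metis
    have "(LINT x|m. \<bar>c * \<phi> x - indicator A x *\<^sub>R c\<bar>) = (LINT x|m. \<bar>c\<bar> * \<bar>\<phi> x - indicator A x\<bar>)"
      by (intro Bochner_Integration.integral_cong refl) (simp add: abs_mult[symmetric] algebra_simps)
    also have "\<dots> = \<bar>c\<bar> * (LINT x|m. \<bar>\<phi> x - indicator A x\<bar>)" by simp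
    also have "\<dots> \<le> \<bar>c\<bar> * (e / (1 + \<bar>c\<bar>))" using \<phi> by (intro mult_left_mono) auto
    also have "\<dots> < e" using base by (simp add: field_simps)
    finally show ?case by (intro bexI[OF _ test_functions_scale[OF \<phi>(1), of c]])
    next
    case (add f g)
    then have "0 < e/2" by simp
    obtain \<phi> where \<phi>: "\<phi> \<in> ?T" "(LINT x|m. \<bar>\<phi> x - f x\<bar>) < e/2" using add.IH(1)[OF \<open>0 < e/2\<close>] by blast
    obtain \<psi> where \<psi>: "\<psi> \<in> ?T" "(LINT x|m. \<bar>\<psi> x - g x\<bar>) < e/2" using add.IH(2)[OF \<open>0 < e/2\<close>] by blast
    have "(LINT x|m. \<bar>(\<phi> x + \<psi> x) - (f x + g x)\<bar>) \<le> (LINT x|m. \<bar>\<phi> x - f x\<bar> + \<bar>\<psi> x - g x\<bar>)"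
      using int[OF \<phi>(1)] int[OF \<psi>(1)] add.hyps by (intro integral_mono) auto
    also have "\<dots> < e" using int[OF \<phi>(1)] int[OF \<psi>(1)] add.hyps \<phi> \<psi> by simp
    finally show ?case by (intro bexI[OF _ test_functions_add[OF \<phi>(1) \<psi>(1)]])
    next
    case (lim f s)
    have L: "(\<lambda>i. LINT x|m. \<bar>s i x - f x\<bar>) \<longlonglongrightarrow> 0"
      by (rule tendsto_L1_of_dominated) (use lim.hyps in auto)
    have "0 < e/2" using lim.prems by simp
    have "eventually (\<lambda>i. (LINT x|m. \<bar>s i x - f x\<bar>) < e/2) sequentially"
      by (rule order_tendstoD(2)[OF L \<open>0 < e/2\<close>])
    then obtain i where i: "(LINT x|m. \<bar>s i x - f x\<bar>) < e/2" by (auto simp: eventually_sequentially)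
    obtain \<phi> where \<phi>: "\<phi> \<in> ?T" "(LINT x|m. \<bar>\<phi> x - s i x\<bar>) < e/2" using lim.IH[OF \<open>0 < e/2\<close>] by blast
    have "(LINT x|m. \<bar>\<phi> x - f x\<bar>) \<le> (LINT x|m. \<bar>\<phi> x - s i x\<bar>) + (LINT x|m. \<bar>s i x - f x\<bar>)"
      by (rule integral_abs_triangle[OF int[OF \<phi>(1)]]) (use lim.hyps in auto)
    then show ?case using i \<phi> by (intro bexI[OF _ \<phi>(1)]) linarith
    qed
qed

text \<open>
  For integrable \<open>f\<close> the intervals of radius \<open>C \<integral> \<bar>\<phi> - f\<bar> dm\<close> around \<open>P \<phi>\<close>, one for each test function, meet
  pairwise because of the bound on \<open>P\<close>. Hence the supremum \<open>l f\<close> of their left end points lies in all of them, and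
  density makes it the only such point; so \<open>l\<close> is linear and extends \<open>P\<close>. The measure is \<open>l\<close> on indicators: it is
  finitely additive and at most \<open>C m\<close>, hence countably additive. That integration against it is \<open>l\<close> again follows
  by induction over integrable functions.
\<close>

lemma dominated_functional_extension:
  fixes P :: "(real^'n \<Rightarrow> real) \<Rightarrow> real"
  assumes \<Omega>: "open \<Omega>" and m: "finite_measure m" "sets m = borel_on \<Omega>"
    and add: "\<And>\<phi> \<psi>. \<phi> \<in> test_functions \<Omega> \<Longrightarrow> \<psi> \<in> test_functions \<Omega> \<Longrightarrow> P (\<lambda>x. \<phi> x + \<psi> x) = P \<phi> + P \<psi>"
    and scale: "\<And>\<phi> c. \<phi> \<in> test_functions \<Omega> \<Longrightarrow> P (\<lambda>x. c * \<phi> x) = c * P \<phi>"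
    and C: "0 \<le> C" and bound: "\<And>\<phi>. \<phi> \<in> test_functions \<Omega> \<Longrightarrow> \<bar>P \<phi>\<bar> \<le> C * (LINT x|m. \<bar>\<phi> x\<bar>)"
  obtains \<nu> where "represents \<Omega> P \<nu>"
    "\<And>B \<phi>. B \<in> borel_on \<Omega> \<Longrightarrow> \<phi> \<in> test_functions \<Omega> \<Longrightarrow> \<bar>\<nu> B - P \<phi>\<bar> \<le> C * (LINT x|m. \<bar>\<phi> x - indicator B x\<bar>)"
proof -
  interpret finite_measure m by fact
  let ?T = "test_functions \<Omega>"
  have space: "space m = \<Omega>" using sets_eq_imp_space_eq[OF m(2)] by (simp add: space_restrict_space)
  have int: "integrable m \<phi>" if "\<phi> \<in> ?T" for \<phi>
    by (rule test_function_integrable[OF m that])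
  have diff: "P (\<lambda>x. \<phi> x - \<psi> x) = P \<phi> - P \<psi>" if "\<phi> \<in> ?T" "\<psi> \<in> ?T" for \<phi> \<psi>
    using add[OF that(1) test_functions_scale[OF that(2), of "-1"]] scale[OF that(2), of "-1"] by simp
  have P0: "P (\<lambda>x. 0) = 0" using scale[OF test_functions_zero, of 0] by simp
  \<comment> \<open>Left end point of the interval around \<open>P \<phi>\<close> in which the value at \<open>f\<close> has to lie.\<close>
  define lo where "lo f \<phi> = P \<phi> - C * (LINT x|m. \<bar>\<phi> x - f x\<bar>)" for f \<phi>
  define l where "l f = (SUP \<phi>\<in>?T. lo f \<phi>)" for f
  have l_bound: "\<bar>l f - P \<phi>\<bar> \<le> C * (LINT x|m. \<bar>\<phi> x - f x\<bar>)" if f: "integrable m f" and \<phi>: "\<phi> \<in> ?T" for f \<phi>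
  proof -
    have lo_le: "lo f \<psi> \<le> P \<phi> + C * (LINT x|m. \<bar>\<phi> x - f x\<bar>)" if \<psi>: "\<psi> \<in> ?T" for \<psi>
    proof -
      have "P \<psi> - P \<phi> \<le> C * (LINT x|m. \<bar>\<psi> x - \<phi> x\<bar>)"
        using bound[OF test_functions_diff[OF \<psi> \<phi>]] diff[OF \<psi> \<phi>] by linarith
      also have "\<dots> \<le> C * ((LINT x|m. \<bar>\<psi> x - f x\<bar>) + (LINT x|m. \<bar>f x - \<phi> x\<bar>))"
        by (intro mult_left_mono C integral_abs_triangle int f \<phi> \<psi>)
      finally show ?thesis by (simp add: lo_def algebra_simps abs_minus_commute)
    qed
    then have "bdd_above (lo f ` ?T)" by (intro bdd_aboveI2)
    then have "lo f \<phi> \<le> l f" unfolding l_def using \<phi> by (intro cSUP_upper)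
    moreover have "l f \<le> P \<phi> + C * (LINT x|m. \<bar>\<phi> x - f x\<bar>)"
      unfolding l_def using lo_le \<phi> by (intro cSUP_least) auto
    ultimately show ?thesis by (simp add: lo_def abs_le_iff)
  qed
  have dense: "\<exists>\<phi>\<in>?T. (LINT x|m. \<bar>\<phi> x - f x\<bar>) < e" if "integrable m f" "0 < e" for f and e :: real
    by (rule test_functions_dense_L1[OF \<Omega> m that])
  have le0: "a \<le> 0" if "\<And>e. 0 < e \<Longrightarrow> a \<le> K * e" "0 \<le> K" for a K :: real
  proof (rule ccontr)
    assume "\<not> a \<le> 0"
    then have "a \<le> K * (a / (2 * (K + 1)))" using that by (intro that) auto
    also have "\<dots> \<le> a / 2" using \<open>\<not> a \<le> 0\<close> that(2) by (simp add: field_simps)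
    finally show False using \<open>\<not> a \<le> 0\<close> by simp
  qed
  have l_add: "l (\<lambda>x. f x + g x) = l f + l g" if f: "integrable m f" and g: "integrable m g" for f g
  proof -
    have "\<bar>l (\<lambda>x. f x + g x) - (l f + l g)\<bar> \<le> (4 * C) * e" if e: "0 < e" for e
    proof -
      obtain \<phi> where \<phi>: "\<phi> \<in> ?T" "(LINT x|m. \<bar>\<phi> x - f x\<bar>) < e" using dense[OF f e] by blast
      obtain \<psi> where \<psi>: "\<psi> \<in> ?T" "(LINT x|m. \<bar>\<psi> x - g x\<bar>) < e" using dense[OF g e] by blast
      have "(LINT x|m. \<bar>(\<phi> x + \<psi> x) - (f x + g x)\<bar>) \<le> (LINT x|m. \<bar>\<phi> x - f x\<bar> + \<bar>\<psi> x - g x\<bar>)"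
        using int[OF \<phi>(1)] int[OF \<psi>(1)] f g by (intro integral_mono) auto
      also have "\<dots> \<le> 2 * e" using int[OF \<phi>(1)] int[OF \<psi>(1)] f g \<phi> \<psi> by simp
      finally have "C * (LINT x|m. \<bar>(\<phi> x + \<psi> x) - (f x + g x)\<bar>) \<le> C * (2 * e)"
        using C by (rule mult_left_mono)
      moreover have "\<bar>l (\<lambda>x. f x + g x) - P (\<lambda>x. \<phi> x + \<psi> x)\<bar> \<le> C * (LINT x|m. \<bar>(\<phi> x + \<psi> x) - (f x + g x)\<bar>)"
        using f g by (intro l_bound test_functions_add \<phi> \<psi>) auto
      moreover have "\<bar>l f - P \<phi>\<bar> \<le> C * e"
        using l_bound[OF f \<phi>(1)] mult_left_mono[OF less_imp_le[OF \<phi>(2)] C] by linarith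
      moreover have "\<bar>l g - P \<psi>\<bar> \<le> C * e"
        using l_bound[OF g \<psi>(1)] mult_left_mono[OF less_imp_le[OF \<psi>(2)] C] by linarith
      ultimately show ?thesis using assms(4)[OF \<phi>(1) \<psi>(1)] by (simp add: algebra_simps)
    qed
    then have "\<bar>l (\<lambda>x. f x + g x) - (l f + l g)\<bar> \<le> 0" using C by (intro le0[where K="4 * C"]) auto
    then show ?thesis by simp
  qed
  have l_le: "\<bar>l f\<bar> \<le> C * (LINT x|m. \<bar>f x\<bar>)" if "integrable m f" for f
    using l_bound[OF that test_functions_zero] P0 by simp
  have l_lip: "\<bar>l f - l g\<bar> \<le> C * (LINT x|m. \<bar>f x - g x\<bar>)" if f: "integrable m f" and g: "integrable m g" for f g
    using l_add[of g "\<lambda>x. f x - g x"] l_le[of "\<lambda>x. f x - g x"] f g by simp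
  have l_test: "l \<phi> = P \<phi>" if "\<phi> \<in> ?T" for \<phi>
    using l_bound[OF int[OF that] that] by simp
  define \<nu> where "\<nu> B = (if B \<in> borel_on \<Omega> then l (indicator B) else 0)" for B
  have ind: "integrable m (indicat_real B)" if "B \<in> borel_on \<Omega>" for B
    by (rule integrable_real_indicator) (use that m(2) in \<open>auto simp: emeasure_eq_measure\<close>)
  have \<nu>_le: "\<bar>\<nu> B\<bar> \<le> C * measure m B" if B: "B \<in> borel_on \<Omega>" for B
    using l_le[OF ind[OF B]] B m(2) sets.sets_into_space[of B m] by (simp add: \<nu>_def Int_absorb2)
  have \<nu>_Un: "\<nu> (A \<union> B) = \<nu> A + \<nu> B" if A: "A \<in> borel_on \<Omega>" and B: "B \<in> borel_on \<Omega>" and "A \<inter> B = {}" for A B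
  proof -
    have "indicator (A \<union> B) = (\<lambda>x. indicator A x + indicator B x :: real)"
      using \<open>A \<inter> B = {}\<close> by (auto simp: indicator_def fun_eq_iff)
    then show ?thesis using l_add[OF ind[OF A] ind[OF B]] A B by (simp add: \<nu>_def)
  qed
  have \<nu>: "Radon_measure \<Omega> \<nu>"
    unfolding Radon_measure_def
  proof (intro conjI allI impI)
    fix F :: "nat \<Rightarrow> (real^'n) set" assume F: "range F \<subseteq> borel_on \<Omega>" "disjoint_family F"
    have FU: "(\<Union>i<n. F i) \<in> borel_on \<Omega>" "(\<Union>i. F i) \<in> borel_on \<Omega>" for n using F by auto
    have disj: "(\<Union>i<n. F i) \<inter> F n = {}" for n
      by (rule disjoint_family_UN_lessThan_Int[OF F(2)])
    have fin: "(\<Sum>i<n. \<nu> (F i)) = \<nu> (\<Union>i<n. F i)" "(\<Sum>i<n. measure m (F i)) = measure m (\<Union>i<n. F i)" for n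
    proof (induction n)
      case 0
      { case 1 show ?case using \<nu>_le[of "{}"] by simp }
      { case 2 show ?case by simp }
    next
      case (Suc n)
      have Fn: "F n \<in> borel_on \<Omega>" using F by auto
      { case 1 show ?case using Suc(1) \<nu>_Un[OF FU(1) Fn disj] by (simp add: lessThan_Suc Un_commute) }
      { case 2 show ?case using Suc(2) finite_measure_Union[of "\<Union>i<n. F i" "F n"] FU(1) Fn disj m(2)
          by (simp add: lessThan_Suc Un_commute) }
    qed
    have "(\<lambda>n. measure m (\<Union>i. F i) - (\<Sum>i<n. measure m (F i))) \<longlonglongrightarrow> measure m (\<Union>i. F i) - measure m (\<Union>i. F i)"
      using finite_measure_UNION[of F] F m(2) by (intro tendsto_diff tendsto_const) (auto simp: sums_def)
    then have "(\<lambda>n. C * (measure m (\<Union>i. F i) - (\<Sum>i<n. measure m (F i)))) \<longlonglongrightarrow> 0"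
      by (simp add: tendsto_mult_right_zero)
    moreover have "\<bar>(\<Sum>i<n. \<nu> (F i)) - \<nu> (\<Union>i. F i)\<bar> \<le> C * (measure m (\<Union>i. F i) - (\<Sum>i<n. measure m (F i)))" for n
    proof -
      let ?R = "(\<Union>i. F i) - (\<Union>i<n. F i)"
      have R: "?R \<in> borel_on \<Omega>" using FU by auto
      have un: "(\<Union>i<n. F i) \<union> ?R = (\<Union>i. F i)" and d: "(\<Union>i<n. F i) \<inter> ?R = {}" by auto
      have "\<nu> (\<Union>i. F i) = \<nu> (\<Union>i<n. F i) + \<nu> ?R" using \<nu>_Un[OF FU(1) R d] unfolding un .
      moreover have "measure m ?R = measure m (\<Union>i. F i) - measure m (\<Union>i<n. F i)"
        using FU m(2) by (intro finite_measure_Diff) auto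
      ultimately show ?thesis using \<nu>_le[OF R] unfolding fin by simp
    qed
    ultimately have "(\<lambda>n. (\<Sum>i<n. \<nu> (F i)) - \<nu> (\<Union>i. F i)) \<longlonglongrightarrow> 0"
      by - (rule Lim_null_comparison[rotated], assumption, simp add: always_eventually)
    then show "(\<lambda>i. \<nu> (F i)) sums \<nu> (\<Union>i. F i)"
      unfolding sums_def by (simp add: LIM_zero_iff)
  qed (simp add: \<nu>_def)
  let ?p = "positive_part \<Omega> \<nu>" and ?q = "positive_part \<Omega> (\<lambda>B. - \<nu> B)"
  interpret p: finite_measure ?p by (rule finite_measure_positive_part[OF \<nu>])
  interpret q: finite_measure ?q by (rule finite_measure_positive_part[OF Radon_measure_uminus[OF \<nu>]])
  interpret tv: finite_measure "total_variation \<Omega> \<nu>" by (rule finite_measure_total_variation[OF \<nu>])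
  have tv_le: "measure (total_variation \<Omega> \<nu>) B \<le> C * measure m B" if B: "B \<in> borel_on \<Omega>" for B
  proof -
    have "emeasure (total_variation \<Omega> \<nu>) B \<le> ennreal C * emeasure m B"
      using \<nu>_le C by (intro total_variation_least[OF \<nu> m(2) B])
        (auto simp: emeasure_eq_measure ennreal_leI simp flip: ennreal_mult)
    then show ?thesis using C by (simp add: emeasure_eq_measure tv.emeasure_eq_measure flip: ennreal_mult)
  qed
  have pq: "emeasure ?p B \<le> ennreal C * emeasure m B" "emeasure ?q B \<le> ennreal C * emeasure m B"
    if "B \<in> sets m" for B
  proof -
    have B: "B \<in> borel_on \<Omega>" using that m(2) by simp
    have "measure ?p B \<le> C * measure m B" "measure ?q B \<le> C * measure m B"
      using tv_le[OF B] Jordan_decomposition(2)[OF \<nu> B] measure_nonneg[of ?p B] measure_nonneg[of ?q B] by linarith+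
    then show "emeasure ?p B \<le> ennreal C * emeasure m B" "emeasure ?q B \<le> ennreal C * emeasure m B"
      using C by (simp_all add: emeasure_eq_measure p.emeasure_eq_measure q.emeasure_eq_measure ennreal_leI flip: ennreal_mult)
  qed
  have pi: "integrable ?p f" "(LINT x|?p. \<bar>f x\<bar>) \<le> C * (LINT x|m. \<bar>f x\<bar>)"
     "integrable ?q f" "(LINT x|?q. \<bar>f x\<bar>) \<le> C * (LINT x|m. \<bar>f x\<bar>)" if "integrable m f" for f
    using integral_dominated_measure[OF _ pq(1) C that] integral_dominated_measure[OF _ pq(2) C that] m(2) by auto
  have si_le: "\<bar>signed_integral \<Omega> \<nu> f\<bar> \<le> 2 * C * (LINT x|m. \<bar>f x\<bar>)" if f: "integrable m f" for f
  proof -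
    have "\<bar>LINT x|M. f x\<bar> \<le> (LINT x|M. \<bar>f x\<bar>)" for M by (rule integral_abs_bound)
    from this[of ?p] this[of ?q] show ?thesis using pi[OF f] unfolding signed_integral_def by linarith
  qed
  have si_add: "signed_integral \<Omega> \<nu> (\<lambda>x. f x + g x) = signed_integral \<Omega> \<nu> f + signed_integral \<Omega> \<nu> g"
    if "integrable m f" "integrable m g" for f g
    using pi[OF that(1)] pi[OF that(2)] by (simp add: signed_integral_def)
  have si_scale: "signed_integral \<Omega> \<nu> (\<lambda>x. c * f x) = c * signed_integral \<Omega> \<nu> f" for c f
    by (simp add: signed_integral_def right_diff_distrib)
  have l_scale: "l (\<lambda>x. c * f x) = c * l f" if f: "integrable m f" for c f
  proof -
    have "\<bar>l (\<lambda>x. c * f x) - c * l f\<bar> \<le> (2 * C * \<bar>c\<bar>) * e" if e: "0 < e" for e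
    proof -
      obtain \<phi> where \<phi>: "\<phi> \<in> ?T" "(LINT x|m. \<bar>\<phi> x - f x\<bar>) < e" using dense[OF f e] by blast
      have "\<bar>l (\<lambda>x. c * f x) - P (\<lambda>x. c * \<phi> x)\<bar> \<le> C * (LINT x|m. \<bar>c * \<phi> x - c * f x\<bar>)"
        using f by (intro l_bound test_functions_scale \<phi>) auto
      also have "(LINT x|m. \<bar>c * \<phi> x - c * f x\<bar>) = \<bar>c\<bar> * (LINT x|m. \<bar>\<phi> x - f x\<bar>)"
        by (simp add: abs_mult flip: right_diff_distrib)
      also have "C * \<dots> \<le> C * (\<bar>c\<bar> * e)" using \<phi> C by (intro mult_left_mono) auto
      finally have 1: "\<bar>l (\<lambda>x. c * f x) - c * P \<phi>\<bar> \<le> C * (\<bar>c\<bar> * e)" by (simp add: assms(5)[OF \<phi>(1)])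
      have "\<bar>c * P \<phi> - c * l f\<bar> = \<bar>c\<bar> * \<bar>l f - P \<phi>\<bar>" by (simp add: abs_mult abs_minus_commute flip: right_diff_distrib)
      also have "\<dots> \<le> \<bar>c\<bar> * (C * e)"
        using l_bound[OF f \<phi>(1)] mult_left_mono[OF less_imp_le[OF \<phi>(2)] C] by (intro mult_left_mono) auto
      finally show ?thesis using 1 by (simp add: algebra_simps)
    qed
    then have "\<bar>l (\<lambda>x. c * f x) - c * l f\<bar> \<le> 0" using C by (intro le0[where K="2 * C * \<bar>c\<bar>"]) auto
    then show ?thesis by simp
  qed
  have si_eq: "signed_integral \<Omega> \<nu> f = l f" if "integrable m f" for f
    using that
  proof (induction f rule: integrable_induct)
    case (base A c)
    have A: "A \<in> borel_on \<Omega>" using base m(2) by simp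
    have eq: "(\<lambda>x. indicator A x *\<^sub>R c) = (\<lambda>x. c * indicator A x)" by auto
    show ?case unfolding eq l_scale[OF ind[OF A]] si_scale signed_integral_indicator[OF \<nu> A]
      using A by (simp add: \<nu>_def)
  next
    case (add f g)
    then show ?case by (simp add: si_add l_add)
  next
    case (lim f s)
    have L: "(\<lambda>i. LINT x|m. \<bar>s i x - f x\<bar>) \<longlonglongrightarrow> 0"
      by (rule tendsto_L1_of_dominated) (use lim.hyps in auto)
    have lim0: "(\<lambda>i. (3 * C) * (LINT x|m. \<bar>s i x - f x\<bar>)) \<longlonglongrightarrow> 0"
      by (rule tendsto_mult_right_zero[OF L])
    have "\<bar>signed_integral \<Omega> \<nu> f - l f\<bar> \<le> (3 * C) * (LINT x|m. \<bar>s i x - f x\<bar>)" for i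
    proof -
      have si: "integrable m (s i)" using lim.hyps by blast
      have "(\<lambda>x. s i x + (f x - s i x)) = f" by auto
      then have "signed_integral \<Omega> \<nu> f = signed_integral \<Omega> \<nu> (s i) + signed_integral \<Omega> \<nu> (\<lambda>x. f x - s i x)"
        using si_add[of "s i" "\<lambda>x. f x - s i x"] si lim.hyps by simp
      moreover have "\<bar>signed_integral \<Omega> \<nu> (\<lambda>x. f x - s i x)\<bar> \<le> 2 * C * (LINT x|m. \<bar>s i x - f x\<bar>)"
        using si_le[of "\<lambda>x. f x - s i x"] si lim.hyps by (simp add: abs_minus_commute)
      moreover have "\<bar>l (s i) - l f\<bar> \<le> C * (LINT x|m. \<bar>s i x - f x\<bar>)"
        using l_lip si lim.hyps by blast
      ultimately show ?thesis using lim.IH[of i] by (simp add: algebra_simps)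
    qed
    then have "\<bar>signed_integral \<Omega> \<nu> f - l f\<bar> \<le> 0"
      by (intro LIMSEQ_le_const[OF lim0]) auto
    then show ?case by simp
  qed
  show ?thesis
  proof
    show "represents \<Omega> P \<nu>"
      using \<nu> si_eq[OF int] l_test by (simp add: represents_def)
    show "\<bar>\<nu> B - P \<phi>\<bar> \<le> C * (LINT x|m. \<bar>\<phi> x - indicator B x\<bar>)" if "B \<in> borel_on \<Omega>" "\<phi> \<in> ?T" for B \<phi>
      using l_bound[OF ind[OF that(1)] that(2)] that by (simp add: \<nu>_def)
  qed
qed

section \<open>Lebesgue decomposition\<close>

lemma Radon_measure_restrict:
  assumes \<mu>: "Radon_measure \<Omega> \<mu>" and E: "E \<in> borel_on \<Omega>"
  shows "Radon_measure \<Omega> (\<lambda>B. if B \<in> borel_on \<Omega> then \<mu> (B \<inter> E) else 0)"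
  unfolding Radon_measure_def
proof (intro conjI allI impI)
  fix F :: "nat \<Rightarrow> 'a set" assume F: "range F \<subseteq> borel_on \<Omega>" "disjoint_family F"
  have "(\<lambda>i. \<mu> (F i \<inter> E)) sums \<mu> (\<Union>i. F i \<inter> E)"
  proof (rule Radon_measureD[OF \<mu>])
    show "range (\<lambda>i. F i \<inter> E) \<subseteq> borel_on \<Omega>" using F E by auto
    show "disjoint_family (\<lambda>i. F i \<inter> E)" by (rule disjoint_family_subset[OF F(2)]) auto
  qed
  moreover have "F i \<in> borel_on \<Omega>" "(\<Union>i. F i) \<in> borel_on \<Omega>" for i using F by auto
  ultimately show "(\<lambda>i. if F i \<in> borel_on \<Omega> then \<mu> (F i \<inter> E) else 0) sums
      (if (\<Union>i. F i) \<in> borel_on \<Omega> then \<mu> ((\<Union>i. F i) \<inter> E) else 0)"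
    by simp
qed simp

lemma total_variation_null_iff:
  assumes "Radon_measure \<Omega> \<mu>"
  shows "N \<in> null_sets (total_variation \<Omega> \<mu>) \<longleftrightarrow>
    N \<in> borel_on \<Omega> \<and> (\<forall>B\<in>borel_on \<Omega>. B \<subseteq> N \<longrightarrow> \<mu> B = 0)"
proof
  assume N: "N \<in> null_sets (total_variation \<Omega> \<mu>)"
  interpret finite_measure "total_variation \<Omega> \<mu>" by (rule finite_measure_total_variation[OF assms])
  have "\<mu> B = 0" if "B \<in> borel_on \<Omega>" "B \<subseteq> N" for B
  proof -
    have "B \<in> null_sets (total_variation \<Omega> \<mu>)"
      by (rule null_sets_subset[OF N]) (use that in auto)
    then have "measure (total_variation \<Omega> \<mu>) B = 0" by (rule measure_eq_0_null_sets)
    then show ?thesis using norm_le_total_variation[OF assms, of B] by simp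
  qed
  then show "N \<in> borel_on \<Omega> \<and> (\<forall>B\<in>borel_on \<Omega>. B \<subseteq> N \<longrightarrow> \<mu> B = 0)" using N by auto
next
  assume N: "N \<in> borel_on \<Omega> \<and> (\<forall>B\<in>borel_on \<Omega>. B \<subseteq> N \<longrightarrow> \<mu> B = 0)"
  have "emeasure (total_variation \<Omega> \<mu>) N \<le> 0 * emeasure (total_variation \<Omega> \<mu>) N"
    by (rule total_variation_least[OF assms]) (use N in auto)
  then show "N \<in> null_sets (total_variation \<Omega> \<mu>)" using N by auto
qed

text \<open>
  The supremum of \<open>m\<close> over the Lebesgue null sets is attained by the union of a maximising sequence. A null set
  outside this union must have measure \<open>0\<close>, since otherwise the union could be enlarged.
\<close>

lemma exists_largest_Lebesgue_null_set:
  assumes m: "finite_measure m" "sets m = borel_on \<Omega>"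
  obtains N where "N \<in> null_sets (restrict_space lborel \<Omega>)"
    "\<And>B. B \<in> null_sets (restrict_space lborel \<Omega>) \<Longrightarrow> B \<subseteq> \<Omega> - N \<Longrightarrow> B \<in> null_sets m"
proof -
  interpret finite_measure m by fact
  let ?Z = "null_sets (restrict_space lborel \<Omega>)"
  have Zm: "B \<in> sets m" if "B \<in> ?Z" for B
    using null_setsD2[OF that] m(2) sets_restrict_space_cong[of lborel borel \<Omega>] by simp
  define s where "s = (SUP B\<in>?Z. measure m B)"
  have bdd: "bdd_above (measure m ` ?Z)"
    by (rule bdd_aboveI2[where M="measure m (space m)"]) (rule bounded_measure)
  have "{} \<in> ?Z" by auto
  have "\<exists>B\<in>?Z. s - 1 / (1 + real n) < measure m B" for n
    using less_cSUP_iff[OF _ bdd, of "s - 1 / (1 + real n)"] \<open>{} \<in> ?Z\<close>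
    by (auto simp: s_def[symmetric])
  then obtain F where F: "\<And>n. F n \<in> ?Z" "\<And>n. s - 1 / (1 + real n) < measure m (F n)" by metis
  define N where "N = (\<Union>n. F n)"
  have N: "N \<in> ?Z" unfolding N_def using F(1) by auto
  have sN: "s \<le> measure m N"
  proof (rule field_le_epsilon)
    fix e :: real assume "0 < e"
    then obtain n where n: "1 / (1 + real n) < e" by (metis nat_approx_posE of_nat_Suc)
    have "measure m (F n) \<le> measure m N"
      using F(1) N Zm by (intro finite_measure_mono) (auto simp: N_def)
    then show "s \<le> measure m N + e" using F(2)[of n] n by linarith
  qed
  show ?thesis
  proof (rule that[OF N])
    fix B assume B: "B \<in> ?Z" "B \<subseteq> \<Omega> - N"
    have "N \<union> B \<in> ?Z" using N B by auto
    then have "measure m (N \<union> B) \<le> s" unfolding s_def by (rule cSUP_upper[OF _ bdd])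
    moreover have "measure m (N \<union> B) = measure m N + measure m B"
      using N B Zm by (intro finite_measure_Union) auto
    ultimately have "measure m B = 0" using sN measure_nonneg[of m B] by linarith
    then show "B \<in> null_sets m" using Zm[OF B(1)] by (auto simp: null_sets_def emeasure_eq_measure)
  qed
qed

text \<open>
  Restricting \<open>\<mu>\<close> to the largest Lebesgue null set of \<open>|\<mu>|\<close> and to its complement is a Lebesgue decomposition, so
  the choice in the definition of \<open>singular_part\<close> has its defining properties.
\<close>

lemma singular_part_decomposition:
  assumes \<mu>: "Radon_measure \<Omega> \<mu>"
  obtains \<mu>a where "Radon_measure \<Omega> (singular_part \<Omega> \<mu>)" "Radon_measure \<Omega> \<mu>a"
    "absolutely_continuous (restrict_space lborel \<Omega>) (total_variation \<Omega> \<mu>a)"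
    "\<And>B. \<mu> B = \<mu>a B + singular_part \<Omega> \<mu> B"
proof -
  let ?P = "\<lambda>\<mu>s. Radon_measure \<Omega> \<mu>s \<and>
        (\<exists>N. N \<in> null_sets (restrict_space lborel \<Omega>) \<and> \<Omega> - N \<in> null_sets (total_variation \<Omega> \<mu>s)) \<and>
        (\<exists>\<mu>a. Radon_measure \<Omega> \<mu>a \<and>
              absolutely_continuous (restrict_space lborel \<Omega>) (total_variation \<Omega> \<mu>a) \<and>
              (\<forall>B. \<mu> B = \<mu>a B + \<mu>s B))"
  obtain N where N: "N \<in> null_sets (restrict_space lborel \<Omega>)"
    "\<And>B. B \<in> null_sets (restrict_space lborel \<Omega>) \<Longrightarrow> B \<subseteq> \<Omega> - N \<Longrightarrow> B \<in> null_sets (total_variation \<Omega> \<mu>)"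
    using exists_largest_Lebesgue_null_set[OF finite_measure_total_variation[OF \<mu>] sets_total_variation] by metis
  have sets_eq: "sets (restrict_space lborel \<Omega>) = borel_on \<Omega>"
    by (rule sets_restrict_space_cong) simp
  have N': "N \<in> borel_on \<Omega>" "N \<subseteq> \<Omega>" using null_setsD2[OF N(1)] sets_eq sets.sets_into_space by (auto simp: space_restrict_space dest!: sets.sets_into_space)
  have \<Omega>: "\<Omega> \<in> borel_on \<Omega>" using sets.top[of "restrict_space borel \<Omega>"] by (simp add: space_restrict_space)
  define \<mu>s where "\<mu>s B = (if B \<in> borel_on \<Omega> then \<mu> (B \<inter> N) else 0)" for B
  define \<mu>a where "\<mu>a B = (if B \<in> borel_on \<Omega> then \<mu> (B \<inter> (\<Omega> - N)) else 0)" for B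
  have Rs: "Radon_measure \<Omega> \<mu>s" unfolding \<mu>s_def[abs_def] by (rule Radon_measure_restrict[OF \<mu> N'(1)])
  have Ra: "Radon_measure \<Omega> \<mu>a" unfolding \<mu>a_def[abs_def] using N' \<Omega> by (intro Radon_measure_restrict[OF \<mu>]) auto
  have eq: "\<mu> B = \<mu>a B + \<mu>s B" for B
  proof (cases "B \<in> borel_on \<Omega>")
    case True
    then have "B \<subseteq> \<Omega>" using sets.sets_into_space[OF True] by (simp add: space_restrict_space)
    then have "B = B \<inter> (\<Omega> - N) \<union> B \<inter> N" by auto
    then have "\<mu> B = \<mu> (B \<inter> (\<Omega> - N) \<union> B \<inter> N)" by simp
    also have "\<dots> = \<mu> (B \<inter> (\<Omega> - N)) + \<mu> (B \<inter> N)"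
      using True N' \<Omega> by (intro Radon_measure_Un[OF \<mu>]) auto
    finally show ?thesis using True by (simp add: \<mu>s_def \<mu>a_def)
  qed (simp add: \<mu>s_def \<mu>a_def Radon_measure_outside[OF \<mu>])
  have "?P \<mu>s"
  proof (intro conjI exI allI)
    show "Radon_measure \<Omega> \<mu>s" "N \<in> null_sets (restrict_space lborel \<Omega>)" "Radon_measure \<Omega> \<mu>a" by fact+
    show "\<mu> B = \<mu>a B + \<mu>s B" for B by (rule eq)
    show "\<Omega> - N \<in> null_sets (total_variation \<Omega> \<mu>s)"
      unfolding total_variation_null_iff[OF Rs]
    proof (intro conjI ballI impI)
      show "\<Omega> - N \<in> borel_on \<Omega>" using N' \<Omega> by auto
      fix B assume "B \<in> borel_on \<Omega>" "B \<subseteq> \<Omega> - N"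
      then have "B \<inter> N = {}" by auto
      then show "\<mu>s B = 0" using Radon_measure_empty[OF \<mu>] by (simp add: \<mu>s_def)
    qed
    show "absolutely_continuous (restrict_space lborel \<Omega>) (total_variation \<Omega> \<mu>a)"
      unfolding absolutely_continuous_def
    proof
      fix Z assume Z: "Z \<in> null_sets (restrict_space lborel \<Omega>)"
      have Zb: "Z \<in> borel_on \<Omega>" using null_setsD2[OF Z] sets_eq by simp
      show "Z \<in> null_sets (total_variation \<Omega> \<mu>a)"
        unfolding total_variation_null_iff[OF Ra]
      proof (intro conjI ballI impI Zb)
        fix B assume B: "B \<in> borel_on \<Omega>" "B \<subseteq> Z"
        have "B \<inter> (\<Omega> - N) \<in> null_sets (restrict_space lborel \<Omega>)"
          by (rule null_sets_subset[OF Z]) (use B N' \<Omega> sets_eq in auto)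
        then have "B \<inter> (\<Omega> - N) \<in> null_sets (total_variation \<Omega> \<mu>)" by (rule N(2)) auto
        then show "\<mu>a B = 0" using total_variation_null_iff[OF \<mu>] by (auto simp: \<mu>a_def)
      qed
    qed
  qed
  then have "?P (singular_part \<Omega> \<mu>)" unfolding singular_part_def by (rule someI[of ?P])
  then show ?thesis using that by blast
qed

lemma null_set_of_singular_and_Lebesgue:
  assumes \<mu>: "Radon_measure \<Omega> \<mu>"
    and S: "S \<in> null_sets (total_variation \<Omega> (singular_part \<Omega> \<mu>))"
    and L: "S \<in> null_sets (restrict_space lborel \<Omega>)"
  shows "S \<in> null_sets (total_variation \<Omega> \<mu>)"
proof -
  obtain \<mu>a where \<mu>a: "Radon_measure \<Omega> (singular_part \<Omega> \<mu>)" "Radon_measure \<Omega> \<mu>a"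
    "absolutely_continuous (restrict_space lborel \<Omega>) (total_variation \<Omega> \<mu>a)"
    "\<And>B. \<mu> B = \<mu>a B + singular_part \<Omega> \<mu> B"
    using singular_part_decomposition[OF \<mu>] by metis
  have "S \<in> null_sets (total_variation \<Omega> \<mu>a)"
    using \<mu>a(3) L unfolding absolutely_continuous_def by blast
  then show ?thesis
    using S \<mu>a(4) unfolding total_variation_null_iff[OF \<mu>] total_variation_null_iff[OF \<mu>a(1)]
      total_variation_null_iff[OF \<mu>a(2)] by simp
qed

section \<open>Lebesgue points\<close>

abbreviation ball_integral :: "'a::euclidean_space \<Rightarrow> real \<Rightarrow> ('a \<Rightarrow> real) \<Rightarrow> real" where
  "ball_integral x r f \<equiv> (LINT y|lborel. indicator (ball x r) y * f y)"

lemma content_ball_scale: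
  fixes x y :: "'a::euclidean_space"
  assumes "0 < r" "0 \<le> s"
  shows "measure lborel (ball x (s * r)) = s ^ DIM('a) * measure lborel (ball y r)"
  using assms content_ball_conv_unit_ball[of "s * r" x] content_ball_conv_unit_ball[of r y]
  by (simp add: power_mult_distrib)

lemma content_ball_pos_lborel: "0 < r \<Longrightarrow> 0 < measure lborel (ball (x::'a::euclidean_space) r)"
  using content_ball_pos[of r x] by simp

lemma emeasure_lborel_ball_finite: "emeasure lborel (ball (x::'a::euclidean_space) r) < \<infinity>"
  by (rule emeasure_bounded_finite) simp

text \<open>
  The volume estimate behind the Vitali covering argument: enlarging disjoint balls by the factor \<open>5\<close> multiplies
  their total volume by at most \<open>5 ^ DIM('a)\<close>.
\<close>

lemma emeasure_UN_5_times_balls: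
  fixes a :: "'a::euclidean_space \<Rightarrow> real" and M :: "'a measure"
  assumes C: "countable C" and disj: "pairwise (\<lambda>i j. disjnt (ball i (a i)) (ball j (a j))) C"
    and pos: "\<And>i. i \<in> C \<Longrightarrow> 0 < a i" and t: "0 < t" and M: "sets M = sets borel"
    and le: "\<And>i. i \<in> C \<Longrightarrow> ennreal t * emeasure lborel (ball i (a i)) \<le> emeasure M (ball i (a i))"
  shows "ennreal t * emeasure lborel (\<Union>i\<in>C. ball i (5 * a i)) \<le> 5 ^ DIM('a) * emeasure M (\<Union>i\<in>C. ball i (a i))"
proof -
  define I where "I = to_nat_on C ` C"
  define c where "c n = from_nat_into C n" for n
  have c: "c n \<in> C" if "n \<in> I" for n
    using that C by (auto simp: I_def c_def)
  have inj: "c m = c n \<Longrightarrow> m = n" if "m \<in> I" "n \<in> I" for m n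
    using that C by (auto simp: I_def c_def)
  have cI: "\<exists>n\<in>I. c n = i" if "i \<in> C" for i
    using that C by (auto simp: I_def c_def)
  define F where "F s n = (if n \<in> I then ball (c n) (s * a (c n)) else {})" for s n
  have UN: "(\<Union>i\<in>C. ball i (s * a i)) = (\<Union>n. F s n)" for s
    using c cI by (fastforce simp: F_def split: if_splits)
  have F: "F s n \<in> sets borel" for s n by (simp add: F_def)
  have dF: "disjoint_family (F 1)"
    unfolding disjoint_family_on_def
  proof (intro ballI impI)
    fix m n :: nat assume "m \<noteq> n"
    show "F 1 m \<inter> F 1 n = {}"
    proof (cases "m \<in> I \<and> n \<in> I")
      case True
      then have "c m \<noteq> c n" using inj \<open>m \<noteq> n\<close> by blast
      then show ?thesis using disj c True by (auto simp: F_def pairwise_def disjnt_def)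
    qed (auto simp: F_def)
  qed
  have le5: "ennreal t * emeasure lborel (F 5 n) \<le> 5 ^ DIM('a) * emeasure M (F 1 n)" for n
  proof (cases "n \<in> I")
    case True
    have "emeasure lborel (ball (c n) (5 * a (c n))) = 5 ^ DIM('a) * emeasure lborel (ball (c n) (a (c n)))"
      using content_ball_scale[OF pos[OF c[OF True]], of 5 "c n" "c n"] emeasure_lborel_ball_finite[of "c n"]
      by (simp add: emeasure_eq_ennreal_measure less_top ennreal_mult ennreal_power[symmetric])
    then have "ennreal t * emeasure lborel (F 5 n) = 5 ^ DIM('a) * (ennreal t * emeasure lborel (ball (c n) (a (c n))))"
      using True by (simp add: F_def mult_ac)
    also have "\<dots> \<le> 5 ^ DIM('a) * emeasure M (ball (c n) (a (c n)))"
      using le[OF c[OF True]] by (intro mult_left_mono) auto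
    finally show ?thesis using True by (simp add: F_def)
  qed (simp add: F_def)
  have "ennreal t * emeasure lborel (\<Union>n. F 5 n) \<le> ennreal t * (\<Sum>n. emeasure lborel (F 5 n))"
    using F by (intro mult_left_mono emeasure_subadditive_countably) auto
  also have "\<dots> = (\<Sum>n. ennreal t * emeasure lborel (F 5 n))" by simp
  also have "\<dots> \<le> (\<Sum>n. 5 ^ DIM('a) * emeasure M (F 1 n))"
    by (intro suminf_le le5) auto
  also have "\<dots> = 5 ^ DIM('a) * (\<Sum>n. emeasure M (F 1 n))" by simp
  also have "(\<Sum>n. emeasure M (F 1 n)) = emeasure M (\<Union>n. F 1 n)"
    using F M dF by (intro suminf_emeasure) auto
  finally show ?thesis using UN[of 5] UN[of 1] by simp
qed

text \<open>
  The measure with density \<open>g\<close> does not charge the zero set of \<open>g\<close>, so by outer regularity it gives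
  little mass to some open neighbourhood of it. Balls inside this neighbourhood on which the average of \<open>g\<close> is at
  least \<open>t\<close> have small total volume if they are disjoint, and by Vitali's lemma their enlargements cover the bad points.
\<close>

lemma negligible_large_averages_on_zero_set:
  fixes g :: "'a::euclidean_space \<Rightarrow> real"
  assumes g: "integrable lborel g" "\<And>x. 0 \<le> g x" and t: "0 < t"
  shows "negligible {x. g x = 0 \<and> (\<forall>d>0. \<exists>r. 0 < r \<and> r < d \<and> t * measure lborel (ball x r) \<le> ball_integral x r g)}"
    (is "negligible ?E")
proof -
  have [measurable]: "g \<in> borel_measurable borel" using g(1) by auto
  define \<nu> where "\<nu> = density lborel (\<lambda>x. ennreal (g x))"
  have sets: "sets \<nu> = sets borel" by (simp add: \<nu>_def)
  have ball: "emeasure \<nu> (ball x r) = ennreal (ball_integral x r g)" for x r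
  proof -
    have "emeasure \<nu> (ball x r) = (\<integral>\<^sup>+y. ennreal (indicator (ball x r) y * g y) \<partial>lborel)"
      unfolding \<nu>_def by (subst emeasure_density) (auto intro!: nn_integral_cong simp: indicator_def)
    also have "\<dots> = ennreal (ball_integral x r g)"
      using integrable_mult_indicator[of "ball x r" lborel g] g by (intro nn_integral_eq_integral) auto
    finally show ?thesis .
  qed
  have fin: "emeasure \<nu> (space \<nu>) \<noteq> \<infinity>"
    unfolding \<nu>_def by (subst emeasure_density) (use g in \<open>auto simp: nn_integral_eq_integral\<close>)
  define Z where "Z = {x. g x = 0}"
  have Z: "Z \<in> sets borel" unfolding Z_def by measurable
  have "emeasure \<nu> Z = 0"
    unfolding \<nu>_def using Z by (subst emeasure_density) (auto simp: nn_integral_0_iff_AE Z_def indicator_def intro!: AE_I2)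
  then have inf0: "(INF U \<in> {U. Z \<subseteq> U \<and> open U}. emeasure \<nu> U) = 0"
    using outer_regular[OF sets fin Z] by simp
  show ?thesis
    unfolding negligible_outer
  proof (intro allI impI)
    fix e :: real assume e: "0 < e"
    \<comment> \<open>The enlarged balls then have total volume at most \<open>5 ^ DIM(a) * \<delta> / t = e / 2\<close>.\<close>
    define \<delta> where "\<delta> = e * t / (2 * 5 ^ DIM('a))"
    have \<delta>: "0 < \<delta>" using e t by (simp add: \<delta>_def)
    then have "(INF U \<in> {U. Z \<subseteq> U \<and> open U}. emeasure \<nu> U) < ennreal \<delta>" using inf0 by simp
    then obtain V where V: "Z \<subseteq> V" "open V" "emeasure \<nu> V < ennreal \<delta>" unfolding INF_less_iff by auto
    have "\<forall>x\<in>?E. \<exists>r. 0 < r \<and> r \<le> 1 \<and> ball x r \<subseteq> V \<and> t * measure lborel (ball x r) \<le> ball_integral x r g"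
    proof
      fix x assume x: "x \<in> ?E"
      then have "x \<in> V" using V by (auto simp: Z_def)
      then obtain d where d: "0 < d" "ball x d \<subseteq> V" using V(2) by (auto simp: open_contains_ball)
      have "0 < min d 1" using d by simp
      then obtain r where r: "0 < r" "r < min d 1" "t * measure lborel (ball x r) \<le> ball_integral x r g"
        using x by blast
      then have "ball x r \<subseteq> V" using d subset_ball[of r d x] by auto
      then show "\<exists>r. 0 < r \<and> r \<le> 1 \<and> ball x r \<subseteq> V \<and> t * measure lborel (ball x r) \<le> ball_integral x r g"
        using r by (intro exI[of _ r]) auto
    qed
    then obtain \<rho> where \<rho>: "\<And>x. x \<in> ?E \<Longrightarrow> 0 < \<rho> x \<and> \<rho> x \<le> 1"
      "\<And>x. x \<in> ?E \<Longrightarrow> ball x (\<rho> x) \<subseteq> V" "\<And>x. x \<in> ?E \<Longrightarrow> t * measure lborel (ball x (\<rho> x)) \<le> ball_integral x (\<rho> x) g"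
      unfolding bchoice_iff by blast
    have cov: "?E \<subseteq> (\<Union>i\<in>?E. ball i (\<rho> i))" using \<rho>(1) centre_in_ball by blast
    obtain C where C: "countable C" "C \<subseteq> ?E" "pairwise (\<lambda>i j. disjnt (ball i (\<rho> i)) (ball j (\<rho> j))) C"
      "?E \<subseteq> (\<Union>i\<in>C. ball i (5 * \<rho> i))"
      by (rule Vitali_covering_lemma_balls[OF cov \<rho>(1)])
    let ?T = "\<Union>i\<in>C. ball i (5 * \<rho> i)"
    have oT: "open ?T" "open (\<Union>i\<in>C. ball i (\<rho> i))" by auto
    have "ennreal t * emeasure lborel ?T \<le> 5 ^ DIM('a) * emeasure \<nu> (\<Union>i\<in>C. ball i (\<rho> i))"
    proof (rule emeasure_UN_5_times_balls[OF C(1,3) _ t sets])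
      fix i assume "i \<in> C"
      then have i: "i \<in> ?E" using C by blast
      show "0 < \<rho> i" using \<rho>(1)[OF i] by simp
      show "ennreal t * emeasure lborel (ball i (\<rho> i)) \<le> emeasure \<nu> (ball i (\<rho> i))"
        unfolding ball using \<rho>(3)[OF i] t emeasure_lborel_ball_finite[of i "\<rho> i"]
        by (simp add: emeasure_eq_ennreal_measure less_top ennreal_leI flip: ennreal_mult)
    qed
    also have "\<dots> \<le> 5 ^ DIM('a) * ennreal \<delta>"
    proof (intro mult_left_mono)
      have "(\<Union>i\<in>C. ball i (\<rho> i)) \<subseteq> V" using \<rho>(2) C(2) by blast
      then have "emeasure \<nu> (\<Union>i\<in>C. ball i (\<rho> i)) \<le> emeasure \<nu> V"
        using V sets by (intro emeasure_mono) auto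
      then show "emeasure \<nu> (\<Union>i\<in>C. ball i (\<rho> i)) \<le> ennreal \<delta>" using V(3) by simp
    qed auto
    also have "\<dots> = ennreal (e * t / 2)"
      using \<delta> e t by (simp add: \<delta>_def ennreal_mult[symmetric] ennreal_power ennreal_numeral[symmetric] del: ennreal_numeral)
    finally have T: "ennreal t * emeasure lborel ?T \<le> ennreal (e * t / 2)" .
    then have fin: "emeasure lborel ?T < \<infinity>"
      using t by (auto simp: less_top[symmetric] ennreal_mult_eq_top_iff top_unique)
    then have "t * measure lborel ?T \<le> e * t / 2"
      using T t e by (simp add: emeasure_eq_ennreal_measure less_top flip: ennreal_mult)
    then have "measure lborel ?T \<le> e / 2" using t by (simp add: field_simps)
    then have "measure lebesgue ?T < e" using e oT by (simp add: measure_completion)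
    moreover have "?T \<in> lmeasurable" using fin oT by (intro fmeasurableI) (auto simp: emeasure_completion)
    ultimately show "\<exists>T. ?E \<subseteq> T \<and> T \<in> lmeasurable \<and> measure lebesgue T < e"
      using C(4) by blast
  qed
qed

text \<open>
  Take \<open>q\<close> from a countable dense set. On a ball, the function \<open>max 0 (norm (v y - q) - 1 / (1 + k))\<close> is
  integrable, and it vanishes at the points where \<open>v\<close> is within \<open>1 / (1 + k)\<close> of \<open>q\<close>. At almost all of these points its averages
  tend to \<open>0\<close>, so those of \<open>norm (v y - v x)\<close> are eventually below \<open>3 / (1 + k)\<close>.
\<close>

lemma AE_Lebesgue_point:
  fixes v :: "'a::euclidean_space \<Rightarrow> 'b::euclidean_space"
  assumes v: "integrable lborel v"
  obtains N where "negligible N"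
    "\<And>x. x \<notin> N \<Longrightarrow> ((\<lambda>r. ball_integral x r (\<lambda>y. norm (v y - v x)) / measure lborel (ball x r)) \<longlongrightarrow> 0) (at_right 0)"
proof -
  have [measurable]: "v \<in> borel_measurable borel" using v by auto
  obtain D :: "'b set" where D: "countable D" "\<And>X. open X \<Longrightarrow> X \<noteq> {} \<Longrightarrow> \<exists>d\<in>D. d \<in> X"
    using countable_dense_exists[where 'a='b] by blast
  define g where "g q k n y = indicator (ball 0 (real n)) y * max 0 (norm (v y - q) - 1 / (1 + real k))"
    for q :: 'b and k n :: nat and y :: 'a
  define E where "E q k n j = {x. g q k n x = 0 \<and>
     (\<forall>d>0. \<exists>r. 0 < r \<and> r < d \<and> (1 / (1 + real j)) * measure lborel (ball x r) \<le> ball_integral x r (g q k n))}"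
    for q k n j
  have ind: "integrable lborel (indicat_real (ball x r))" for x :: 'a and r
    using emeasure_lborel_ball_finite[of x r] by (intro integrable_real_indicator) auto
  have g: "integrable lborel (g q k n)" "0 \<le> g q k n x" for q k n x
  proof -
    have "integrable lborel (\<lambda>y. norm (v y) + norm q * indicator (ball 0 (real n)) y)"
      using v ind by (intro Bochner_Integration.integrable_add integrable_norm integrable_mult_right) auto
    then show "integrable lborel (g q k n)"
    proof (rule Bochner_Integration.integrable_bound)
      show "g q k n \<in> borel_measurable lborel" unfolding g_def[abs_def]
        by (intro borel_measurable_times borel_measurable_indicator borel_measurable_max borel_measurable_const
            borel_measurable_diff borel_measurable_norm) auto
      have "norm (g q k n y) \<le> norm (norm (v y) + norm q * indicator (ball 0 (real n)) y)" for y
        using norm_triangle_ineq4[of "v y" q]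
        by (simp add: g_def indicator_def) (smt (verit) divide_nonneg_nonneg norm_ge_zero of_nat_0_le_iff)
      then show "AE y in lborel. norm (g q k n y) \<le> norm (norm (v y) + norm q * indicator (ball 0 (real n)) y)"
        by simp
    qed
    show "0 \<le> g q k n x" by (simp add: g_def)
  qed
  have nE: "negligible (E q k n j)" for q k n j
    unfolding E_def by (rule negligible_large_averages_on_zero_set[OF g]) simp
  define N where "N = (\<Union>q\<in>D. \<Union>k. \<Union>n. \<Union>j. E q k n j)"
  have UN: "negligible (\<Union>i\<in>I. S i)" if "countable I" "\<And>i. negligible (S i)" for I :: "'i set" and S :: "'i \<Rightarrow> 'a set"
    using that by (intro negligible_countable_Union) auto
  have N: "negligible N"
    unfolding N_def by (intro UN D(1) nE countableI_type)
  show ?thesis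
  proof (rule that[OF N])
    fix x assume x: "x \<notin> N"
    let ?A = "\<lambda>r. ball_integral x r (\<lambda>y. norm (v y - v x)) / measure lborel (ball x r)"
    show "(?A \<longlongrightarrow> 0) (at_right 0)"
    proof (rule tendstoI)
      fix e :: real assume e: "0 < e"
      obtain k where k: "1 / (1 + real k) < e / 4" using e by (metis nat_approx_posE of_nat_Suc zero_less_divide_iff zero_less_numeral)
      obtain q where q: "q \<in> D" "q \<in> ball (v x) (1 / (1 + real k))"
        using D(2)[of "ball (v x) (1 / (1 + real k))"] by auto
      obtain n where n: "norm x < real n" using reals_Archimedean2 by blast
      have gx: "g q k n x = 0"
        using q(2) by (simp add: g_def dist_norm max_def indicator_def)
      have "x \<notin> E q k n k" using x q(1) by (auto simp: N_def)
      then obtain d where d: "0 < d" "\<And>r. 0 < r \<Longrightarrow> r < d \<Longrightarrow>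
          ball_integral x r (g q k n) < 1 / (1 + real k) * measure lborel (ball x r)"
        using gx by (auto simp: E_def not_le)
      \<comment> \<open>Keeps the ball around \<open>x\<close> inside \<open>ball 0 n\<close>, where \<open>g q k n\<close> is not cut off.\<close>
      define d' where "d' = min d (real n - norm x)"
      have "dist (?A r) 0 < e" if r: "0 < r" "r < d'" for r
      proof -
        let ?m = "measure lborel (ball x r)"
        have m: "0 < ?m" by (rule content_ball_pos_lborel[OF r(1)])
        have sub: "y \<in> ball 0 (real n)" if "y \<in> ball x r" for y
        proof -
          have "norm y \<le> norm x + dist x y" using norm_triangle_sub[of y x] by (simp add: dist_norm norm_minus_commute)
          then show ?thesis using that r by (simp add: d'_def)
        qed
        have pt: "indicator (ball x r) y * norm (v y - v x)
            \<le> indicator (ball x r) y * g q k n y + 2 / (1 + real k) * indicator (ball x r) y" for y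
        proof (cases "y \<in> ball x r")
          case True
          have "norm (v y - v x) \<le> norm (v y - q) + norm (q - v x)"
            using norm_triangle_ineq[of "v y - q" "q - v x"] by simp
          moreover have "norm (q - v x) \<le> 1 / (1 + real k)" using q(2) by (simp add: dist_norm norm_minus_commute)
          moreover have "norm (v y - q) \<le> g q k n y + 1 / (1 + real k)"
            using sub[OF True] by (simp add: g_def)
          ultimately have "norm (v y - v x) \<le> g q k n y + 2 / (1 + real k)" by simp
          then show ?thesis using True by simp
        qed simp
        have i1: "integrable lborel (\<lambda>y. indicator (ball x r) y * g q k n y)"
          using integrable_mult_indicator[of "ball x r" lborel "g q k n"] g by simp
        have i2: "integrable lborel (\<lambda>y. 2 / (1 + real k) * indicator (ball x r) y)" using ind by auto
        have "ball_integral x r (\<lambda>y. norm (v y - v x)) \<le> ball_integral x r (g q k n) + 2 / (1 + real k) * ?m"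
        proof -
          have "ball_integral x r (\<lambda>y. norm (v y - v x))
              \<le> (LINT y|lborel. indicator (ball x r) y * g q k n y + 2 / (1 + real k) * indicator (ball x r) y)"
          proof (rule integral_mono_AE')
            show "integrable lborel (\<lambda>y. indicator (ball x r) y * g q k n y + 2 / (1 + real k) * indicator (ball x r) y)"
              by (rule Bochner_Integration.integrable_add[OF i1 i2])
            show "AE y in lborel. indicator (ball x r) y * norm (v y - v x)
                \<le> indicator (ball x r) y * g q k n y + 2 / (1 + real k) * indicator (ball x r) y" using pt by simp
            show "AE y in lborel. 0 \<le> indicator (ball x r) y * g q k n y + 2 / (1 + real k) * indicator (ball x r) y"
              using g(2) by (intro AE_I2 add_nonneg_nonneg mult_nonneg_nonneg) auto
          qed
          also have "\<dots> = ball_integral x r (g q k n) + 2 / (1 + real k) * ?m"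
            using i1 i2 by (subst Bochner_Integration.integral_add) auto
          finally show ?thesis .
        qed
        also have "\<dots> < 1 / (1 + real k) * ?m + 2 / (1 + real k) * ?m"
          using d(2)[of r] r by (simp add: d'_def)
        also have "\<dots> = (3 * (1 / (1 + real k))) * ?m" by (simp add: algebra_simps)
        also have "\<dots> \<le> e * ?m" using k m e by (intro mult_right_mono) auto
        finally have "?A r < e" using m by (simp add: divide_less_eq)
        moreover have "0 \<le> ?A r" by (intro divide_nonneg_nonneg integral_nonneg_AE) auto
        ultimately show ?thesis by simp
      qed
      moreover have "0 < d'" using d(1) n by (simp add: d'_def)
      ultimately show "\<forall>\<^sub>F r in at_right 0. dist (?A r) 0 < e"
        unfolding eventually_at_right_field by blast
    qed
  qed
qed

section \<open>Mollification\<close>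

definition mollifier :: "real \<Rightarrow> real^'n \<Rightarrow> real^'n \<Rightarrow> real" where
  "mollifier r x y = bump 0 r x y / (LINT z|lborel. bump 0 r (0::real^'n) z)"

definition mollify :: "real \<Rightarrow> (real^'n \<Rightarrow> 'b::euclidean_space) \<Rightarrow> real^'n \<Rightarrow> 'b" where
  "mollify r v x = (LINT y|lborel. mollifier r x y *\<^sub>R v y)"

lemma flat_measurable [measurable]: "flat m \<in> borel_measurable borel"
  by (intro borel_measurable_continuous_onI continuous_at_imp_continuous_on ballI)
    (rule DERIV_isCont[OF flat_has_real_derivative])

lemma bump_measurable: "(\<lambda>p. bump m r (fst p) (snd p)) \<in> borel_measurable (borel \<Otimes>\<^sub>M borel)"
  unfolding bump_def by measurable

lemma bump_measurable' [measurable]: "bump m r x \<in> borel_measurable borel"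
  unfolding bump_def[abs_def] by measurable

lemma bump_le_indicator: "0 < r \<Longrightarrow> bump 0 r x y \<le> indicator (ball x r) y"
  using bump_0_le_1[of r x y] bump_outside[of r y x 0]
  by (auto simp: indicator_def dist_norm norm_minus_commute)

lemma integrable_indicator_ball: "integrable lborel (indicat_real (ball (x::real^'n) r))"
  using emeasure_lborel_ball_finite[of x r] by (intro integrable_real_indicator) auto

lemma integrable_bump:
  assumes "0 < r"
  shows "integrable lborel (bump 0 r (x::real^'n))"
  by (rule Bochner_Integration.integrable_bound[OF integrable_indicator_ball[of x r]])
    (use bump_le_indicator[OF assms, of x] bump_nonneg[of 0 r x] in \<open>auto simp: abs_of_nonneg\<close>)

lemma integral_lborel_translate:
  fixes f :: "'a::euclidean_space \<Rightarrow> 'b::{banach, second_countable_topology}"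
  assumes "f \<in> borel_measurable borel"
  shows "(LINT y|lborel. f (a + y)) = (LINT y|lborel. f y)"
proof -
  have "(LINT y|lborel. f y) = (LINT y|distr lborel borel ((+) a). f y)" by (simp add: lborel_distr_plus)
  also have "\<dots> = (LINT y|lborel. f (a + y))" using assms by (intro integral_distr) auto
  finally show ?thesis by simp
qed

lemma integral_lborel_reflect:
  fixes f :: "'a::euclidean_space \<Rightarrow> 'b::{banach, second_countable_topology}"
  assumes "f \<in> borel_measurable borel"
  shows "(LINT y|lborel. f (a - y)) = (LINT y|lborel. f y)"
proof -
  have "lborel = distr lborel borel (\<lambda>y. a - y)"
    using lborel_affine[of "-1" a] by (simp add: density_1)
  then have "(LINT y|lborel. f y) = (LINT y|distr lborel borel (\<lambda>y. a - y). f y)" by simp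
  also have "\<dots> = (LINT y|lborel. f (a - y))" using assms by (intro integral_distr) auto
  finally show ?thesis by simp
qed

lemma integral_bump_shift: "(LINT z|lborel. bump 0 r (x::real^'n) z) = (LINT z|lborel. bump 0 r (0::real^'n) z)"
  using integral_lborel_translate[of "bump 0 r x" x] by (simp add: bump_def)

text \<open>
  On the ball of radius \<open>r / 2\<close> the argument of \<open>flat 0\<close> is at least \<open>3/4\<close>. This bounds the mollifier by a
  constant over the volume of the ball, which is what convergence at Lebesgue points and jump points rests on.
\<close>

lemma bump_mass_lower_bound:
  assumes r: "0 < r"
  shows "flat 0 (3/4) / 2 ^ CARD('n) * measure lborel (ball (x::real^'n) r) \<le> (LINT z|lborel. bump 0 r (0::real^'n) z)"
proof -
  let ?f = "flat 0 (3/4)"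
  have "?f * indicator (ball 0 (r / 2)) z \<le> bump 0 r (0::real^'n) z" for z
  proof (cases "z \<in> ball 0 (r / 2)")
    case True
    then have "(norm z)\<^sup>2 \<le> (r / 2)\<^sup>2" by (intro power_mono) auto
    then have "(norm z)\<^sup>2 / r\<^sup>2 \<le> 1 / 4" using r by (simp add: power_divide field_simps)
    then have t: "3 / 4 \<le> 1 - (norm z)\<^sup>2 / r\<^sup>2" by simp
    have "flat 0 s \<le> flat 0 t" if "0 < s" "s \<le> t" for s t
      using that by (simp add: flat_def frac_le)
    from this[OF _ t] show ?thesis using True by (simp add: bump_def)
  next
    case False
    then show ?thesis using bump_nonneg[of 0 r 0 z] by simp
  qed
  then have "(LINT z|lborel. ?f * indicator (ball (0::real^'n) (r / 2)) z) \<le> (LINT z|lborel. bump 0 r (0::real^'n) z)"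
    using integrable_indicator_ball[of "0::real^'n" "r/2"] integrable_bump[OF r, of 0] by (intro integral_mono) auto
  then have "?f * measure lborel (ball (0::real^'n) (r / 2)) \<le> (LINT z|lborel. bump 0 r (0::real^'n) z)"
    by simp
  moreover have "measure lborel (ball (0::real^'n) (r / 2)) = (1/2) ^ CARD('n) * measure lborel (ball x r)"
    using content_ball_scale[OF r, of "1/2" "0::real^'n" x] by simp
  ultimately show ?thesis by (simp add: power_one_over)
qed

lemma bump_mass_pos: "0 < r \<Longrightarrow> 0 < (LINT z|lborel. bump 0 r (0::real^'n) z)"
  by (rule less_le_trans[OF _ bump_mass_lower_bound[of r 0]])
    (auto intro!: mult_pos_pos divide_pos_pos flat_pos content_ball_pos_lborel)

lemma mollifier_nonneg: "0 < r \<Longrightarrow> 0 \<le> mollifier r (x::real^'n) y"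
  unfolding mollifier_def using bump_mass_pos[where 'n='n] by (intro divide_nonneg_pos bump_nonneg)

lemma mollifier_commute: "mollifier r x y = mollifier r y x"
  by (simp add: mollifier_def bump_commute[of 0 r x])

lemma mollifier_measurable: "(\<lambda>p. mollifier r (fst p) (snd p)) \<in> borel_measurable (borel \<Otimes>\<^sub>M borel)"
  unfolding mollifier_def using bump_measurable by (intro borel_measurable_divide) auto

lemma mollifier_measurable' [measurable]: "mollifier r x \<in> borel_measurable borel"
  unfolding mollifier_def[abs_def] using bump_measurable'[of 0 r x] by (intro borel_measurable_divide borel_measurable_const)

lemma mollifier_integrable: "0 < r \<Longrightarrow> integrable lborel (mollifier r (x::real^'n))"
  unfolding mollifier_def[abs_def] by (intro integrable_divide integrable_bump)

lemma mollifier_integral: "0 < r \<Longrightarrow> (LINT y|lborel. mollifier r (x::real^'n) y) = 1"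
  using bump_mass_pos[of r, where 'n='n]
  by (simp only: mollifier_def integral_divide_zero integral_bump_shift[of r x]) simp

lemma mollifier_le:
  assumes r: "0 < r"
  shows "mollifier r (x::real^'n) y \<le> (2 ^ CARD('n) / flat 0 (3/4)) / measure lborel (ball x r) * indicator (ball x r) y"
proof -
  let ?c = "LINT z|lborel. bump 0 r (0::real^'n) z" and ?m = "measure lborel (ball x r)"
  have f: "0 < flat 0 (3/4)" by (rule flat_pos) simp
  have m: "0 < ?m" by (rule content_ball_pos_lborel[OF r])
  have "bump 0 r x y / ?c \<le> indicator (ball x r) y / (flat 0 (3/4) / 2 ^ CARD('n) * ?m)"
    using f m by (intro frac_le bump_le_indicator[OF r] bump_mass_lower_bound[OF r]) auto
  then show ?thesis by (simp add: mollifier_def field_simps)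
qed

lemma mollifier_bounded: "0 < r \<Longrightarrow> \<exists>B\<ge>0. \<forall>x y. mollifier r (x::real^'n) y \<le> B"
proof (intro exI conjI allI)
  assume r: "0 < r"
  show "mollifier r (x::real^'n) y \<le> 1 / (LINT z|lborel. bump 0 r (0::real^'n) z)" for x y
    unfolding mollifier_def using bump_mass_pos[OF r, where 'n='n]
    by (intro divide_right_mono bump_0_le_1) auto
  show "0 \<le> 1 / (LINT z|lborel. bump 0 r (0::real^'n) z)"
    using bump_mass_pos[OF r, where 'n='n] by simp
qed

lemma mollifier_integrable_scaleR:
  fixes v :: "real^'n \<Rightarrow> 'b::euclidean_space"
  assumes r: "0 < r" and v: "integrable lborel v"
  shows "integrable lborel (\<lambda>y. mollifier r x y *\<^sub>R v y)"
proof -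
  obtain B where B: "0 \<le> B" "\<And>x y. mollifier r (x::real^'n) y \<le> B" using mollifier_bounded[OF r] by blast
  have "integrable lborel (\<lambda>y. B *\<^sub>R v y)" using v by simp
  then show ?thesis
  proof (rule Bochner_Integration.integrable_bound)
    show "(\<lambda>y. mollifier r x y *\<^sub>R v y) \<in> borel_measurable lborel"
      using v by (intro borel_measurable_scaleR) auto
    show "AE y in lborel. norm (mollifier r x y *\<^sub>R v y) \<le> norm (B *\<^sub>R v y)"
    proof (rule AE_I2)
      fix y
      have "\<bar>mollifier r x y\<bar> \<le> \<bar>B\<bar>" using B mollifier_nonneg[OF r, of x y] by simp
      then show "norm (mollifier r x y *\<^sub>R v y) \<le> norm (B *\<^sub>R v y)"
        unfolding norm_scaleR by (rule mult_right_mono) simp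
    qed
  qed
qed

lemma norm_mollifier_integral_le:
  fixes w :: "real^'n \<Rightarrow> 'b::euclidean_space"
  assumes r: "0 < r" and S: "S \<in> sets borel" and w: "integrable lborel (\<lambda>y. indicator (S \<inter> ball x r) y * norm (w y))"
  shows "norm (LINT y|lborel. (indicator S y * mollifier r x y) *\<^sub>R w y)
    \<le> 2 ^ CARD('n) / flat 0 (3/4) * ((LINT y|lborel. indicator (S \<inter> ball x r) y * norm (w y)) / measure lborel (ball x r))"
proof -
  let ?k = "2 ^ CARD('n) / flat 0 (3/4) / measure lborel (ball x r)"
  have "norm (LINT y|lborel. (indicator S y * mollifier r x y) *\<^sub>R w y)
      \<le> (LINT y|lborel. norm ((indicator S y * mollifier r x y) *\<^sub>R w y))"
    by (rule integral_norm_bound)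
  also have "\<dots> \<le> (LINT y|lborel. ?k * (indicator (S \<inter> ball x r) y * norm (w y)))"
  proof (rule integral_mono_AE')
    show "integrable lborel (\<lambda>y. ?k * (indicator (S \<inter> ball x r) y * norm (w y)))" using w by simp
    have k: "0 \<le> ?k" using flat_nonneg by (intro divide_nonneg_nonneg) auto
    then show "AE y in lborel. 0 \<le> ?k * (indicator (S \<inter> ball x r) y * norm (w y))"
      by (intro AE_I2 mult_nonneg_nonneg) auto
    show "AE y in lborel. norm ((indicator S y * mollifier r x y) *\<^sub>R w y) \<le> ?k * (indicator (S \<inter> ball x r) y * norm (w y))"
    proof (rule AE_I2)
      fix y
      have "mollifier r x y \<le> ?k * indicator (ball x r) y" by (rule mollifier_le[OF r])
      then have "indicator S y * mollifier r x y * norm (w y) \<le> indicator S y * (?k * indicator (ball x r) y) * norm (w y)"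
        by (intro mult_right_mono mult_left_mono) auto
      then show "norm ((indicator S y * mollifier r x y) *\<^sub>R w y) \<le> ?k * (indicator (S \<inter> ball x r) y * norm (w y))"
        using mollifier_nonneg[OF r, of x y] by (simp add: abs_mult indicator_inter_arith mult_ac)
    qed
  qed
  also have "\<dots> = ?k * (LINT y|lborel. indicator (S \<inter> ball x r) y * norm (w y))"
    by (rule integral_mult_right_zero)
  finally show ?thesis by simp
qed

lemma integrable_indicator_bounded:
  fixes v :: "real^'n \<Rightarrow> 'b::euclidean_space" and x :: "real^'n"
  assumes v: "integrable lborel v" and S: "S \<in> sets borel"
  shows "integrable lborel (\<lambda>y. indicator (S \<inter> ball x r) y * norm (v y - (z::'b)))"
proof (rule Bochner_Integration.integrable_bound)
  show "integrable lborel (\<lambda>y. norm (v y) + norm z * indicator (ball x r) y)"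
    using v integrable_indicator_ball[of x r] by auto
  show "(\<lambda>y. indicator (S \<inter> ball x r) y * norm (v y - z)) \<in> borel_measurable lborel"
    using v S by (intro borel_measurable_times borel_measurable_indicator borel_measurable_norm borel_measurable_diff) auto
  show "AE y in lborel. norm (indicator (S \<inter> ball x r) y * norm (v y - z)) \<le> norm (norm (v y) + norm z * indicator (ball x r) y)"
  proof (rule AE_I2)
    fix y show "norm (indicator (S \<inter> ball x r) y * norm (v y - z)) \<le> norm (norm (v y) + norm z * indicator (ball x r) y)"
      using norm_triangle_ineq4[of "v y" z] by (auto simp: indicator_def)
  qed
qed

lemma mollify_tendsto_Lebesgue_point:
  fixes v :: "real^'n \<Rightarrow> 'b::euclidean_space"
  assumes v: "integrable lborel v"
    and lim: "((\<lambda>r. ball_integral x r (\<lambda>y. norm (v y - z)) / measure lborel (ball x r)) \<longlongrightarrow> 0) (at_right 0)"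
  shows "((\<lambda>r. mollify r v x) \<longlongrightarrow> z) (at_right 0)"
proof -
  let ?k = "2 ^ CARD('n) / flat 0 (3/4)"
  have "((\<lambda>r. mollify r v x - z) \<longlongrightarrow> 0) (at_right 0)"
  proof (rule Lim_null_comparison)
    show "((\<lambda>r. ?k * (ball_integral x r (\<lambda>y. norm (v y - z)) / measure lborel (ball x r))) \<longlongrightarrow> 0) (at_right 0)"
      by (rule tendsto_mult_right_zero[OF lim])
    have "norm (mollify r v x - z) \<le> ?k * (ball_integral x r (\<lambda>y. norm (v y - z)) / measure lborel (ball x r))" if r: "0 < r" for r
    proof -
      have "mollify r v x - z = (LINT y|lborel. mollifier r x y *\<^sub>R v y) - (LINT y|lborel. mollifier r x y *\<^sub>R z)"
        using mollifier_integral[OF r, of x] mollifier_integrable[OF r, of x] by (simp add: mollify_def)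
      also have "\<dots> = (LINT y|lborel. mollifier r x y *\<^sub>R v y - mollifier r x y *\<^sub>R z)"
        using mollifier_integrable_scaleR[OF r v, of x] mollifier_integrable[OF r, of x]
        by (intro Bochner_Integration.integral_diff[symmetric]) auto
      also have "\<dots> = (LINT y|lborel. (indicator UNIV y * mollifier r x y) *\<^sub>R (v y - z))"
        by (simp add: scaleR_diff_right)
      finally show ?thesis
        using norm_mollifier_integral_le[OF r, of UNIV x "\<lambda>y. v y - z"] integrable_indicator_bounded[OF v, of UNIV x r z]
        by simp
    qed
    then show "\<forall>\<^sub>F r in at_right 0. norm (mollify r v x - z) \<le> ?k * (ball_integral x r (\<lambda>y. norm (v y - z)) / measure lborel (ball x r))"
      by (auto simp: eventually_at_right_field intro: exI[of _ 1])
  qed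
  then show ?thesis by (simp add: LIM_zero_iff)
qed

abbreviation half_space :: "real^'n \<Rightarrow> real^'n \<Rightarrow> (real^'n) set" where
  "half_space x \<nu> \<equiv> {y. 0 < (y - x) \<bullet> \<nu>}"

lemma half_space_borel: "half_space x \<nu> \<in> sets borel"
  by (intro borel_open open_Collect_less continuous_intros)

text \<open>
  The reflection in \<open>x\<close> exchanges the two half-spaces and preserves the kernel; the hyperplane between them is
  null.
\<close>

lemma mollifier_half_integral:
  assumes r: "0 < r" and \<nu>: "\<nu> \<noteq> 0"
  shows "(LINT y|lborel. indicator (half_space x \<nu>) y * mollifier r (x::real^'n) y) = 1 / 2"
proof -
  let ?I = "\<lambda>\<nu>. LINT y|lborel. indicator (half_space x \<nu>) y * mollifier r x y"
  have m: "(\<lambda>y. indicator (half_space x \<nu>) y * mollifier r x y) \<in> borel_measurable borel" for \<nu>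
    using half_space_borel by (intro borel_measurable_times borel_measurable_indicator) auto
  have int: "integrable lborel (\<lambda>y. indicator (half_space x \<nu>) y * mollifier r x y)" for \<nu>
    using integrable_mult_indicator[of "half_space x \<nu>" lborel "mollifier r x"] mollifier_integrable[OF r] half_space_borel by auto
  have sym: "indicator (half_space x \<nu>) (2 *\<^sub>R x - y) * mollifier r x (2 *\<^sub>R x - y)
      = (indicator (half_space x (- \<nu>)) y * mollifier r x y :: real)" for y
  proof -
    have 1: "2 *\<^sub>R x - y - x = - (y - x)" by (simp add: scaleR_2)
    have "(2 *\<^sub>R x - y - x) \<bullet> \<nu> = (y - x) \<bullet> (- \<nu>)" unfolding 1 by (simp only: inner_minus_left inner_minus_right)
    moreover have "mollifier r x (2 *\<^sub>R x - y) = mollifier r x y"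
      unfolding mollifier_def bump_def 1 by (simp only: norm_minus_cancel)
    ultimately show ?thesis by (simp add: indicator_def)
  qed
  have eq: "?I \<nu> = ?I (- \<nu>)"
    using integral_lborel_reflect[OF m[of \<nu>], of "2 *\<^sub>R x"] unfolding sym by simp
  have "{y. \<nu> \<bullet> y = \<nu> \<bullet> x} \<in> null_sets lebesgue"
    using negligible_hyperplane[of \<nu> "\<nu> \<bullet> x"] \<nu> by (auto simp: negligible_iff_null_sets)
  then have "AE y in lebesgue. y \<notin> {y. \<nu> \<bullet> y = \<nu> \<bullet> x}" by (rule AE_not_in)
  then have "AE y in lborel. \<nu> \<bullet> y \<noteq> \<nu> \<bullet> x" by (simp add: AE_completion_iff)
  then have ae: "AE y in lborel. indicator (half_space x \<nu>) y * mollifier r x y + indicator (half_space x (- \<nu>)) y * mollifier r x y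
      = mollifier r x y"
  proof eventually_elim
    case (elim y)
    then have "(y - x) \<bullet> \<nu> \<noteq> 0" by (simp add: inner_commute[of _ \<nu>] inner_diff_right)
    then show ?case by (auto simp: indicator_def)
  qed
  have "?I \<nu> + ?I (- \<nu>) = (LINT y|lborel. indicator (half_space x \<nu>) y * mollifier r x y + indicator (half_space x (- \<nu>)) y * mollifier r x y)"
    using int[of \<nu>] int[of "- \<nu>"] by (intro Bochner_Integration.integral_add[symmetric])
  also have "\<dots> = (LINT y|lborel. mollifier r x y)"
    using m[of \<nu>] m[of "- \<nu>"] ae by (intro integral_cong_AE) auto
  finally show ?thesis using eq mollifier_integral[OF r, of x] by simp
qed

text \<open>
  Both half-spaces carry half of the mass of the kernel, so the two one-sided limits enter with weight \<open>1/2\<close>.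
\<close>

lemma mollify_tendsto_jump_point:
  fixes v :: "real^'n \<Rightarrow> 'b::euclidean_space"
  assumes v: "integrable lborel v" and \<nu>: "norm \<nu> = 1"
    and a: "((\<lambda>r. (LINT y|lborel. indicator (half_space x \<nu> \<inter> ball x r) y * norm (v y - a)) / measure lborel (ball x r)) \<longlongrightarrow> 0) (at_right 0)"
    and b: "((\<lambda>r. (LINT y|lborel. indicator (half_space x (- \<nu>) \<inter> ball x r) y * norm (v y - b)) / measure lborel (ball x r)) \<longlongrightarrow> 0) (at_right 0)"
  shows "((\<lambda>r. mollify r v x) \<longlongrightarrow> (1/2) *\<^sub>R (a + b)) (at_right 0)"
proof -
  let ?k = "2 ^ CARD('n) / flat 0 (3/4)"
  let ?J = "\<lambda>\<nu> z r. (LINT y|lborel. indicator (half_space x \<nu> \<inter> ball x r) y * norm (v y - z)) / measure lborel (ball x r)"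
  let ?P = "\<lambda>\<nu> r. LINT y|lborel. (indicator (half_space x \<nu>) y * mollifier r x y) *\<^sub>R v y"
  have \<nu>0: "\<nu> \<noteq> 0" using \<nu> by auto
  have int: "integrable lborel (\<lambda>y. (indicator (half_space x \<nu>) y * mollifier r x y) *\<^sub>R v y)" if "0 < r" for r \<nu>
    using integrable_mult_indicator[OF _ mollifier_integrable_scaleR[OF that v, of x], of "half_space x \<nu>"] half_space_borel
    by auto
  have intK: "integrable lborel (\<lambda>y. indicator (half_space x \<nu>) y * mollifier r x y)" if "0 < r" for \<nu> r
    using integrable_mult_indicator[of "half_space x \<nu>" lborel "mollifier r x"] mollifier_integrable[OF that] half_space_borel by auto
  have half: "norm (?P \<nu> r - (1/2) *\<^sub>R z) \<le> ?k * ?J \<nu> z r" if r: "0 < r" and "\<nu> \<noteq> 0" for \<nu> z r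
  proof -
    have "?P \<nu> r - (1/2) *\<^sub>R z = ?P \<nu> r - (LINT y|lborel. (indicator (half_space x \<nu>) y * mollifier r x y) *\<^sub>R z)"
      using mollifier_half_integral[OF r \<open>\<nu> \<noteq> 0\<close>, of x] intK[OF r, of \<nu>] by simp
    also have "\<dots> = (LINT y|lborel. (indicator (half_space x \<nu>) y * mollifier r x y) *\<^sub>R v y - (indicator (half_space x \<nu>) y * mollifier r x y) *\<^sub>R z)"
      using int[OF r] intK[OF r] by (intro Bochner_Integration.integral_diff[symmetric]) auto
    also have "\<dots> = (LINT y|lborel. (indicator (half_space x \<nu>) y * mollifier r x y) *\<^sub>R (v y - z))"
      by (simp add: scaleR_diff_right)
    finally show ?thesis
      using norm_mollifier_integral_le[OF r half_space_borel, of x \<nu> x "\<lambda>y. v y - z"]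
        integrable_indicator_bounded[OF v half_space_borel, of x \<nu> x r z] by simp
  qed
  have null: "{y. \<nu> \<bullet> y = \<nu> \<bullet> x} \<in> null_sets lebesgue"
    using negligible_hyperplane[of \<nu> "\<nu> \<bullet> x"] \<nu>0 by (auto simp: negligible_iff_null_sets)
  then have "AE y in lebesgue. y \<notin> {y. \<nu> \<bullet> y = \<nu> \<bullet> x}" by (rule AE_not_in)
  then have ae: "AE y in lborel. \<nu> \<bullet> y \<noteq> \<nu> \<bullet> x" by (simp add: AE_completion_iff)
  have split: "mollify r v x = ?P \<nu> r + ?P (- \<nu>) r" if r: "0 < r" for r
  proof -
    have "?P \<nu> r + ?P (- \<nu>) r = (LINT y|lborel. (indicator (half_space x \<nu>) y * mollifier r x y) *\<^sub>R v y + (indicator (half_space x (- \<nu>)) y * mollifier r x y) *\<^sub>R v y)"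
      using int[OF r, of \<nu>] int[OF r, of "- \<nu>"] by (intro Bochner_Integration.integral_add[symmetric])
    also have "\<dots> = mollify r v x"
      unfolding mollify_def
    proof (rule integral_cong_AE)
      show "AE y in lborel. (indicator (half_space x \<nu>) y * mollifier r x y) *\<^sub>R v y + (indicator (half_space x (- \<nu>)) y * mollifier r x y) *\<^sub>R v y
          = mollifier r x y *\<^sub>R v y"
        using ae
      proof eventually_elim
        case (elim y)
        then have "(y - x) \<bullet> \<nu> \<noteq> 0" by (simp add: inner_commute[of _ \<nu>] inner_diff_right)
        then show ?case by (auto simp: indicator_def)
      qed
    qed (use int[OF r, of \<nu>] int[OF r, of "- \<nu>"] mollifier_integrable_scaleR[OF r v, of x] in auto)
    finally show ?thesis by simp
  qed
  have "((\<lambda>r. mollify r v x - (1/2) *\<^sub>R (a + b)) \<longlongrightarrow> 0) (at_right 0)"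
  proof (rule Lim_null_comparison)
    show "((\<lambda>r. ?k * ?J \<nu> a r + ?k * ?J (- \<nu>) b r) \<longlongrightarrow> 0) (at_right 0)"
      using tendsto_add[OF tendsto_mult_right_zero[OF a, of ?k] tendsto_mult_right_zero[OF b, of ?k]] by simp
    have "norm (mollify r v x - (1/2) *\<^sub>R (a + b)) \<le> ?k * ?J \<nu> a r + ?k * ?J (- \<nu>) b r" if r: "0 < r" for r
    proof -
      have "mollify r v x - (1/2) *\<^sub>R (a + b) = (?P \<nu> r - (1/2) *\<^sub>R a) + (?P (- \<nu>) r - (1/2) *\<^sub>R b)"
        unfolding split[OF r] by (simp add: scaleR_add_right)
      then show ?thesis
        using norm_triangle_mono[OF half[OF r \<nu>0, of a] half[OF r, of "- \<nu>" b]] \<nu>0 by simp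
    qed
    then show "\<forall>\<^sub>F r in at_right 0. norm (mollify r v x - (1/2) *\<^sub>R (a + b)) \<le> ?k * ?J \<nu> a r + ?k * ?J (- \<nu>) b r"
      by (auto simp: eventually_at_right_field intro: exI[of _ 1])
  qed
  then show ?thesis by (simp add: LIM_zero_iff)
qed

section \<open>Borel representatives and the precise representative\<close>

text \<open>
  The fields \<open>A\<close> and \<open>u\<close> are only Lebesgue measurable and matter only up to null sets of \<open>\<Omega>\<close>. Fubini's theorem
  with a Borel measure as one factor needs Borel representatives; extended by \<open>0\<close>, they are
  defined on the whole space.
\<close>

definition borel_version :: "'a::euclidean_space set \<Rightarrow> ('a \<Rightarrow> 'b::euclidean_space) \<Rightarrow> ('a \<Rightarrow> 'b) \<Rightarrow> bool" where
  "borel_version \<Omega> u v \<longleftrightarrow> v \<in> borel_measurable borel \<and> (\<forall>y. y \<notin> \<Omega> \<longrightarrow> v y = 0) \<and>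
     (AE y in lborel. y \<in> \<Omega> \<longrightarrow> u y = v y)"

lemma AE_lebesgue_on_iff:
  "S \<in> sets borel \<Longrightarrow> (AE y in lebesgue_on S. P y) \<longleftrightarrow> (AE y in lborel. y \<in> S \<longrightarrow> P y)"
  by (subst AE_restrict_space_iff) (auto simp: AE_completion_iff)

lemma integral_lebesgue_on_eq_lborel:
  fixes f g :: "'a::euclidean_space \<Rightarrow> 'b::{banach, second_countable_topology}"
  assumes S: "S \<in> sets borel" and f: "f \<in> borel_measurable (lebesgue_on S)" and g: "g \<in> borel_measurable borel"
    and ae: "AE y in lborel. y \<in> S \<longrightarrow> f y = g y"
  shows "(LINT y|lebesgue_on S. f y) = (LINT y|lborel. indicator S y *\<^sub>R g y)"
proof -
  have gl: "g \<in> borel_measurable lebesgue" using g by (simp add: measurable_completion)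
  have "(LINT y|lebesgue_on S. f y) = (LINT y|lebesgue_on S. g y)"
    using f gl ae S by (intro integral_cong_AE) (auto simp: AE_lebesgue_on_iff measurable_restrict_space1)
  also have "\<dots> = (LINT y|lebesgue. indicator S y *\<^sub>R g y)"
    using S by (intro integral_restrict_space) auto
  also have "\<dots> = (LINT y|lborel. indicator S y *\<^sub>R g y)"
    using S g by (intro integral_completion borel_measurable_scaleR borel_measurable_indicator) auto
  finally show ?thesis .
qed

lemma exists_borel_version:
  fixes u :: "'a::euclidean_space \<Rightarrow> 'b::euclidean_space"
  assumes \<Omega>: "\<Omega> \<in> sets borel" and u: "u \<in> L_infty \<Omega>"
  obtains v M where "borel_version \<Omega> u v" "\<And>y. norm (v y) \<le> M"
proof -
  have um: "u \<in> borel_measurable (lebesgue_on \<Omega>)" and fin: "Linf_norm \<Omega> u < \<infinity>"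
    using u by (auto simp: L_infty_def)
  obtain M where M0: "Linf_norm \<Omega> u = ennreal M" "0 \<le> M" using fin by (cases "Linf_norm \<Omega> u") auto
  have "AE y in lebesgue_on \<Omega>. ennreal (norm (u y)) \<le> Linf_norm \<Omega> u"
    unfolding Linf_norm_def by (rule esssup_AE)
  then have "AE y in lebesgue_on \<Omega>. norm (u y) \<le> M" using M0 by (simp add: ennreal_le_iff)
  then have M: "AE y in lborel. y \<in> \<Omega> \<longrightarrow> norm (u y) \<le> M"
    by (simp only: AE_lebesgue_on_iff[OF \<Omega>])
  have "(\<lambda>y. indicator \<Omega> y *\<^sub>R u y) \<in> borel_measurable lebesgue"
    using um \<Omega> by (subst borel_measurable_restrict_space_iff[symmetric]) auto
  then have "\<exists>g\<in>borel_measurable lborel. AE y in lborel. (indicator \<Omega> y *\<^sub>R u y) \<bullet> b = g y" for b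
    by (intro completion_ex_borel_measurable_real borel_measurable_inner) auto
  then have "\<forall>b. \<exists>g. g \<in> borel_measurable lborel \<and> (AE y in lborel. (indicator \<Omega> y *\<^sub>R u y) \<bullet> b = g y)"
    by blast
  then obtain g where g: "\<And>b. g b \<in> borel_measurable lborel" "\<And>b. AE y in lborel. (indicator \<Omega> y *\<^sub>R u y) \<bullet> b = g b y"
    by metis
  define w where "w y = (\<Sum>b\<in>Basis. g b y *\<^sub>R b)" for y
  have wm: "w \<in> borel_measurable borel"
    unfolding w_def[abs_def] using g(1) by (intro borel_measurable_sum borel_measurable_scaleR) auto
  have w: "AE y in lborel. indicator \<Omega> y *\<^sub>R u y = w y"
  proof -
    have "AE y in lborel. \<forall>b\<in>Basis. (indicator \<Omega> y *\<^sub>R u y) \<bullet> b = g b y"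
      using g(2) by (intro AE_finite_allI) auto
    then show ?thesis
    proof eventually_elim
      case (elim y)
      have "w y = (\<Sum>b\<in>Basis. ((indicator \<Omega> y *\<^sub>R u y) \<bullet> b) *\<^sub>R b)"
        unfolding w_def using elim by (intro sum.cong) auto
      then show ?case by (simp only: euclidean_representation)
    qed
  qed
  define v where "v y = (if y \<in> \<Omega> \<and> norm (w y) \<le> M then w y else 0)" for y
  show ?thesis
  proof (rule that)
    have "v \<in> borel_measurable borel"
    proof -
      have "{y \<in> space borel. y \<in> \<Omega> \<and> norm (w y) \<le> M} \<in> sets borel" using wm \<Omega> by measurable
      then show ?thesis unfolding v_def[abs_def] using wm by (intro measurable_If) auto
    qed
    moreover have "AE y in lborel. y \<in> \<Omega> \<longrightarrow> u y = v y"
      using w M by eventually_elim (auto simp: v_def)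
    ultimately show "borel_version \<Omega> u v" by (simp add: borel_version_def v_def)
    show "norm (v y) \<le> M" for y using M0(2) by (simp add: v_def)
  qed
qed

lemma borel_version_integral:
  fixes u v :: "'a::euclidean_space \<Rightarrow> 'b::euclidean_space" and h :: "'a \<Rightarrow> 'b \<Rightarrow> real"
  assumes v: "borel_version \<Omega> u v" and u: "u \<in> borel_measurable (lebesgue_on \<Omega>)"
    and S: "S \<in> sets borel" "S \<subseteq> \<Omega>" and h: "(\<lambda>p. h (fst p) (snd p)) \<in> borel_measurable (borel \<Otimes>\<^sub>M borel)"
  shows "(LINT y|lebesgue_on S. h y (u y)) = (LINT y|lborel. indicator S y *\<^sub>R h y (v y))"
proof (rule integral_lebesgue_on_eq_lborel[OF S(1)])
  have comp: "(\<lambda>y. h y (w y)) \<in> borel_measurable M" if "w \<in> borel_measurable M" "(\<lambda>y. y) \<in> borel_measurable M"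
    for w :: "'a \<Rightarrow> 'b" and M :: "'a measure"
    using measurable_compose[OF measurable_Pair[OF that(2,1)] h] by simp
  have "u \<in> borel_measurable (lebesgue_on S)" by (rule measurable_restrict_mono[OF u S(2)])
  moreover have "(\<lambda>y. y) \<in> borel_measurable (lebesgue_on S)"
    by (rule measurable_restrict_space1) (simp add: measurable_completion)
  ultimately show "(\<lambda>y. h y (u y)) \<in> borel_measurable (lebesgue_on S)" by (rule comp)
  show "(\<lambda>y. h y (v y)) \<in> borel_measurable borel"
    using v by (intro comp) (auto simp: borel_version_def)
  show "AE y in lborel. y \<in> S \<longrightarrow> h y (u y) = h y (v y)"
    using v S(2) unfolding borel_version_def by (auto elim!: eventually_mono)
qed

lemma mean_value_borel_version:
  assumes v: "borel_version \<Omega> u v" and u: "u \<in> borel_measurable (lebesgue_on \<Omega>)"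
    and S: "S \<in> sets borel" "S \<subseteq> \<Omega>"
  shows "mean_value S (\<lambda>y. norm (u y - z)) = (LINT y|lborel. indicator S y * norm (v y - z)) / measure lborel S"
proof -
  have "(LINT y|lebesgue_on S. norm (u y - z)) = (LINT y|lborel. indicator S y *\<^sub>R norm (v y - z))"
    by (rule borel_version_integral[OF v u S, of "\<lambda>y a. norm (a - z)"]) measurable
  then show ?thesis using S by (simp add: mean_value_def measure_completion)
qed

lemma approx_limit_iff_ball_integral:
  assumes \<Omega>: "open \<Omega>" and v: "borel_version \<Omega> u v" and u: "u \<in> borel_measurable (lebesgue_on \<Omega>)" and x: "x \<in> \<Omega>"
  shows "approx_limit u x z \<longleftrightarrow>
    ((\<lambda>r. ball_integral x r (\<lambda>y. norm (v y - z)) / measure lborel (ball x r)) \<longlongrightarrow> 0) (at_right 0)"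
proof -
  obtain d where d: "0 < d" "ball x d \<subseteq> \<Omega>" using \<Omega> x by (auto simp: open_contains_ball)
  have "mean_value (ball x r) (\<lambda>y. norm (u y - z)) = ball_integral x r (\<lambda>y. norm (v y - z)) / measure lborel (ball x r)"
    if "r < d" for r
    using that d subset_ball[of r d x] by (intro mean_value_borel_version[OF v u]) auto
  then have "\<forall>\<^sub>F r in at_right 0. mean_value (ball x r) (\<lambda>y. norm (u y - z))
      = ball_integral x r (\<lambda>y. norm (v y - z)) / measure lborel (ball x r)"
    using d(1) unfolding eventually_at_right_field by blast
  then show ?thesis unfolding approx_limit_def by (rule tendsto_cong)
qed

text \<open>
  Averages over half-balls are at least as large as the same integrals divided by the volume of the full ball.
\<close>

lemma half_ball_limit_imp:
  fixes u v :: "real^'n \<Rightarrow> 'b::euclidean_space"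
  assumes \<Omega>: "open \<Omega>" and v: "borel_version \<Omega> u v" and u: "u \<in> borel_measurable (lebesgue_on \<Omega>)" and x: "x \<in> \<Omega>"
    and lim: "((\<lambda>r. mean_value (half_ball x r \<nu>) (\<lambda>y. norm (u y - z))) \<longlongrightarrow> 0) (at_right 0)"
  shows "((\<lambda>r. (LINT y|lborel. indicator (half_space x \<nu> \<inter> ball x r) y * norm (v y - z)) / measure lborel (ball x r)) \<longlongrightarrow> 0) (at_right 0)"
proof -
  obtain d where d: "0 < d" "ball x d \<subseteq> \<Omega>" using \<Omega> x by (auto simp: open_contains_ball)
  have bound: "norm ((LINT y|lborel. indicator (half_space x \<nu> \<inter> ball x r) y * norm (v y - z)) / measure lborel (ball x r))
      \<le> mean_value (half_ball x r \<nu>) (\<lambda>y. norm (u y - z))" if r: "0 < r" "r < d" for r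
  proof -
    let ?S = "half_space x \<nu> \<inter> ball x r"
    let ?n = "LINT y|lborel. indicator ?S y * norm (v y - z)"
    have S: "?S \<in> sets borel" using half_space_borel by auto
    have hb: "half_ball x r \<nu> = ?S" by (auto simp: half_ball_def)
    have mv: "mean_value (half_ball x r \<nu>) (\<lambda>y. norm (u y - z)) = ?n / measure lborel ?S"
      unfolding hb using r d subset_ball[of r d x] S by (intro mean_value_borel_version[OF v u]) auto
    have n0: "0 \<le> ?n" by (intro integral_nonneg_AE) auto
    have mS: "measure lborel ?S \<le> measure lborel (ball x r)"
      using S emeasure_lborel_ball_finite[of x r] by (intro measure_mono_fmeasurable) (auto simp: fmeasurable_def)
    show ?thesis
    proof (cases "measure lborel ?S = 0")
      case True
      have "emeasure lborel ?S \<le> emeasure lborel (ball x r)" by (intro emeasure_mono) auto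
      then have "emeasure lborel ?S < \<infinity>" using emeasure_lborel_ball_finite[of x r] by (rule le_less_trans)
      then have "?S \<in> null_sets lborel"
        using True S by (auto simp: null_sets_def emeasure_eq_ennreal_measure less_top)
      then have "AE y in lborel. y \<notin> ?S" by (rule AE_not_in)
      then have "?n = 0" by (intro integral_eq_zero_AE) (auto elim!: eventually_mono)
      then show ?thesis unfolding mv by simp
    next
      case False
      then have "0 < measure lborel ?S" using measure_nonneg[of lborel ?S] by linarith
      then show ?thesis unfolding mv using mS n0 by (simp add: frac_le)
    qed
  qed
  show ?thesis
  proof (rule Lim_null_comparison[OF _ lim])
    show "\<forall>\<^sub>F r in at_right 0. norm ((LINT y|lborel. indicator (half_space x \<nu> \<inter> ball x r) y * norm (v y - z)) / measure lborel (ball x r))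
      \<le> mean_value (half_ball x r \<nu>) (\<lambda>y. norm (u y - z))"
      unfolding eventually_at_right_field using bound d(1) by blast
  qed
qed

text \<open>
  Whichever approximate limit or pair of one-sided limits the precise representative picks, the mollifications
  converge to it; in particular it is a pointwise limit of Borel functions.
\<close>

lemma mollify_tendsto_precise_rep:
  fixes u v :: "real^'n \<Rightarrow> 'b::euclidean_space"
  assumes \<Omega>: "open \<Omega>" and v: "borel_version \<Omega> u v" "integrable lborel v" and u: "u \<in> borel_measurable (lebesgue_on \<Omega>)"
    and x: "x \<in> \<Omega>" "x \<notin> disc_set \<Omega> u - jump_set \<Omega> u"
  shows "((\<lambda>r. mollify r v x) \<longlongrightarrow> precise_rep \<Omega> u x) (at_right 0)"
proof (cases "x \<in> disc_set \<Omega> u")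
  case False
  then have "\<exists>z. approx_limit u x z" using x by (auto simp: disc_set_def)
  then have "approx_limit u x (SOME z. approx_limit u x z)" by (rule someI_ex)
  moreover have "precise_rep \<Omega> u x = (SOME z. approx_limit u x z)" using False x by (simp add: precise_rep_def)
  ultimately have "approx_limit u x (precise_rep \<Omega> u x)" by simp
  then show ?thesis
    unfolding approx_limit_iff_ball_integral[OF \<Omega> v(1) u x(1)] by (rule mollify_tendsto_Lebesgue_point[OF v(2)])
next
  case True
  then have j: "x \<in> jump_set \<Omega> u" using x by blast
  then have "\<exists>p. case p of (a, b) \<Rightarrow> \<exists>\<nu>. approx_jump u x a b \<nu>" by (auto simp: jump_set_def)
  then have "case jump_values u x of (a, b) \<Rightarrow> \<exists>\<nu>. approx_jump u x a b \<nu>"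
    unfolding jump_values_def by (rule someI_ex)
  then obtain \<nu> where \<nu>: "approx_jump u x (fst (jump_values u x)) (snd (jump_values u x)) \<nu>" by (auto simp: split_beta)
  then have "norm \<nu> = 1"
    and a: "((\<lambda>r. mean_value (half_ball x r \<nu>) (\<lambda>y. norm (u y - fst (jump_values u x)))) \<longlongrightarrow> 0) (at_right 0)"
    and b: "((\<lambda>r. mean_value (half_ball x r (- \<nu>)) (\<lambda>y. norm (u y - snd (jump_values u x)))) \<longlongrightarrow> 0) (at_right 0)"
    by (simp_all add: approx_jump_def)
  have "precise_rep \<Omega> u x = (1/2) *\<^sub>R (fst (jump_values u x) + snd (jump_values u x))"
    using True j by (simp add: precise_rep_def)
  then show ?thesis
    using mollify_tendsto_jump_point[OF v(2) \<open>norm \<nu> = 1\<close> half_ball_limit_imp[OF \<Omega> v(1) u x(1) a]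
        half_ball_limit_imp[OF \<Omega> v(1) u x(1) b]] by (simp only:)
qed

lemma disc_set_negligible:
  fixes u v :: "real^'n \<Rightarrow> 'b::euclidean_space"
  assumes \<Omega>: "open \<Omega>" and v: "borel_version \<Omega> u v" "integrable lborel v" and u: "u \<in> borel_measurable (lebesgue_on \<Omega>)"
  obtains N where "negligible N" "disc_set \<Omega> u \<subseteq> N" "\<And>x. x \<notin> N \<Longrightarrow> ((\<lambda>r. mollify r v x) \<longlongrightarrow> v x) (at_right 0)"
proof -
  obtain N where N: "negligible N"
    "\<And>x. x \<notin> N \<Longrightarrow> ((\<lambda>r. ball_integral x r (\<lambda>y. norm (v y - v x)) / measure lborel (ball x r)) \<longlongrightarrow> 0) (at_right 0)"
    by (rule AE_Lebesgue_point[OF v(2)]) blast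
  show ?thesis
  proof (rule that[OF N(1)])
    show "disc_set \<Omega> u \<subseteq> N"
    proof
      fix x assume x: "x \<in> disc_set \<Omega> u"
      then have "x \<in> \<Omega>" by (simp add: disc_set_def)
      show "x \<in> N"
      proof (rule ccontr)
        assume "x \<notin> N"
        then have "approx_limit u x (v x)"
          using approx_limit_iff_ball_integral[OF \<Omega> v(1) u \<open>x \<in> \<Omega>\<close>] N(2) by blast
        then show False using x by (auto simp: disc_set_def)
      qed
    qed
    show "x \<notin> N \<Longrightarrow> ((\<lambda>r. mollify r v x) \<longlongrightarrow> v x) (at_right 0)" for x
      by (rule mollify_tendsto_Lebesgue_point[OF v(2) N(2)])
  qed
qed

section \<open>The gradient of the mollifier\<close>

text \<open>
  The gradient of the mollifier in its first argument; the one in the second argument is its negative.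
\<close>

definition mollifier_grad :: "real \<Rightarrow> real^'n \<Rightarrow> real^'n \<Rightarrow> real^'n" where
  "mollifier_grad r x y = (- 2 / r\<^sup>2 * bump 2 r x y / (LINT z|lborel. bump 0 r (0::real^'n) z)) *\<^sub>R (x - y)"

lemma mollifier_eq_bump: "mollifier r (x::real^'n) y = bump 0 r x y * inverse (LINT z|lborel. bump 0 r (0::real^'n) z)"
  by (simp add: mollifier_def divide_inverse)

lemma Ck_mollifier:
  fixes x y :: "real^'n"
  shows "Ck k (mollifier r x)" "Ck k (\<lambda>x. mollifier r x y)"
proof -
  have *: "mollifier r x = (\<lambda>y. bump 0 r x y * inverse (LINT z|lborel. bump 0 r (0::real^'n) z))" for x :: "real^'n"
    by (rule ext) (rule mollifier_eq_bump)
  show 1: "Ck k (mollifier r x)" for x :: "real^'n"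
    unfolding * by (intro Ck_mult Ck_bump Ck_const)
  show "Ck k (\<lambda>x. mollifier r x y)"
    using 1[of y] by (simp add: mollifier_commute[of r _ y])
qed

lemma grad_mollifier:
  shows "grad (mollifier r x) y = - mollifier_grad r x y" and "grad (\<lambda>x. mollifier r x y) x = mollifier_grad r x y"
proof -
  have *: "mollifier r x = (\<lambda>y. bump 0 r x y * inverse (LINT z|lborel. bump 0 r (0::real^'a) z))" for x :: "real^'a"
    by (rule ext) (rule mollifier_eq_bump)
  have g: "grad (mollifier r x) y = inverse (LINT z|lborel. bump 0 r (0::real^'a) z) *\<^sub>R grad (bump 0 r x) y" for x y :: "real^'a"
    unfolding * by (subst grad_mult) (auto intro: grad_eqI(1)[OF bump_has_derivative])
  have m2: "(0::nat) + 2 = 2" by simp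
  show 1: "grad (mollifier r x) y = - mollifier_grad r x y" for x y :: "real^'a"
    unfolding g grad_bump mollifier_grad_def m2 scaleR_minus_right[symmetric] minus_diff_eq scaleR_scaleR
    by (rule arg_cong[where f="\<lambda>c. c *\<^sub>R (y - x)"]) (simp add: divide_inverse)
  have "(\<lambda>x. mollifier r x y) = mollifier r y" by (rule ext) (rule mollifier_commute)
  then have "grad (\<lambda>x. mollifier r x y) x = - mollifier_grad r y x" by (simp only: 1)
  also have "\<dots> = mollifier_grad r x y"
    unfolding mollifier_grad_def bump_commute[of 2 r y x] by (simp flip: scaleR_minus_right)
  finally show "grad (\<lambda>x. mollifier r x y) x = mollifier_grad r x y" .
qed

lemma mollifier_test_function:
  assumes "0 < r" "cball x r \<subseteq> \<Omega>"
  shows "mollifier r x \<in> test_functions \<Omega>"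
proof -
  have *: "mollifier r x = (\<lambda>y. bump 0 r x y * inverse (LINT z|lborel. bump 0 r (0::real^'a) z))"
    by (rule ext) (rule mollifier_eq_bump)
  show ?thesis
    unfolding * by (intro test_functions_mult bump_test_function assms Ck_const)
qed

lemma component_measurable: "(\<lambda>z. z $ i) \<in> borel_measurable (borel :: (real^'n) measure)"
  "(\<lambda>z. z $ j $ k) \<in> borel_measurable (borel :: (real^'m^'l) measure)"
  by (auto intro!: borel_measurable_continuous_onI continuous_intros)

lemma mollifier_grad_measurable:
  "(\<lambda>p. mollifier_grad r (fst p) (snd p) $ i) \<in> borel_measurable (borel \<Otimes>\<^sub>M (borel :: (real^'n) measure))"
proof -
  have "(\<lambda>p. fst p - snd p) \<in> borel \<Otimes>\<^sub>M (borel :: (real^'n) measure) \<rightarrow>\<^sub>M borel"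
    by measurable
  from measurable_compose[OF this component_measurable(1)[of i]]
  have "(\<lambda>p. (fst p - snd p) $ i) \<in> borel_measurable (borel \<Otimes>\<^sub>M (borel :: (real^'n) measure))" .
  then show ?thesis
    unfolding mollifier_grad_def vector_scaleR_component real_scaleR_def
    by (intro borel_measurable_times borel_measurable_divide borel_measurable_const bump_measurable)
qed

lemma mollifier_grad_bounded:
  assumes r: "0 < r"
  obtains B where "0 \<le> B" "\<And>x (y::real^'n) i. \<bar>mollifier_grad r x y $ i\<bar> \<le> B"
proof -
  have T: "mollifier r (0::real^'n) \<in> test_functions UNIV" by (rule mollifier_test_function[OF r]) simp
  obtain B where B: "\<And>x i. \<bar>grad (mollifier r (0::real^'n)) x $ i\<bar> \<le> B" "0 \<le> B"
    using test_function_bounded[OF T] by metis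
  have "\<bar>mollifier_grad r x y $ i\<bar> \<le> B" for x y :: "real^'n" and i
  proof -
    have "mollifier_grad r x y = - mollifier_grad r 0 (x - y)"
      by (simp add: mollifier_grad_def bump_def norm_minus_commute vec_eq_iff algebra_simps)
    then show ?thesis using B(1)[of "x - y" i] by (simp add: grad_mollifier(1))
  qed
  then show ?thesis using that B(2) by blast
qed

section \<open>Fubini for dominated integrands\<close>

lemma Fubini_dominated:
  fixes f :: "'a \<Rightarrow> 'b \<Rightarrow> real"
  assumes M: "sigma_finite_measure M1" "sigma_finite_measure M2"
    and f: "(\<lambda>p. f (fst p) (snd p)) \<in> borel_measurable (M1 \<Otimes>\<^sub>M M2)"
    and w: "integrable M1 w" and h: "integrable M2 h"
    and bound: "\<And>x y. x \<in> space M1 \<Longrightarrow> y \<in> space M2 \<Longrightarrow> \<bar>f x y\<bar> \<le> w x * h y"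
  shows "(LINT x|M1. LINT y|M2. f x y) = (LINT y|M2. LINT x|M1. f x y)"
    and "integrable M1 (\<lambda>x. LINT y|M2. f x y)" and "integrable M2 (\<lambda>y. LINT x|M1. f x y)"
proof -
  interpret pair_sigma_finite M1 M2 using M by (simp add: pair_sigma_finite_def)
  have fx: "f x \<in> borel_measurable M2" if "x \<in> space M1" for x
    using measurable_Pair2[OF f that] by simp
  have ix: "integrable M2 (f x)" if "x \<in> space M1" for x
  proof (rule Bochner_Integration.integrable_bound)
    show "integrable M2 (\<lambda>y. w x * h y)" using h by simp
    show "AE y in M2. norm (f x y) \<le> norm (w x * h y)" using bound[OF that] by (intro AE_I2) fastforce
  qed (rule fx[OF that])
  have f': "(\<lambda>p. norm (f (fst p) (snd p))) \<in> borel_measurable (M1 \<Otimes>\<^sub>M M2)" using f by simp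
  have int: "integrable (M1 \<Otimes>\<^sub>M M2) (\<lambda>p. f (fst p) (snd p))"
  proof (rule Fubini_integrable)
    show "integrable M1 (\<lambda>x. LINT y|M2. norm (f (fst (x, y)) (snd (x, y))))"
    proof (rule Bochner_Integration.integrable_bound)
      show "integrable M1 (\<lambda>x. w x * (LINT y|M2. \<bar>h y\<bar>))" using w by simp
      show "(\<lambda>x. LINT y|M2. norm (f (fst (x, y)) (snd (x, y)))) \<in> borel_measurable M1"
        using M2.borel_measurable_lebesgue_integral[of "\<lambda>x y. norm (f x y)" M1] f' by (simp add: split_beta')
      show "AE x in M1. norm (LINT y|M2. norm (f (fst (x, y)) (snd (x, y)))) \<le> norm (w x * (LINT y|M2. \<bar>h y\<bar>))"
      proof (rule AE_I2)
        fix x assume x: "x \<in> space M1"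
        have "(LINT y|M2. \<bar>f x y\<bar>) \<le> (LINT y|M2. \<bar>w x\<bar> * \<bar>h y\<bar>)"
        proof (rule integral_mono)
          fix y assume "y \<in> space M2"
          then show "\<bar>f x y\<bar> \<le> \<bar>w x\<bar> * \<bar>h y\<bar>" using bound[OF x, of y] by (simp flip: abs_mult)
        qed (use ix[OF x] h in auto)
        then show "norm (LINT y|M2. norm (f (fst (x, y)) (snd (x, y)))) \<le> norm (w x * (LINT y|M2. \<bar>h y\<bar>))"
          by (simp add: abs_mult integral_nonneg_AE)
      qed
    qed
    show "AE x in M1. integrable M2 (\<lambda>y. f (fst (x, y)) (snd (x, y)))" using ix by simp
  qed (rule f)
  then have int': "integrable (M1 \<Otimes>\<^sub>M M2) (case_prod f)" by (simp add: split_beta')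
  show "(LINT x|M1. LINT y|M2. f x y) = (LINT y|M2. LINT x|M1. f x y)" using Fubini_integral[OF int'] by simp
  show "integrable M1 (\<lambda>x. LINT y|M2. f x y)" by (rule integrable_fst[OF int'])
  show "integrable M2 (\<lambda>y. LINT x|M1. f x y)" by (rule integrable_snd[OF int'])
qed

lemma measurable_pair_to_borel:
  fixes f :: "'a::euclidean_space \<times> 'b::euclidean_space \<Rightarrow> real"
  assumes f: "f \<in> borel_measurable (borel \<Otimes>\<^sub>M borel)" and M: "sets M = borel_on \<Omega> \<or> sets M = sets borel"
  shows "f \<in> borel_measurable (M \<Otimes>\<^sub>M lborel)"
proof -
  have id: "(\<lambda>x. x) \<in> M \<rightarrow>\<^sub>M borel"
    using M measurable_cong_sets[of M "restrict_space borel \<Omega>" borel borel] measurable_cong_sets[of M borel borel borel]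
      measurable_restrict_space1[of "\<lambda>x. x" borel borel \<Omega>] by auto
  have "(\<lambda>p. (fst p, snd p)) \<in> M \<Otimes>\<^sub>M lborel \<rightarrow>\<^sub>M borel \<Otimes>\<^sub>M borel"
    using measurable_compose[OF measurable_fst id] by (intro measurable_Pair) auto
  from measurable_compose[OF this f] show ?thesis by simp
qed

lemma inner_symmetric_matrix:
  fixes a :: "real^'n^'n"
  assumes "transpose a = a"
  shows "(\<Sum>j\<in>UNIV. \<Sum>i\<in>UNIV. a $ i $ j * c i j) = a \<bullet> (\<chi> i j. (c i j + c j i) / 2)"
proof -
  have sym: "a $ j $ i = a $ i $ j" for i j using assms by (simp add: transpose_def vec_eq_iff)
  have "(\<Sum>i\<in>UNIV. \<Sum>j\<in>UNIV. a $ i $ j * c j i) = (\<Sum>j\<in>UNIV. \<Sum>i\<in>UNIV. a $ i $ j * c j i)"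
    by (rule sum.swap)
  also have "\<dots> = (\<Sum>i\<in>UNIV. \<Sum>j\<in>UNIV. a $ i $ j * c i j)" by (simp only: sym)
  finally have 1: "(\<Sum>i\<in>UNIV. \<Sum>j\<in>UNIV. a $ i $ j * c j i) = (\<Sum>i\<in>UNIV. \<Sum>j\<in>UNIV. a $ i $ j * c i j)" .
  have "a \<bullet> (\<chi> i j. (c i j + c j i) / 2) = (\<Sum>i\<in>UNIV. \<Sum>j\<in>UNIV. a $ i $ j * ((c i j + c j i) / 2))"
    by (simp add: inner_vec_def)
  also have "\<dots> = ((\<Sum>i\<in>UNIV. \<Sum>j\<in>UNIV. a $ i $ j * c i j) + (\<Sum>i\<in>UNIV. \<Sum>j\<in>UNIV. a $ i $ j * c j i)) / 2"
    by (simp add: sum.distrib sum_divide_distrib add_divide_distrib distrib_left)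
  also have "\<dots> = (\<Sum>i\<in>UNIV. \<Sum>j\<in>UNIV. a $ i $ j * c i j)" using 1 by simp
  also have "\<dots> = (\<Sum>j\<in>UNIV. \<Sum>i\<in>UNIV. a $ i $ j * c i j)" by (rule sum.swap)
  finally show ?thesis by simp
qed

text \<open>
  Turns the sums over \<open>Basis\<close> in the definition of \<open>dot_integral\<close> into sums over coordinates.
\<close>

lemma sum_Basis_vec: "(\<Sum>b\<in>(Basis :: (real^'n) set). f b) = (\<Sum>j\<in>UNIV. f (axis j 1))"
proof -
  have B: "(Basis :: (real^'n) set) = range (\<lambda>j. axis j 1)" by (auto simp: Basis_vec_def)
  have "inj (\<lambda>j::'n. axis j (1::real))" by (auto simp: inj_on_def axis_eq_axis)
  then show ?thesis unfolding B by (simp add: sum.reindex)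
qed

section \<open>The setting of the theorem\<close>

text \<open>
  The hypotheses of the theorem together with bounded Borel representatives of \<open>u\<close> and \<open>A\<close>. The representative
  of \<open>A\<close> is symmetric and bounded at every point, not only almost everywhere.
\<close>

locale pairing_setting =
  fixes \<Omega> :: "(real^'n) set" and A :: "real^'n \<Rightarrow> real^'n^'n" and u :: "real^'n \<Rightarrow> real^'n"
    and a :: "real^'n \<Rightarrow> real^'n^'n" and v :: "real^'n \<Rightarrow> real^'n" and L M :: real
  assumes open_\<Omega>: "open \<Omega>" and A_DM: "A \<in> DM_infty \<Omega>" and u_BD: "u \<in> BD \<Omega>" and u_L: "u \<in> L_infty \<Omega>"
    and S_null: "disc_set \<Omega> u - jump_set \<Omega> u \<in> null_sets (total_variation \<Omega> (singular_part \<Omega> (Div_measure \<Omega> A)))"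
    and v: "borel_version \<Omega> u v" and v_le: "\<And>y. norm (v y) \<le> M"
    and a: "borel_version \<Omega> A a" and a_le: "\<And>x. norm (a x) \<le> L" and a_sym: "\<And>x. transpose (a x) = a x"
begin

abbreviation "D \<equiv> Div_measure \<Omega> A"
abbreviation "E \<equiv> E_measure \<Omega> u"
abbreviation "Dj j \<equiv> (\<lambda>B. D B \<bullet> axis j 1)"

text \<open>
  The mollified strain. The integral makes sense at all points, also where the kernel leaves \<open>\<Omega>\<close> and is not a
  test function of \<open>\<Omega>\<close>.
\<close>

definition W :: "real \<Rightarrow> real^'n \<Rightarrow> real^'n^'n" where
  "W r x = (\<chi> i j. (LINT y|lborel. v y $ j * mollifier_grad r x y $ i + v y $ i * mollifier_grad r x y $ j) / 2)"

lemma \<Omega>_borel: "\<Omega> \<in> sets borel" using open_\<Omega> by simp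

lemma u_meas: "u \<in> borel_measurable (lebesgue_on \<Omega>)" and A_meas: "A \<in> borel_measurable (lebesgue_on \<Omega>)"
  using u_L A_DM by (auto simp: L_infty_def DM_infty_def)

lemma v_meas: "v \<in> borel_measurable borel" and a_meas: "a \<in> borel_measurable borel"
  using v a by (auto simp: borel_version_def)

lemma vi_meas: "(\<lambda>y. v y $ i) \<in> borel_measurable borel" and aij_meas: "(\<lambda>y. a y $ i $ j) \<in> borel_measurable borel"
  by (rule measurable_compose[OF v_meas component_measurable(1)], rule measurable_compose[OF a_meas component_measurable(2)])

lemma v_int: "integrable lborel v"
proof -
  have "integrable (lebesgue_on \<Omega>) u" using u_BD by (simp add: BD_def)
  then have u: "integrable lebesgue (\<lambda>y. indicator \<Omega> y *\<^sub>R u y)"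
    by (subst integrable_restrict_space[symmetric]) (use \<Omega>_borel in auto)
  have ae: "AE y in lebesgue. indicator \<Omega> y *\<^sub>R u y = v y"
    unfolding AE_completion_iff using v by (auto simp: borel_version_def indicator_def elim!: eventually_mono)
  have "v \<in> borel_measurable lebesgue" using v_meas by (simp add: measurable_completion)
  then have "integrable lebesgue v"
    using integrable_cong_AE[OF borel_measurable_integrable[OF u] _ ae] u by blast
  then show ?thesis using v_meas by (simp add: integrable_completion)
qed

lemma vi_int: "integrable lborel (\<lambda>y. v y $ i)"
  using integrable_bounded_linear[OF bounded_linear_vec_nth v_int] .

lemma vi_le: "\<bar>v y $ i\<bar> \<le> M" using component_le_norm_cart[of "v y" i] v_le[of y] by linarith

lemma aij_le: "\<bar>a x $ i $ j\<bar> \<le> L"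
  using component_le_norm_cart[of "a x $ i" j] Finite_Cartesian_Product.norm_nth_le[of "a x" i] a_le[of x] by linarith

lemma L_nonneg: "0 \<le> L" and M_nonneg: "0 \<le> M"
  using order_trans[OF norm_ge_zero a_le] order_trans[OF norm_ge_zero v_le] by auto

lemma D_represents: "represents \<Omega> (Div_distr \<Omega> A) D"
  using A_DM by (intro represents_the_measure) (simp add: DM_infty_def)

lemma E_represents: "represents \<Omega> (E_distr \<Omega> u) E"
  using u_BD by (intro represents_the_measure) (simp add: BD_def)

lemma D_Radon: "Radon_measure \<Omega> D" and E_Radon: "Radon_measure \<Omega> E"
  using D_represents E_represents by (auto simp: represents_def)

lemma grad_measurable: "\<phi> \<in> test_functions \<Omega> \<Longrightarrow> (\<lambda>x. grad \<phi> x $ i) \<in> borel_measurable borel"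
  by (intro borel_measurable_continuous_onI test_functionsD(6))

lemma D_integral:
  assumes \<phi>: "\<phi> \<in> test_functions \<Omega>"
  shows "signed_integral \<Omega> (Dj j) \<phi> = - (LINT x|lborel. (\<Sum>i\<in>UNIV. a x $ i $ j * grad \<phi> x $ i))"
proof -
  have "axis j 1 \<in> (Basis :: (real^'n) set)" by (auto simp: Basis_vec_def)
  then have "signed_integral \<Omega> (Dj j) \<phi> = Div_distr \<Omega> A \<phi> \<bullet> axis j 1"
    using D_represents \<phi> unfolding represents_def by simp
  also have "\<dots> = - (LINT x|lebesgue_on \<Omega>. (\<Sum>i\<in>UNIV. A x $ i $ j * grad \<phi> x $ i))"
    by (simp add: inner_axis Div_distr_def)
  also have "(LINT x|lebesgue_on \<Omega>. (\<Sum>i\<in>UNIV. A x $ i $ j * grad \<phi> x $ i))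
      = (LINT x|lborel. indicator \<Omega> x *\<^sub>R (\<Sum>i\<in>UNIV. a x $ i $ j * grad \<phi> x $ i))"
    by (rule borel_version_integral[OF a A_meas \<Omega>_borel order_refl])
      (intro borel_measurable_sum borel_measurable_times measurable_compose[OF measurable_snd component_measurable(2)]
        measurable_compose[OF measurable_fst grad_measurable[OF \<phi>]])
  also have "\<dots> = (LINT x|lborel. (\<Sum>i\<in>UNIV. a x $ i $ j * grad \<phi> x $ i))"
    using a by (intro Bochner_Integration.integral_cong refl) (auto simp: borel_version_def indicator_def)
  finally show ?thesis .
qed

lemma pairing_eq:
  assumes \<phi>: "\<phi> \<in> test_functions \<Omega>"
  shows "pairing \<Omega> A u \<phi> = - (\<Sum>j\<in>UNIV. signed_integral \<Omega> (Dj j) (\<lambda>x. \<phi> x * precise_rep \<Omega> u x $ j))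
     - (LINT x|lborel. a x \<bullet> (v x \<odot> grad \<phi> x))"
proof -
  have dot: "dot_integral \<Omega> D (\<lambda>x. \<phi> x *\<^sub>R precise_rep \<Omega> u x)
      = (\<Sum>j\<in>UNIV. signed_integral \<Omega> (Dj j) (\<lambda>x. \<phi> x * precise_rep \<Omega> u x $ j))"
    by (simp add: dot_integral_def sum_Basis_vec inner_axis)
  have mult: "a x \<bullet> (b \<odot> c) = (\<Sum>i\<in>UNIV. \<Sum>j\<in>UNIV. a x $ i $ j * ((b $ i * c $ j + c $ i * b $ j) / 2))"
    for x and b c :: "real^'n" and a :: "real^'n \<Rightarrow> real^'n^'n"
    by (simp add: inner_vec_def sym_prod_def mult.commute)
  have um: "u \<in> borel_measurable (lebesgue_on \<Omega>)" and Am: "A \<in> borel_measurable (lebesgue_on \<Omega>)"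
    by (rule u_meas, rule A_meas)
  have gm: "(\<lambda>x. grad \<phi> x $ i) \<in> borel_measurable (lebesgue_on \<Omega>)" for i
    using grad_measurable[OF \<phi>] by (intro measurable_restrict_space1 measurable_completion) simp
  have "(LINT x|lebesgue_on \<Omega>. A x \<bullet> (u x \<odot> grad \<phi> x)) = (LINT x|lborel. indicator \<Omega> x *\<^sub>R (a x \<bullet> (v x \<odot> grad \<phi> x)))"
  proof (rule integral_lebesgue_on_eq_lborel[OF \<Omega>_borel])
    show "(\<lambda>x. A x \<bullet> (u x \<odot> grad \<phi> x)) \<in> borel_measurable (lebesgue_on \<Omega>)"
      unfolding mult
      by (intro borel_measurable_sum borel_measurable_times borel_measurable_divide borel_measurable_add borel_measurable_const gm
          measurable_compose[OF um component_measurable(1)] measurable_compose[OF Am component_measurable(2)])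
    show "(\<lambda>x. a x \<bullet> (v x \<odot> grad \<phi> x)) \<in> borel_measurable borel"
      unfolding mult
      by (intro borel_measurable_sum borel_measurable_times borel_measurable_divide borel_measurable_add borel_measurable_const
          grad_measurable[OF \<phi>] vi_meas aij_meas)
    have "AE y in lborel. y \<in> \<Omega> \<longrightarrow> A y = a y" "AE y in lborel. y \<in> \<Omega> \<longrightarrow> u y = v y"
      using a v by (auto simp: borel_version_def)
    then show "AE x in lborel. x \<in> \<Omega> \<longrightarrow> A x \<bullet> (u x \<odot> grad \<phi> x) = a x \<bullet> (v x \<odot> grad \<phi> x)"
      by eventually_elim simp
  qed
  also have "\<dots> = (LINT x|lborel. a x \<bullet> (v x \<odot> grad \<phi> x))"
    using a by (intro Bochner_Integration.integral_cong refl) (auto simp: borel_version_def indicator_def)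
  finally show ?thesis unfolding pairing_def dot by simp
qed

lemma E_component:
  assumes \<phi>: "\<phi> \<in> test_functions \<Omega>"
  shows "E_distr \<Omega> u \<phi> $ i $ j = - (LINT y|lborel. v y $ i * grad \<phi> y $ j + v y $ j * grad \<phi> y $ i) / 2"
proof -
  obtain K where K: "\<And>x i. \<bar>grad \<phi> x $ i\<bar> \<le> K" using test_function_bounded[OF \<phi>] by metis
  have int: "integrable lborel (\<lambda>y. v y $ i * grad \<phi> y $ j)" for i j
  proof (rule Bochner_Integration.integrable_bound)
    show "integrable lborel (\<lambda>y. K * v y $ i)" using vi_int by simp
    show "(\<lambda>y. v y $ i * grad \<phi> y $ j) \<in> borel_measurable lborel"
      using vi_meas[of i] grad_measurable[OF \<phi>, of j] by simp
    show "AE y in lborel. norm (v y $ i * grad \<phi> y $ j) \<le> norm (K * v y $ i)"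
    proof (rule AE_I2)
      fix y have "\<bar>grad \<phi> y $ j\<bar> \<le> \<bar>K\<bar>" using K[of y j] by linarith
      then show "norm (v y $ i * grad \<phi> y $ j) \<le> norm (K * v y $ i)"
        by (simp add: abs_mult mult.commute[of _ "\<bar>v y $ i\<bar>"] mult_left_mono)
    qed
  qed
  have "D_distr \<Omega> u \<phi> $ i $ j = - (LINT y|lborel. v y $ i * grad \<phi> y $ j)" for i j
  proof -
    have "(LINT x|lebesgue_on \<Omega>. u x $ i * grad \<phi> x $ j) = (LINT x|lborel. indicator \<Omega> x *\<^sub>R (v x $ i * grad \<phi> x $ j))"
      by (rule borel_version_integral[OF v u_meas \<Omega>_borel order_refl])
        (intro borel_measurable_times measurable_compose[OF measurable_snd component_measurable(1)]
          measurable_compose[OF measurable_fst grad_measurable[OF \<phi>]])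
    also have "\<dots> = (LINT x|lborel. v x $ i * grad \<phi> x $ j)"
      using v by (intro Bochner_Integration.integral_cong refl) (auto simp: borel_version_def indicator_def)
    finally show ?thesis by (simp add: D_distr_def)
  qed
  then show ?thesis using int by (simp add: E_distr_def transpose_def)
qed

lemma E_norm_le:
  assumes \<phi>: "\<phi> \<in> test_functions \<Omega>"
  shows "norm (E_distr \<Omega> u \<phi>) \<le> (LINT x|total_variation \<Omega> E. \<bar>\<phi> x\<bar>)"
proof -
  obtain K where K: "\<And>x. \<bar>\<phi> x\<bar> \<le> K" using test_function_bounded[OF \<phi>] by metis
  show ?thesis
    by (rule norm_vector_integral_le[OF E_Radon test_function_measurable(1)[OF \<phi>] K])
      (use E_represents \<phi> in \<open>auto simp: represents_def\<close>)
qed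

lemma W_eq_E_distr:
  assumes "0 < r" "cball x r \<subseteq> \<Omega>"
  shows "E_distr \<Omega> u (mollifier r x) = W r x"
proof -
  have "(LINT y|lborel. v y $ i * grad (mollifier r x) y $ j + v y $ j * grad (mollifier r x) y $ i)
      = - (LINT y|lborel. v y $ j * mollifier_grad r x y $ i + v y $ i * mollifier_grad r x y $ j)" for i j
    unfolding integral_minus[symmetric] grad_mollifier(1)
    by (intro Bochner_Integration.integral_cong refl) simp
  then show ?thesis
    by (simp add: vec_eq_iff E_component[OF mollifier_test_function[OF assms]] W_def)
qed

end

section \<open>The mollified pairing\<close>

context pairing_setting
begin

lemma mollify_component:
  assumes "0 < r"
  shows "mollify r v x $ j = (LINT y|lborel. mollifier r x y * v y $ j)"
  unfolding mollify_def
  using integral_bounded_linear[OF bounded_linear_vec_nth mollifier_integrable_scaleR[OF assms v_int]] by simp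

lemma mollify_component_measurable:
  assumes "0 < r"
  shows "(\<lambda>x. mollify r v x $ j) \<in> borel_measurable borel"
proof -
  have "(\<lambda>p. mollifier r (fst p) (snd p) * v (snd p) $ j) \<in> borel_measurable (borel \<Otimes>\<^sub>M lborel)"
    by (rule measurable_pair_to_borel[where \<Omega>=UNIV])
      (intro borel_measurable_times mollifier_measurable measurable_compose[OF measurable_snd vi_meas], simp)
  then show ?thesis
    unfolding mollify_component[OF assms]
    using lborel.borel_measurable_lebesgue_integral[of "\<lambda>x y. mollifier r x y * v y $ j" borel] by (simp add: split_beta')
qed

lemma mollify_component_le:
  assumes "0 < r"
  shows "\<bar>mollify r v x $ j\<bar> \<le> M"
proof -
  have i: "integrable lborel (\<lambda>y. mollifier r x y * v y $ j)"
    using integrable_bounded_linear[OF bounded_linear_vec_nth mollifier_integrable_scaleR[OF assms v_int]] by simp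
  have "\<bar>mollify r v x $ j\<bar> \<le> (LINT y|lborel. \<bar>mollifier r x y * v y $ j\<bar>)"
    unfolding mollify_component[OF assms] by (rule integral_abs_bound)
  also have "\<dots> \<le> (LINT y|lborel. mollifier r x y * M)"
  proof (rule integral_mono)
    show "integrable lborel (\<lambda>y. \<bar>mollifier r x y * v y $ j\<bar>)" using i by simp
    show "integrable lborel (\<lambda>y. mollifier r x y * M)" using mollifier_integrable[OF assms, of x] by simp
    show "\<bar>mollifier r x y * v y $ j\<bar> \<le> mollifier r x y * M" for y
      using mollifier_nonneg[OF assms, of x y] vi_le[of y j] by (simp add: abs_mult mult_left_mono)
  qed
  also have "\<dots> = M" using mollifier_integral[OF assms, of x] by simp
  finally show ?thesis .
qed

lemma Fubini_test_mollifier: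
  assumes \<phi>: "\<phi> \<in> test_functions \<Omega>" and r: "0 < r" and N: "finite_measure N" "sets N = borel_on \<Omega>"
  shows "(LINT x|N. \<phi> x * mollify r v x $ j) = (LINT y|lborel. v y $ j * (LINT x|N. \<phi> x * mollifier r x y))"
    and "integrable lborel (\<lambda>y. v y $ j * (LINT x|N. \<phi> x * mollifier r x y))"
proof -
  interpret finite_measure N by fact
  obtain K where K: "\<And>x. \<bar>\<phi> x\<bar> \<le> K" "0 \<le> K" using test_function_bounded[OF \<phi>] by metis
  obtain B where B: "0 \<le> B" "\<And>x y. mollifier r (x::real^'n) y \<le> B" using mollifier_bounded[OF r] by blast
  let ?f = "\<lambda>x y. \<phi> x * (mollifier r x y * v y $ j)"
  have f: "(\<lambda>p. ?f (fst p) (snd p)) \<in> borel_measurable (N \<Otimes>\<^sub>M lborel)"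
    by (rule measurable_pair_to_borel[where \<Omega>=\<Omega>])
      (intro borel_measurable_times mollifier_measurable measurable_compose[OF measurable_snd vi_meas]
        measurable_compose[OF measurable_fst test_function_measurable(2)[OF \<phi>]], use N in simp)
  have sf: "sigma_finite_measure N" "sigma_finite_measure lborel" by unfold_locales
  have w: "integrable N (\<lambda>x. K * B)" by simp
  have h: "integrable lborel (\<lambda>y. \<bar>v y $ j\<bar>)" using vi_int[of j] by simp
  have bound: "\<bar>?f x y\<bar> \<le> (K * B) * \<bar>v y $ j\<bar>" for x y
  proof -
    have "\<bar>\<phi> x\<bar> * \<bar>mollifier r x y\<bar> \<le> K * B"
      using K B mollifier_nonneg[OF r, of x y] by (intro mult_mono) auto
    then have "\<bar>\<phi> x\<bar> * \<bar>mollifier r x y\<bar> * \<bar>v y $ j\<bar> \<le> K * B * \<bar>v y $ j\<bar>" by (rule mult_right_mono) simp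
    then show ?thesis by (simp add: abs_mult mult_ac)
  qed
  note F = Fubini_dominated[OF sf f w h bound]
  have 1: "(LINT y|lborel. ?f x y) = \<phi> x * mollify r v x $ j" for x
    unfolding mollify_component[OF r] by simp
  have 2: "(LINT x|N. ?f x y) = v y $ j * (LINT x|N. \<phi> x * mollifier r x y)" for y
    by (subst integral_mult_right_zero[symmetric]) (simp add: mult_ac)
  show "(LINT x|N. \<phi> x * mollify r v x $ j) = (LINT y|lborel. v y $ j * (LINT x|N. \<phi> x * mollifier r x y))"
    using F(1) unfolding 1 2 .
  show "integrable lborel (\<lambda>y. v y $ j * (LINT x|N. \<phi> x * mollifier r x y))"
    using F(3) unfolding 2 .
qed

text \<open>
  Fubini for the two parts of the Jordan decomposition of a row of \<open>Div A\<close>.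
\<close>

lemma signed_integral_mollified:
  assumes \<phi>: "\<phi> \<in> test_functions \<Omega>" and r: "0 < r"
  shows "signed_integral \<Omega> (Dj j) (\<lambda>x. \<phi> x * mollify r v x $ j)
    = (LINT y|lborel. v y $ j * signed_integral \<Omega> (Dj j) (\<lambda>x. \<phi> x * mollifier r x y))"
proof -
  have R: "Radon_measure \<Omega> (Dj j)" by (rule Radon_measure_inner[OF D_Radon])
  note p = Fubini_test_mollifier[OF \<phi> r finite_measure_positive_part[OF R] sets_positive_part, of j]
  note q = Fubini_test_mollifier[OF \<phi> r finite_measure_positive_part[OF Radon_measure_uminus[OF R]] sets_positive_part, of j]
  show ?thesis
    unfolding signed_integral_def p(1) q(1) right_diff_distrib
    by (rule Bochner_Integration.integral_diff[OF p(2) q(2), symmetric])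
qed

lemma v_mollifier_grad_integrable:
  assumes r: "0 < r"
  shows "integrable lborel (\<lambda>y. v y $ j * mollifier_grad r x y $ i)"
proof -
  obtain B where B: "0 \<le> B" "\<And>x (y::real^'n) i. \<bar>mollifier_grad r x y $ i\<bar> \<le> B"
    using mollifier_grad_bounded[OF r] by metis
  show ?thesis
  proof (rule Bochner_Integration.integrable_bound)
    show "integrable lborel (\<lambda>y. v y $ j * B)" using vi_int by simp
    have "(\<lambda>y. mollifier_grad r x y $ i) \<in> borel_measurable borel"
      using measurable_Pair2[OF mollifier_grad_measurable, of x] by simp
    then show "(\<lambda>y. v y $ j * mollifier_grad r x y $ i) \<in> borel_measurable lborel" using vi_meas[of j] by simp
    show "AE y in lborel. norm (v y $ j * mollifier_grad r x y $ i) \<le> norm (v y $ j * B)"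
      using B by (intro AE_I2) (simp add: abs_mult mult_left_mono)
  qed
qed

text \<open>
  The entries of the mollified gradient before symmetrisation; \<open>W\<close> is their symmetric part.
\<close>

definition V :: "real \<Rightarrow> 'n \<Rightarrow> 'n \<Rightarrow> real^'n \<Rightarrow> real" where
  "V r i j x = (LINT y|lborel. v y $ j * mollifier_grad r x y $ i)"

lemma V_measurable: "V r i j \<in> borel_measurable borel"
proof -
  have "(\<lambda>p. v (snd p) $ j * mollifier_grad r (fst p) (snd p) $ i) \<in> borel_measurable (borel \<Otimes>\<^sub>M lborel)"
    by (rule measurable_pair_to_borel[where \<Omega>=UNIV])
      (intro borel_measurable_times mollifier_grad_measurable measurable_compose[OF measurable_snd vi_meas], simp)
  then show ?thesis
    unfolding V_def
    using lborel.borel_measurable_lebesgue_integral[of "\<lambda>x y. v y $ j * mollifier_grad r x y $ i" borel] by (simp add: split_beta')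
qed

lemma V_bounded:
  assumes r: "0 < r"
  obtains B where "0 \<le> B" "\<And>i j x. \<bar>V r i j x\<bar> \<le> B"
proof -
  obtain B where B: "0 \<le> B" "\<And>x (y::real^'n) i. \<bar>mollifier_grad r x y $ i\<bar> \<le> B"
    using mollifier_grad_bounded[OF r] by metis
  have "\<bar>V r i j x\<bar> \<le> B * (\<Sum>j\<in>UNIV. LINT y|lborel. \<bar>v y $ j\<bar>)" for i j x
  proof -
    have "\<bar>V r i j x\<bar> \<le> (LINT y|lborel. \<bar>v y $ j * mollifier_grad r x y $ i\<bar>)"
      unfolding V_def by (rule integral_abs_bound)
    also have "\<dots> \<le> (LINT y|lborel. B * \<bar>v y $ j\<bar>)"
    proof (rule integral_mono)
      show "\<bar>v y $ j * mollifier_grad r x y $ i\<bar> \<le> B * \<bar>v y $ j\<bar>" for y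
        using B(2)[of x y i] by (simp add: abs_mult mult.commute[of B] mult_left_mono)
    qed (use v_mollifier_grad_integrable[OF r, of j x i] vi_int[of j] in auto)
    also have "\<dots> = B * (LINT y|lborel. \<bar>v y $ j\<bar>)" by simp
    also have "\<dots> \<le> B * (\<Sum>j\<in>UNIV. LINT y|lborel. \<bar>v y $ j\<bar>)"
      using B(1) by (intro mult_left_mono member_le_sum integral_nonneg_AE) auto
    finally show ?thesis .
  qed
  moreover have "0 \<le> B * (\<Sum>j\<in>UNIV. LINT y|lborel. \<bar>v y $ j\<bar>)"
    using B(1) by (intro mult_nonneg_nonneg sum_nonneg integral_nonneg_AE) auto
  ultimately show ?thesis using that by blast
qed

lemma integrable_support_bounded:
  assumes \<phi>: "\<phi> \<in> test_functions \<Omega>" and f: "f \<in> borel_measurable borel"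
    and bound: "\<And>x. \<bar>f x\<bar> \<le> C" and zero: "\<And>x. x \<notin> closure {x. \<phi> x \<noteq> 0} \<Longrightarrow> f x = (0::real)"
  shows "integrable lborel f"
proof (rule Bochner_Integration.integrable_bound)
  let ?S = "closure {x. \<phi> x \<noteq> 0}"
  have "emeasure lborel ?S < \<infinity>"
    using test_functionsD(2)[OF \<phi>] by (intro emeasure_bounded_finite compact_imp_bounded)
  then show "integrable lborel (\<lambda>x. C * indicator ?S x)"
    by (intro integrable_mult_right integrable_real_indicator) auto
  show "AE x in lborel. norm (f x) \<le> norm (C * indicator ?S x)"
    using bound zero by (intro AE_I2) (auto simp: indicator_def intro: order_trans[OF _ abs_ge_self])
qed (use f in simp)

lemma a_sum_le:
  assumes "\<And>i. \<bar>c i\<bar> \<le> C"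
  shows "\<bar>\<Sum>i\<in>UNIV. a x $ i $ j * c i\<bar> \<le> real CARD('n) * (L * C)"
proof -
  have "\<bar>\<Sum>i\<in>UNIV. a x $ i $ j * c i\<bar> \<le> (\<Sum>i\<in>(UNIV::'n set). L * C)"
    using assms aij_le L_nonneg by (intro order_trans[OF sum_abs] sum_mono) (auto simp: abs_mult intro!: mult_mono)
  then show ?thesis by simp
qed

text \<open>
  For fixed \<open>y\<close> the function \<open>x \<mapsto> \<phi> x * K\<^sub>r x y\<close> is a test function, so its integral against a row of
  \<open>Div A\<close> is an integral of \<open>A\<close> against its gradient. The product rule for this gradient gives the two terms on the
  right after the integrations in \<open>x\<close> and \<open>y\<close> have been exchanged twice.
\<close>

lemma mollified_component_identity:
  assumes \<phi>: "\<phi> \<in> test_functions \<Omega>" and r: "0 < r"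
  shows "signed_integral \<Omega> (Dj j) (\<lambda>x. \<phi> x * mollify r v x $ j)
    = - (LINT x|lborel. (\<Sum>i\<in>UNIV. a x $ i $ j * (grad \<phi> x $ i * mollify r v x $ j)))
      - (LINT x|lborel. \<phi> x * (\<Sum>i\<in>UNIV. a x $ i $ j * V r i j x))" (is "_ = - ?I1 - ?I2")
    and "integrable lborel (\<lambda>x. \<Sum>i\<in>UNIV. a x $ i $ j * (grad \<phi> x $ i * mollify r v x $ j))"
    and "integrable lborel (\<lambda>x. \<phi> x * (\<Sum>i\<in>UNIV. a x $ i $ j * V r i j x))"
proof -
  obtain K where K: "\<And>x. \<bar>\<phi> x\<bar> \<le> K" "\<And>x i. \<bar>grad \<phi> x $ i\<bar> \<le> K" "0 \<le> K" using test_function_bounded[OF \<phi>] by metis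
  obtain B where B: "0 \<le> B" "\<And>x y. mollifier r (x::real^'n) y \<le> B" using mollifier_bounded[OF r] by blast
  obtain G where G: "0 \<le> G" "\<And>x (y::real^'n) i. \<bar>mollifier_grad r x y $ i\<bar> \<le> G"
    using mollifier_grad_bounded[OF r] by metis
  obtain C where C: "0 \<le> C" "\<And>i j x. \<bar>V r i j x\<bar> \<le> C" using V_bounded[OF r] by metis
  let ?S = "closure {x. \<phi> x \<noteq> 0}"
  have S: "compact ?S" by (rule test_functionsD(2)[OF \<phi>])
  have zero: "\<phi> x = 0" "grad \<phi> x $ i = 0" if "x \<notin> ?S" for x i
    using that in_closure_support[of \<phi> x] grad_test_function_outside[OF \<phi> that] by auto
  show i1: "integrable lborel (\<lambda>x. \<Sum>i\<in>UNIV. a x $ i $ j * (grad \<phi> x $ i * mollify r v x $ j))"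
  proof (rule integrable_support_bounded[OF \<phi>])
    show "(\<lambda>x. \<Sum>i\<in>UNIV. a x $ i $ j * (grad \<phi> x $ i * mollify r v x $ j)) \<in> borel_measurable borel"
      by (intro borel_measurable_sum borel_measurable_times aij_meas grad_measurable[OF \<phi>] mollify_component_measurable[OF r])
    have "\<bar>grad \<phi> x $ i * mollify r v x $ j\<bar> \<le> K * M" for x i
      using K mollify_component_le[OF r, of x j] by (auto simp: abs_mult intro!: mult_mono)
    then show "\<bar>\<Sum>i\<in>UNIV. a x $ i $ j * (grad \<phi> x $ i * mollify r v x $ j)\<bar> \<le> real CARD('n) * (L * (K * M))" for x
      by (rule a_sum_le)
    show "(\<Sum>i\<in>UNIV. a x $ i $ j * (grad \<phi> x $ i * mollify r v x $ j)) = 0" if "x \<notin> ?S" for x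
      by (simp only: zero(2)[OF that] mult_zero_left mult_zero_right sum.neutral_const)
  qed
  show i2: "integrable lborel (\<lambda>x. \<phi> x * (\<Sum>i\<in>UNIV. a x $ i $ j * V r i j x))"
  proof (rule integrable_support_bounded[OF \<phi>])
    show "(\<lambda>x. \<phi> x * (\<Sum>i\<in>UNIV. a x $ i $ j * V r i j x)) \<in> borel_measurable borel"
      by (intro borel_measurable_sum borel_measurable_times aij_meas test_function_measurable(2)[OF \<phi>] V_measurable)
    show "\<bar>\<phi> x * (\<Sum>i\<in>UNIV. a x $ i $ j * V r i j x)\<bar> \<le> K * (real CARD('n) * (L * C))" for x
      unfolding abs_mult using K a_sum_le[of "\<lambda>i. V r i j x" C x j] C by (intro mult_mono) auto
    show "\<phi> x * (\<Sum>i\<in>UNIV. a x $ i $ j * V r i j x) = 0" if "x \<notin> ?S" for x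
      by (simp only: zero(1)[OF that] mult_zero_left)
  qed
  let ?g = "\<lambda>x y i. \<phi> x * mollifier_grad r x y $ i + mollifier r x y * grad \<phi> x $ i"
  let ?f = "\<lambda>x y. v y $ j * (\<Sum>i\<in>UNIV. a x $ i $ j * ?g x y i)"
  have step: "signed_integral \<Omega> (Dj j) (\<lambda>x. \<phi> x * mollifier r x y) = - (LINT x|lborel. (\<Sum>i\<in>UNIV. a x $ i $ j * ?g x y i))" for y
  proof -
    have T: "(\<lambda>x. \<phi> x * mollifier r x y) \<in> test_functions \<Omega>"
      by (rule test_functions_mult[OF \<phi> Ck_mollifier(2)])
    have "(\<lambda>x. mollifier r x y) differentiable (at x)" for x
      using Ck_mollifier(2)[of "Suc 0" r y] by simp
    then have "grad (\<lambda>x. \<phi> x * mollifier r x y) x $ i = ?g x y i" for x i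
      using test_functionsD(4)[OF \<phi>] by (simp add: grad_mult grad_mollifier(2))
    then show ?thesis unfolding D_integral[OF T] by simp
  qed
  have f: "(\<lambda>p. ?f (fst p) (snd p)) \<in> borel_measurable (lborel \<Otimes>\<^sub>M lborel)"
    by (rule measurable_pair_to_borel[where \<Omega>=UNIV])
      (intro borel_measurable_times borel_measurable_sum borel_measurable_add mollifier_measurable mollifier_grad_measurable
        measurable_compose[OF measurable_snd vi_meas] measurable_compose[OF measurable_fst aij_meas]
        measurable_compose[OF measurable_fst test_function_measurable(2)[OF \<phi>]]
        measurable_compose[OF measurable_fst grad_measurable[OF \<phi>]], simp)
  have sf: "sigma_finite_measure (lborel :: (real^'n) measure)" by unfold_locales
  let ?c = "real CARD('n) * (L * (K * G + B * K))"
  have c0: "0 \<le> ?c" using L_nonneg K(3) G(1) B(1) by simp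
  have w: "integrable lborel (\<lambda>x. ?c * indicator ?S x)"
    using S by (intro integrable_mult_right integrable_real_indicator emeasure_bounded_finite compact_imp_bounded) auto
  have h: "integrable lborel (\<lambda>y. \<bar>v y $ j\<bar>)" using vi_int[of j] by simp
  have bound: "\<bar>?f x y\<bar> \<le> (?c * indicator ?S x) * \<bar>v y $ j\<bar>" for x y
  proof (cases "x \<in> ?S")
    case True
    have "\<bar>?g x y i\<bar> \<le> K * G + B * K" for i
    proof -
      have "\<bar>\<phi> x * mollifier_grad r x y $ i\<bar> \<le> K * G"
        using K(1)[of x] K(3) G(2)[of x y i] unfolding abs_mult by (intro mult_mono) auto
      moreover have "\<bar>mollifier r x y * grad \<phi> x $ i\<bar> \<le> B * K"
        using K(2)[of x i] B(1) B(2)[of x y] mollifier_nonneg[OF r, of x y] unfolding abs_mult by (intro mult_mono) auto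
      ultimately show ?thesis by linarith
    qed
    then have "\<bar>\<Sum>i\<in>UNIV. a x $ i $ j * ?g x y i\<bar> \<le> ?c" by (rule a_sum_le)
    then have "\<bar>v y $ j\<bar> * \<bar>\<Sum>i\<in>UNIV. a x $ i $ j * ?g x y i\<bar> \<le> \<bar>v y $ j\<bar> * ?c" by (rule mult_left_mono) simp
    then show ?thesis using True by (simp add: abs_mult mult.commute)
  next
    case False
    have "?f x y = 0"
      by (simp only: zero(1)[OF False] zero(2)[OF False] mult_zero_left mult_zero_right add_0_left sum.neutral_const)
    moreover have "0 \<le> (?c * indicator ?S x) * \<bar>v y $ j\<bar>"
      by (rule mult_nonneg_nonneg[OF mult_nonneg_nonneg[OF c0 indicator_pos_le] abs_ge_zero])
    ultimately show ?thesis by (simp only: abs_zero)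
  qed
  have inner: "(LINT y|lborel. ?f x y) = (\<Sum>i\<in>UNIV. a x $ i $ j * (grad \<phi> x $ i * mollify r v x $ j))
      + \<phi> x * (\<Sum>i\<in>UNIV. a x $ i $ j * V r i j x)" for x
  proof -
    have iK: "integrable lborel (\<lambda>y. mollifier r x y * v y $ j)"
      using integrable_bounded_linear[OF bounded_linear_vec_nth mollifier_integrable_scaleR[OF r v_int]] by simp
    note iG = v_mollifier_grad_integrable[OF r, of j x]
    have "(LINT y|lborel. ?f x y) = (LINT y|lborel. (\<Sum>i\<in>UNIV. a x $ i $ j * (\<phi> x * (v y $ j * mollifier_grad r x y $ i)
        + grad \<phi> x $ i * (mollifier r x y * v y $ j))))"
      by (intro Bochner_Integration.integral_cong refl) (simp add: sum_distrib_left algebra_simps)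
    also have "\<dots> = (\<Sum>i\<in>UNIV. a x $ i $ j * (\<phi> x * V r i j x + grad \<phi> x $ i * mollify r v x $ j))"
      unfolding V_def mollify_component[OF r] using iK iG by simp
    also have "\<dots> = (\<Sum>i\<in>UNIV. a x $ i $ j * (grad \<phi> x $ i * mollify r v x $ j)) + \<phi> x * (\<Sum>i\<in>UNIV. a x $ i $ j * V r i j x)"
      by (simp add: sum_distrib_left sum.distrib[symmetric] algebra_simps)
    finally show ?thesis .
  qed
  have "signed_integral \<Omega> (Dj j) (\<lambda>x. \<phi> x * mollify r v x $ j) = - (LINT y|lborel. LINT x|lborel. ?f x y)"
    unfolding signed_integral_mollified[OF \<phi> r] step by simp
  also have "(LINT y|lborel. LINT x|lborel. ?f x y) = (LINT x|lborel. LINT y|lborel. ?f x y)"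
    by (rule Fubini_dominated(1)[OF sf sf f w h bound, symmetric])
  also have "\<dots> = ?I1 + ?I2"
    unfolding inner by (rule Bochner_Integration.integral_add[OF i1 i2])
  finally show "signed_integral \<Omega> (Dj j) (\<lambda>x. \<phi> x * mollify r v x $ j) = - ?I1 - ?I2" by simp
qed

lemma W_eq_V: assumes "0 < r" shows "W r x = (\<chi> i j. (V r i j x + V r j i x) / 2)"
  using v_mollifier_grad_integrable[OF assms] by (simp add: W_def V_def vec_eq_iff)

lemma mollified_identity:
  assumes \<phi>: "\<phi> \<in> test_functions \<Omega>" and r: "0 < r"
  shows "(\<Sum>j\<in>UNIV. signed_integral \<Omega> (Dj j) (\<lambda>x. \<phi> x * mollify r v x $ j))
    = - (LINT x|lborel. a x \<bullet> (mollify r v x \<odot> grad \<phi> x)) - (LINT x|lborel. \<phi> x * (a x \<bullet> W r x))"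
    and "integrable lborel (\<lambda>x. \<phi> x * (a x \<bullet> W r x))"
proof -
  note I = mollified_component_identity[OF \<phi> r]
  have 1: "(\<Sum>j\<in>UNIV. \<Sum>i\<in>UNIV. a x $ i $ j * (grad \<phi> x $ i * mollify r v x $ j)) = a x \<bullet> (mollify r v x \<odot> grad \<phi> x)" for x
    unfolding inner_symmetric_matrix[OF a_sym]
    by (rule arg_cong[where f="\<lambda>z. a x \<bullet> z"]) (simp add: sym_prod_def vec_eq_iff algebra_simps)
  have 2: "(\<Sum>j\<in>UNIV. \<phi> x * (\<Sum>i\<in>UNIV. a x $ i $ j * V r i j x)) = \<phi> x * (a x \<bullet> W r x)" for x
    unfolding sum_distrib_left[symmetric] inner_symmetric_matrix[OF a_sym] W_eq_V[OF r] ..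
  have "(\<Sum>j\<in>UNIV. signed_integral \<Omega> (Dj j) (\<lambda>x. \<phi> x * mollify r v x $ j))
    = - (\<Sum>j\<in>UNIV. LINT x|lborel. (\<Sum>i\<in>UNIV. a x $ i $ j * (grad \<phi> x $ i * mollify r v x $ j)))
      - (\<Sum>j\<in>UNIV. LINT x|lborel. \<phi> x * (\<Sum>i\<in>UNIV. a x $ i $ j * V r i j x))"
    unfolding I(1) by (simp add: sum_subtractf sum_negf)
  also have "(\<Sum>j\<in>UNIV. LINT x|lborel. (\<Sum>i\<in>UNIV. a x $ i $ j * (grad \<phi> x $ i * mollify r v x $ j)))
      = (LINT x|lborel. (\<Sum>j\<in>UNIV. \<Sum>i\<in>UNIV. a x $ i $ j * (grad \<phi> x $ i * mollify r v x $ j)))"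
    by (rule Bochner_Integration.integral_sum[OF I(2), symmetric])
  also have "(\<Sum>j\<in>UNIV. LINT x|lborel. \<phi> x * (\<Sum>i\<in>UNIV. a x $ i $ j * V r i j x))
      = (LINT x|lborel. (\<Sum>j\<in>UNIV. \<phi> x * (\<Sum>i\<in>UNIV. a x $ i $ j * V r i j x)))"
    by (rule Bochner_Integration.integral_sum[OF I(3), symmetric])
  finally show "(\<Sum>j\<in>UNIV. signed_integral \<Omega> (Dj j) (\<lambda>x. \<phi> x * mollify r v x $ j))
    = - (LINT x|lborel. a x \<bullet> (mollify r v x \<odot> grad \<phi> x)) - (LINT x|lborel. \<phi> x * (a x \<bullet> W r x))"
    unfolding 1 2 .
  have "integrable lborel (\<lambda>x. \<Sum>j\<in>UNIV. \<phi> x * (\<Sum>i\<in>UNIV. a x $ i $ j * V r i j x))"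
    by (intro Bochner_Integration.integrable_sum I(3))
  then show "integrable lborel (\<lambda>x. \<phi> x * (a x \<bullet> W r x))" unfolding 2 .
qed

end

section \<open>The limit of the mollified pairings\<close>

lemma mollify_tendsto_continuity_point:
  fixes w :: "real^'n \<Rightarrow> real"
  assumes w: "integrable lborel w" and cont: "isCont w x"
  shows "((\<lambda>r. mollify r w x) \<longlongrightarrow> w x) (at_right 0)"
proof (rule mollify_tendsto_Lebesgue_point[OF w], rule tendstoI)
  fix e :: real assume e: "0 < e"
  then obtain d where d: "0 < d" "\<And>y. dist y x < d \<Longrightarrow> dist (w y) (w x) < e / 2"
    using cont[unfolded continuous_at_eps_delta] by (meson half_gt_zero)
  have "dist (ball_integral x r (\<lambda>y. norm (w y - w x)) / measure lborel (ball x r)) 0 < e" if r: "0 < r" "r < d" for r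
  proof -
    have m: "0 < measure lborel (ball x r)" by (rule content_ball_pos_lborel[OF r(1)])
    have "ball_integral x r (\<lambda>y. norm (w y - w x)) \<le> (LINT y|lborel. indicator (ball x r) y * (e / 2))"
    proof (rule integral_mono_AE')
      show "integrable lborel (\<lambda>y. indicator (ball x r) y * (e / 2))" using integrable_indicator_ball[of x r] by simp
      show "AE y in lborel. indicator (ball x r) y * norm (w y - w x) \<le> indicator (ball x r) y * (e / 2)"
      proof (rule AE_I2)
        fix y show "indicator (ball x r) y * norm (w y - w x) \<le> indicator (ball x r) y * (e / 2)"
        proof (cases "y \<in> ball x r")
          case True
          then have "dist y x < d" using r by (simp add: dist_commute)
          from d(2)[OF this] True show ?thesis by (simp add: dist_norm)
        qed simp
      qed
      show "AE y in lborel. 0 \<le> indicator (ball x r) y * (e / 2)" using e by simp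
    qed
    also have "\<dots> = measure lborel (ball x r) * (e / 2)" by simp
    finally have "ball_integral x r (\<lambda>y. norm (w y - w x)) / measure lborel (ball x r) \<le> e / 2"
      using m by (simp add: divide_le_eq mult.commute)
    moreover have "0 \<le> ball_integral x r (\<lambda>y. norm (w y - w x)) / measure lborel (ball x r)"
      by (intro divide_nonneg_nonneg integral_nonneg_AE) auto
    ultimately show ?thesis
      unfolding dist_real_def diff_0_right using e by linarith
  qed
  then show "\<forall>\<^sub>F r in at_right 0. dist (ball_integral x r (\<lambda>y. norm (w y - w x)) / measure lborel (ball x r)) 0 < e"
    unfolding eventually_at_right_field using d(1) by blast
qed

lemma abs_mollify_le:
  fixes w :: "real^'n \<Rightarrow> real"
  assumes r: "0 < r" and w: "integrable lborel w" and K: "\<And>y. \<bar>w y\<bar> \<le> K"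
  shows "\<bar>mollify r w x\<bar> \<le> K"
proof -
  have "\<bar>mollify r w x\<bar> \<le> (LINT y|lborel. \<bar>mollifier r x y *\<^sub>R w y\<bar>)"
    unfolding mollify_def by (rule integral_abs_bound)
  also have "\<dots> \<le> (LINT y|lborel. mollifier r x y * K)"
  proof (rule integral_mono)
    show "integrable lborel (\<lambda>y. \<bar>mollifier r x y *\<^sub>R w y\<bar>)"
      by (rule integrable_abs[OF mollifier_integrable_scaleR[OF r w]])
    show "integrable lborel (\<lambda>y. mollifier r x y * K)" using mollifier_integrable[OF r, of x] by simp
    show "\<bar>mollifier r x y *\<^sub>R w y\<bar> \<le> mollifier r x y * K" for y
      using mollifier_nonneg[OF r, of x y] K[of y] by (simp add: abs_mult mult_left_mono)
  qed
  also have "\<dots> = K" using mollifier_integral[OF r, of x] by simp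
  finally show ?thesis .
qed

definition radius :: "nat \<Rightarrow> real" where "radius n = inverse (real (Suc n))"

lemma radius_pos: "0 < radius n" by (simp add: radius_def)

lemma radius_tendsto: "filterlim radius (at_right 0) sequentially"
  unfolding radius_def[abs_def]
  by (rule tendsto_imp_filterlim_at_right[OF LIMSEQ_inverse_real_of_nat]) simp

context pairing_setting
begin

abbreviation "S \<equiv> disc_set \<Omega> u - jump_set \<Omega> u"
abbreviation "U \<equiv> precise_rep \<Omega> u"

lemma S_borel: "S \<in> sets borel" "S \<subseteq> \<Omega>"
  using null_setsD2[OF S_null] by (auto simp: borel_on_iff[OF open_\<Omega>])

text \<open>
  Almost every point is a Lebesgue point, so the exceptional set is Lebesgue null; for the singular part it is null
  by hypothesis.
\<close>

lemma S_null_D: "S \<in> null_sets (total_variation \<Omega> D)"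
proof (rule null_set_of_singular_and_Lebesgue[OF D_Radon S_null])
  obtain N where N: "negligible N" "disc_set \<Omega> u \<subseteq> N"
    by (rule disc_set_negligible[OF open_\<Omega> v v_int u_meas])
  have "negligible S" by (rule negligible_subset[OF N(1)]) (use N(2) in blast)
  then have "S \<in> null_sets lebesgue" by (simp add: negligible_iff_null_sets)
  then have "S \<in> null_sets lborel"
    using S_borel(1) null_sets_completion_iff[of S lborel] by simp
  then show "S \<in> null_sets (restrict_space lborel \<Omega>)"
    using S_borel(2) \<Omega>_borel by (simp add: null_sets_restrict_space)
qed

lemma S_null_Dj:
  shows "S \<in> null_sets (positive_part \<Omega> (Dj j))" and "S \<in> null_sets (positive_part \<Omega> (\<lambda>B. - Dj j B))"
proof -
  have R: "Radon_measure \<Omega> (Dj j)" by (rule Radon_measure_inner[OF D_Radon])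
  have "S \<in> borel_on \<Omega> \<and> (\<forall>B\<in>borel_on \<Omega>. B \<subseteq> S \<longrightarrow> D B = 0)"
    using S_null_D unfolding total_variation_null_iff[OF D_Radon] .
  then have Sb: "S \<in> borel_on \<Omega>" and "S \<in> null_sets (total_variation \<Omega> (Dj j))"
    unfolding total_variation_null_iff[OF R] by auto
  then have "measure (total_variation \<Omega> (Dj j)) S = 0" by (simp only: measure_eq_0_null_sets)
  then have 0: "measure (positive_part \<Omega> (Dj j)) S = 0" "measure (positive_part \<Omega> (\<lambda>B. - Dj j B)) S = 0"
    using Jordan_decomposition(2)[OF R Sb] measure_nonneg[of "positive_part \<Omega> (Dj j)" S]
      measure_nonneg[of "positive_part \<Omega> (\<lambda>B. - Dj j B)" S] by linarith+
  interpret p: finite_measure "positive_part \<Omega> (Dj j)" by (rule finite_measure_positive_part[OF R])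
  interpret q: finite_measure "positive_part \<Omega> (\<lambda>B. - Dj j B)"
    by (rule finite_measure_positive_part[OF Radon_measure_uminus[OF R]])
  show "S \<in> null_sets (positive_part \<Omega> (Dj j))" "S \<in> null_sets (positive_part \<Omega> (\<lambda>B. - Dj j B))"
    using 0 Sb by (simp_all add: null_sets_def p.emeasure_eq_measure q.emeasure_eq_measure)
qed

lemma mollify_tendsto_U:
  assumes "x \<in> \<Omega>" "x \<notin> S"
  shows "(\<lambda>n. mollify (radius n) v x $ j) \<longlonglongrightarrow> U x $ j"
  by (rule tendsto_vec_nth[OF filterlim_compose[OF
          mollify_tendsto_precise_rep[OF open_\<Omega> v v_int u_meas assms] radius_tendsto]])

lemma U_on_S: "x \<in> S \<Longrightarrow> U x = 0"
  by (auto simp: precise_rep_def)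

lemma U_le:
  assumes x: "x \<in> \<Omega>"
  shows "\<bar>U x $ j\<bar> \<le> M"
proof (cases "x \<in> S")
  case True
  then show ?thesis using M_nonneg by (simp only: U_on_S zero_index abs_zero)
next
  case False
  have "(\<lambda>n. \<bar>mollify (radius n) v x $ j\<bar>) \<longlonglongrightarrow> \<bar>U x $ j\<bar>"
    by (rule tendsto_rabs[OF mollify_tendsto_U[OF x False]])
  then show ?thesis
    by (rule LIMSEQ_le_const2) (use mollify_component_le[OF radius_pos] in blast)
qed

text \<open>
  The hypothesis that \<open>S\<close> is a null set contains that \<open>S\<close> is a Borel set. Off \<open>S\<close> the precise
  representative is a limit of Borel functions, and on \<open>S\<close> it is \<open>0\<close>.
\<close>

lemma U_measurable: "(\<lambda>x. U x $ j) \<in> borel_measurable (restrict_space borel \<Omega>)"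
proof (rule borel_measurable_LIMSEQ_real)
  show "(\<lambda>x. indicator (- S) x * mollify (radius n) v x $ j) \<in> borel_measurable (restrict_space borel \<Omega>)" for n
    by (intro measurable_restrict_space1 borel_measurable_times borel_measurable_indicator borel_comp S_borel(1)
        mollify_component_measurable[OF radius_pos])
  fix x assume "x \<in> space (restrict_space borel \<Omega>)"
  then have x: "x \<in> \<Omega>" by (simp add: space_restrict_space)
  show "(\<lambda>n. indicator (- S) x * mollify (radius n) v x $ j) \<longlonglongrightarrow> U x $ j"
  proof (cases "x \<in> S")
    case True
    then have "indicator (- S) x = (0::real)" by simp
    then show ?thesis by (simp only: U_on_S[OF True] zero_index mult_zero_left tendsto_const)
  next
    case False
    then have "indicator (- S) x = (1::real)" by simp
    then show ?thesis by (simp only: mult_1 mollify_tendsto_U[OF x False])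
  qed
qed

lemma test_mollify_limit:
  assumes \<phi>: "\<phi> \<in> test_functions \<Omega>" and N: "finite_measure N" "sets N = borel_on \<Omega>" "S \<in> null_sets N"
  shows "(\<lambda>n. LINT x|N. \<phi> x * mollify (radius n) v x $ j) \<longlonglongrightarrow> (LINT x|N. \<phi> x * U x $ j)"
proof -
  interpret finite_measure N by fact
  have space: "space N = \<Omega>" using sets_eq_imp_space_eq[OF N(2)] by (simp add: space_restrict_space)
  have meas: "f \<in> borel_measurable (restrict_space borel \<Omega>) \<Longrightarrow> f \<in> borel_measurable N" for f :: "_ \<Rightarrow> real"
    using measurable_cong_sets[OF N(2) refl] by blast
  obtain K where K: "\<And>x. \<bar>\<phi> x\<bar> \<le> K" "0 \<le> K" using test_function_bounded[OF \<phi>] by metis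
  show ?thesis
  proof (rule integral_dominated_convergence[where w="\<lambda>_. K * M"])
    show "(\<lambda>x. \<phi> x * U x $ j) \<in> borel_measurable N"
      by (intro meas borel_measurable_times test_function_measurable(1)[OF \<phi>] U_measurable)
    show "(\<lambda>x. \<phi> x * mollify (radius n) v x $ j) \<in> borel_measurable N" for n
      by (intro meas borel_measurable_times test_function_measurable(1)[OF \<phi>] measurable_restrict_space1
          mollify_component_measurable[OF radius_pos])
    show "integrable N (\<lambda>_. K * M)" by simp
    have "AE x in N. x \<notin> S" by (rule AE_not_in[OF N(3)])
    then show "AE x in N. (\<lambda>n. \<phi> x * mollify (radius n) v x $ j) \<longlonglongrightarrow> \<phi> x * U x $ j"
    proof (rule AE_mp, intro AE_I2 impI)
      fix x assume "x \<in> space N" "x \<notin> S"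
      then show "(\<lambda>n. \<phi> x * mollify (radius n) v x $ j) \<longlonglongrightarrow> \<phi> x * U x $ j"
        unfolding space by (intro tendsto_mult_left mollify_tendsto_U)
    qed
    show "AE x in N. norm (\<phi> x * mollify (radius n) v x $ j) \<le> K * M" for n
      unfolding real_norm_def abs_mult using K mollify_component_le[OF radius_pos]
      by (intro AE_I2 mult_mono) auto
  qed
qed

lemma signed_integral_mollify_limit:
  assumes \<phi>: "\<phi> \<in> test_functions \<Omega>"
  shows "(\<lambda>n. signed_integral \<Omega> (Dj j) (\<lambda>x. \<phi> x * mollify (radius n) v x $ j))
    \<longlonglongrightarrow> signed_integral \<Omega> (Dj j) (\<lambda>x. \<phi> x * U x $ j)"
proof -
  have R: "Radon_measure \<Omega> (Dj j)" by (rule Radon_measure_inner[OF D_Radon])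
  show ?thesis
    unfolding signed_integral_def
    by (rule tendsto_diff[OF
          test_mollify_limit[OF \<phi> finite_measure_positive_part[OF R] sets_positive_part S_null_Dj(1)]
          test_mollify_limit[OF \<phi> finite_measure_positive_part[OF Radon_measure_uminus[OF R]] sets_positive_part S_null_Dj(2)]])
qed

lemma inner_sym_prod: "a x \<bullet> (m \<odot> g) = (\<Sum>j\<in>UNIV. \<Sum>i\<in>UNIV. a x $ i $ j * (g $ i * m $ j))"
  unfolding inner_symmetric_matrix[OF a_sym]
  by (rule arg_cong[where f="\<lambda>z. a x \<bullet> z"]) (simp add: sym_prod_def vec_eq_iff algebra_simps)

lemma a_sym_prod_limit:
  assumes \<phi>: "\<phi> \<in> test_functions \<Omega>"
  shows "(\<lambda>n. LINT x|lborel. a x \<bullet> (mollify (radius n) v x \<odot> grad \<phi> x)) \<longlonglongrightarrow> (LINT x|lborel. a x \<bullet> (v x \<odot> grad \<phi> x))"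
proof -
  obtain K where K: "\<And>x i. \<bar>grad \<phi> x $ i\<bar> \<le> K" "0 \<le> K" using test_function_bounded[OF \<phi>] by metis
  let ?T = "closure {x. \<phi> x \<noteq> 0}"
  let ?c = "real CARD('n) * (real CARD('n) * (L * (K * M)))"
  obtain N where N: "negligible N" "\<And>x. x \<notin> N \<Longrightarrow> ((\<lambda>r. mollify r v x) \<longlongrightarrow> v x) (at_right 0)"
    using disc_set_negligible[OF open_\<Omega> v v_int u_meas] by metis
  have aeN: "AE x in lborel. x \<notin> N"
  proof -
    have "AE x in lebesgue. x \<notin> N" using N(1) by (intro AE_not_in) (simp add: negligible_iff_null_sets)
    then show ?thesis by (simp only: AE_completion_iff)
  qed
  show ?thesis
    unfolding inner_sym_prod
  proof (rule integral_dominated_convergence[where w="\<lambda>x. ?c * indicator ?T x"])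
    show "(\<lambda>x. \<Sum>j\<in>UNIV. \<Sum>i\<in>UNIV. a x $ i $ j * (grad \<phi> x $ i * v x $ j)) \<in> borel_measurable lborel"
      unfolding measurable_lborel2
      by (intro borel_measurable_sum borel_measurable_times aij_meas grad_measurable[OF \<phi>] vi_meas)
    show "(\<lambda>x. \<Sum>j\<in>UNIV. \<Sum>i\<in>UNIV. a x $ i $ j * (grad \<phi> x $ i * mollify (radius n) v x $ j)) \<in> borel_measurable lborel" for n
      unfolding measurable_lborel2
      by (intro borel_measurable_sum borel_measurable_times aij_meas grad_measurable[OF \<phi>] mollify_component_measurable[OF radius_pos])
    show "integrable lborel (\<lambda>x. ?c * indicator ?T x)"
      using test_functionsD(2)[OF \<phi>]
      by (intro integrable_mult_right integrable_real_indicator emeasure_bounded_finite compact_imp_bounded) auto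
    show "AE x in lborel. (\<lambda>n. \<Sum>j\<in>UNIV. \<Sum>i\<in>UNIV. a x $ i $ j * (grad \<phi> x $ i * mollify (radius n) v x $ j))
        \<longlonglongrightarrow> (\<Sum>j\<in>UNIV. \<Sum>i\<in>UNIV. a x $ i $ j * (grad \<phi> x $ i * v x $ j))"
      using aeN
    proof (rule AE_mp, intro AE_I2 impI)
      fix x assume "x \<notin> N"
      then have "(\<lambda>n. mollify (radius n) v x $ j) \<longlonglongrightarrow> v x $ j" for j
        by (intro tendsto_vec_nth filterlim_compose[OF N(2) radius_tendsto])
      then show "(\<lambda>n. \<Sum>j\<in>UNIV. \<Sum>i\<in>UNIV. a x $ i $ j * (grad \<phi> x $ i * mollify (radius n) v x $ j))
        \<longlonglongrightarrow> (\<Sum>j\<in>UNIV. \<Sum>i\<in>UNIV. a x $ i $ j * (grad \<phi> x $ i * v x $ j))"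
        by (intro tendsto_sum tendsto_mult_left)
    qed
    show "AE x in lborel. norm (\<Sum>j\<in>UNIV. \<Sum>i\<in>UNIV. a x $ i $ j * (grad \<phi> x $ i * mollify (radius n) v x $ j)) \<le> ?c * indicator ?T x" for n
    proof (rule AE_I2)
      fix x
      let ?X = "\<Sum>j\<in>UNIV. \<Sum>i\<in>UNIV. a x $ i $ j * (grad \<phi> x $ i * mollify (radius n) v x $ j)"
      show "norm ?X \<le> ?c * indicator ?T x"
      proof (cases "x \<in> ?T")
        case True
        have "\<bar>grad \<phi> x $ i * mollify (radius n) v x $ j\<bar> \<le> K * M" for i j
          unfolding abs_mult using K mollify_component_le[OF radius_pos] by (intro mult_mono) auto
        then have "\<bar>\<Sum>i\<in>UNIV. a x $ i $ j * (grad \<phi> x $ i * mollify (radius n) v x $ j)\<bar> \<le> real CARD('n) * (L * (K * M))" for j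
          by (rule a_sum_le)
        then have "\<bar>?X\<bar> \<le> (\<Sum>j\<in>(UNIV::'n set). real CARD('n) * (L * (K * M)))"
          by (rule order_trans[OF sum_abs sum_mono])
        then show ?thesis using True by simp
      next
        case False
        have "grad \<phi> x = 0" by (rule grad_test_function_outside[OF \<phi> False])
        then have "?X = 0" by simp
        then show ?thesis using False by simp
      qed
    qed
  qed
qed

text \<open>
  In the mollified identity the terms that contain the mollified field converge, and their limits make up the
  definition of the pairing.
\<close>

lemma pairing_limit:
  assumes \<phi>: "\<phi> \<in> test_functions \<Omega>"
  shows "(\<lambda>n. LINT x|lborel. \<phi> x * (a x \<bullet> W (radius n) x)) \<longlonglongrightarrow> pairing \<Omega> A u \<phi>"
proof -
  have "(\<lambda>n. - (\<Sum>j\<in>UNIV. signed_integral \<Omega> (Dj j) (\<lambda>x. \<phi> x * mollify (radius n) v x $ j))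
      - (LINT x|lborel. a x \<bullet> (mollify (radius n) v x \<odot> grad \<phi> x))) \<longlonglongrightarrow> pairing \<Omega> A u \<phi>"
    unfolding pairing_eq[OF \<phi>]
    by (intro tendsto_diff tendsto_minus tendsto_sum signed_integral_mollify_limit[OF \<phi>] a_sym_prod_limit[OF \<phi>])
  then show ?thesis unfolding mollified_identity(1)[OF \<phi> radius_pos] by simp
qed

text \<open>
  Linearity is inherited from the approximating integrals.
\<close>

lemma pairing_add:
  assumes "\<phi> \<in> test_functions \<Omega>" "\<psi> \<in> test_functions \<Omega>"
  shows "pairing \<Omega> A u (\<lambda>x. \<phi> x + \<psi> x) = pairing \<Omega> A u \<phi> + pairing \<Omega> A u \<psi>"
proof (rule LIMSEQ_unique[OF pairing_limit[OF test_functions_add[OF assms]]])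
  have "(LINT x|lborel. (\<phi> x + \<psi> x) * (a x \<bullet> W (radius n) x))
      = (LINT x|lborel. \<phi> x * (a x \<bullet> W (radius n) x)) + (LINT x|lborel. \<psi> x * (a x \<bullet> W (radius n) x))" for n
    unfolding distrib_right
    by (rule Bochner_Integration.integral_add[OF mollified_identity(2)[OF assms(1) radius_pos] mollified_identity(2)[OF assms(2) radius_pos]])
  then show "(\<lambda>n. LINT x|lborel. (\<phi> x + \<psi> x) * (a x \<bullet> W (radius n) x)) \<longlonglongrightarrow> pairing \<Omega> A u \<phi> + pairing \<Omega> A u \<psi>"
    by (simp only: tendsto_add[OF pairing_limit[OF assms(1)] pairing_limit[OF assms(2)]])
qed

lemma pairing_scale:
  assumes "\<phi> \<in> test_functions \<Omega>"
  shows "pairing \<Omega> A u (\<lambda>x. c * \<phi> x) = c * pairing \<Omega> A u \<phi>"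
proof (rule LIMSEQ_unique[OF pairing_limit[OF test_functions_scale[OF assms]]])
  have "(LINT x|lborel. c * \<phi> x * (a x \<bullet> W (radius n) x)) = c * (LINT x|lborel. \<phi> x * (a x \<bullet> W (radius n) x))" for n
    unfolding mult.assoc by (rule integral_mult_right_zero)
  then show "(\<lambda>n. LINT x|lborel. c * \<phi> x * (a x \<bullet> W (radius n) x)) \<longlonglongrightarrow> c * pairing \<Omega> A u \<phi>"
    by (simp only: tendsto_mult_left[OF pairing_limit[OF assms]])
qed

text \<open>
  For small \<open>r\<close> the kernels around points of the support of \<open>\<phi>\<close> are test functions of \<open>\<Omega>\<close>, which bounds
  \<open>W r x\<close> by the integral of the kernel against \<open>|Eu|\<close>. Fubini moves the kernel onto \<open>|\<phi>|\<close>, whose mollifications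
  converge to it at every point because it is continuous.
\<close>

lemma pairing_bound:
  assumes G: "open G" "G \<subseteq> \<Omega>" and \<phi>: "\<phi> \<in> test_functions G" and C: "0 \<le> C"
    and aC: "AE x in lborel. x \<in> G \<longrightarrow> norm (a x) \<le> C"
  shows "\<bar>pairing \<Omega> A u \<phi>\<bar> \<le> C * (LINT x|total_variation \<Omega> E. \<bar>\<phi> x\<bar>)"
proof -
  define m where "m = total_variation \<Omega> E"
  interpret m: finite_measure m unfolding m_def by (rule finite_measure_total_variation[OF E_Radon])
  have sets_m: "sets m = borel_on \<Omega>" by (simp add: m_def)
  have \<phi>\<Omega>: "\<phi> \<in> test_functions \<Omega>" using test_functions_mono[OF G(2)] \<phi> by blast
  obtain K where K: "\<And>x. \<bar>\<phi> x\<bar> \<le> K" "0 \<le> K" using test_function_bounded[OF \<phi>] by metis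
  let ?T = "closure {x. \<phi> x \<noteq> 0}"
  have T: "compact ?T" "?T \<subseteq> G" by (rule test_functionsD[OF \<phi>])+
  obtain d where d: "0 < d" "(\<Union>x\<in>?T. cball x d) \<subseteq> \<Omega>"
    using compact_subset_open_imp_cball_epsilon_subset[OF T(1) open_\<Omega>] T(2) G(2) by (metis order_trans)
  have absint: "integrable lborel (\<lambda>x. \<bar>\<phi> x\<bar>)"
  proof (rule integrable_abs, rule integrable_support_bounded[OF \<phi>\<Omega> test_function_measurable(2)[OF \<phi>] K(1)])
    show "\<phi> x = 0" if "x \<notin> ?T" for x using in_closure_support[of \<phi> x] that by blast
  qed
  let ?w = "\<lambda>x. \<bar>\<phi> x\<bar>"
  have sf: "sigma_finite_measure m" "sigma_finite_measure (lborel :: (real^'n) measure)" by unfold_locales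
  have FM: "(\<lambda>p. mollifier r (fst p) (snd p) * ?w (snd p)) \<in> borel_measurable (m \<Otimes>\<^sub>M lborel)" for r
    by (rule measurable_pair_to_borel[where \<Omega>=\<Omega>])
      (intro borel_measurable_times mollifier_measurable borel_measurable_abs
        measurable_compose[OF measurable_snd test_function_measurable(2)[OF \<phi>]], use sets_m in simp)
  have Fub: "(LINT y|m. mollify r ?w y) = (LINT x|lborel. ?w x * (LINT y|m. mollifier r y x))"
    "integrable m (mollify r ?w)" "integrable lborel (\<lambda>x. ?w x * (LINT y|m. mollifier r y x))" if r: "0 < r" for r
  proof -
    obtain B where B: "0 \<le> B" "\<And>x y. mollifier r (x::real^'n) y \<le> B" using mollifier_bounded[OF r] by blast
    have bound: "\<bar>mollifier r y x * ?w x\<bar> \<le> B * ?w x" for x y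
      using B(2)[of y x] mollifier_nonneg[OF r, of y x] by (simp add: abs_mult mult_right_mono)
    have Bint: "integrable m (\<lambda>y. B)" by simp
    note F = Fubini_dominated[OF sf FM Bint absint bound]
    have 1: "(LINT x|lborel. mollifier r y x * ?w x) = mollify r ?w y" for y by (simp add: mollify_def)
    have 2: "(LINT y|m. mollifier r y x * ?w x) = ?w x * (LINT y|m. mollifier r y x)" for x
      unfolding mult.commute[of _ "?w x"] by (rule integral_mult_right_zero)
    show "(LINT y|m. mollify r ?w y) = (LINT x|lborel. ?w x * (LINT y|m. mollifier r y x))"
      using F(1) unfolding 1 2 .
    show "integrable m (mollify r ?w)" using F(2) unfolding 1 .
    show "integrable lborel (\<lambda>x. ?w x * (LINT y|m. mollifier r y x))" using F(3) unfolding 2 .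
  qed
  have est: "\<bar>LINT x|lborel. \<phi> x * (a x \<bullet> W r x)\<bar> \<le> C * (LINT y|m. mollify r ?w y)" if r: "0 < r" "r < d" for r
  proof -
    have "\<bar>LINT x|lborel. \<phi> x * (a x \<bullet> W r x)\<bar> \<le> (LINT x|lborel. \<bar>\<phi> x * (a x \<bullet> W r x)\<bar>)"
      by (rule integral_abs_bound)
    also have "\<dots> \<le> (LINT x|lborel. C * (?w x * (LINT y|m. mollifier r y x)))"
    proof (rule integral_mono_AE)
      show "integrable lborel (\<lambda>x. \<bar>\<phi> x * (a x \<bullet> W r x)\<bar>)"
        by (rule integrable_abs[OF mollified_identity(2)[OF \<phi>\<Omega> r(1)]])
      show "integrable lborel (\<lambda>x. C * (?w x * (LINT y|m. mollifier r y x)))"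
        by (rule integrable_mult_right[OF Fub(3)[OF r(1)]])
      show "AE x in lborel. \<bar>\<phi> x * (a x \<bullet> W r x)\<bar> \<le> C * (?w x * (LINT y|m. mollifier r y x))"
        using aC
      proof (rule AE_mp, intro AE_I2 impI)
        fix x assume x: "x \<in> G \<longrightarrow> norm (a x) \<le> C"
        show "\<bar>\<phi> x * (a x \<bullet> W r x)\<bar> \<le> C * (?w x * (LINT y|m. mollifier r y x))"
        proof (cases "\<phi> x = 0")
          case False
          then have xT: "x \<in> ?T" by (rule in_closure_support)
          then have "norm (a x) \<le> C" using x T(2) by blast
          have "cball x r \<subseteq> cball x d" using r by (intro subset_cball) simp
          then have cb: "cball x r \<subseteq> \<Omega>" using d(2) xT by blast
          have "norm (W r x) \<le> (LINT y|m. \<bar>mollifier r x y\<bar>)"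
            using E_norm_le[OF mollifier_test_function[OF r(1) cb]] unfolding W_eq_E_distr[OF r(1) cb] m_def .
          also have "\<dots> = (LINT y|m. mollifier r y x)"
            by (simp only: mollifier_commute[of r x] abs_of_nonneg[OF mollifier_nonneg[OF r(1)]])
          finally have Wle: "norm (W r x) \<le> (LINT y|m. mollifier r y x)" .
          have "\<bar>a x \<bullet> W r x\<bar> \<le> norm (a x) * norm (W r x)" by (rule Cauchy_Schwarz_ineq2)
          also have "\<dots> \<le> C * (LINT y|m. mollifier r y x)"
            using \<open>norm (a x) \<le> C\<close> Wle C by (intro mult_mono) auto
          finally have "\<bar>\<phi> x\<bar> * \<bar>a x \<bullet> W r x\<bar> \<le> \<bar>\<phi> x\<bar> * (C * (LINT y|m. mollifier r y x))"
            by (rule mult_left_mono) simp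
          then show ?thesis by (simp add: abs_mult mult_ac)
        qed simp
      qed
    qed
    also have "\<dots> = C * (LINT y|m. mollify r ?w y)"
      unfolding Fub(1)[OF r(1)] by (rule integral_mult_right_zero)
    finally show ?thesis .
  qed
  have lim: "(\<lambda>n. LINT y|m. mollify (radius n) ?w y) \<longlonglongrightarrow> (LINT y|m. ?w y)"
  proof (rule integral_dominated_convergence[where w="\<lambda>_. K"])
    show "?w \<in> borel_measurable m"
      using test_function_measurable(1)[OF \<phi>, of \<Omega>] measurable_cong_sets[OF sets_m refl] by (intro borel_measurable_abs) blast
    show "mollify (radius n) ?w \<in> borel_measurable m" for n
      by (rule borel_measurable_integrable[OF Fub(2)[OF radius_pos]])
    show "integrable m (\<lambda>_. K)" by simp
    have "isCont ?w y" for y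
      using test_functionsD(5)[OF \<phi>, of UNIV] by (intro continuous_rabs) (simp add: continuous_on_eq_continuous_at)
    then show "AE y in m. (\<lambda>n. mollify (radius n) ?w y) \<longlonglongrightarrow> ?w y"
      by (intro AE_I2 filterlim_compose[OF mollify_tendsto_continuity_point[OF absint] radius_tendsto])
    show "AE y in m. norm (mollify (radius n) ?w y) \<le> K" for n
      unfolding real_norm_def using K(1) by (intro AE_I2 abs_mollify_le[OF radius_pos absint]) simp
  qed
  have ev: "\<forall>\<^sub>F n in sequentially. \<bar>LINT x|lborel. \<phi> x * (a x \<bullet> W (radius n) x)\<bar> \<le> C * (LINT y|m. mollify (radius n) ?w y)"
  proof -
    have "\<forall>\<^sub>F n in sequentially. radius n < d"
      using order_tendstoD(2)[OF LIMSEQ_inverse_real_of_nat d(1)] by (simp add: radius_def)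
    then show ?thesis by (rule eventually_mono) (rule est[OF radius_pos])
  qed
  show ?thesis
    unfolding m_def[symmetric]
    by (rule tendsto_le[OF sequentially_bot tendsto_mult_left[OF lim] tendsto_rabs[OF pairing_limit[OF \<phi>\<Omega>]] ev])
qed

end

section \<open>Measures with density\<close>

text \<open>
  The measure \<open>f \<mu>\<close>, in the form in which it occurs in \<open>dot_measure\<close>.
\<close>

definition weighted_measure :: "'a::euclidean_space set \<Rightarrow> ('a \<Rightarrow> real) \<Rightarrow> ('a set \<Rightarrow> real) \<Rightarrow> 'a set \<Rightarrow> real" where
  "weighted_measure \<Omega> f \<mu> B =
     (if B \<in> borel_on \<Omega> then signed_integral \<Omega> \<mu> (\<lambda>x. indicator B x * f x) else 0)"

lemma finite_density:
  fixes f :: "'a \<Rightarrow> real"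
  assumes N: "finite_measure N" and f: "f \<in> borel_measurable N" "\<And>x. x \<in> space N \<Longrightarrow> \<bar>f x\<bar> \<le> K" "\<And>x. 0 \<le> f x"
  defines "P \<equiv> density N (\<lambda>x. ennreal (f x))"
  shows "finite_measure P" and "\<And>g :: 'a \<Rightarrow> real. g \<in> borel_measurable N \<Longrightarrow> (LINT x|P. g x) = (LINT x|N. f x * g x)"
    and "\<And>B. B \<in> sets N \<Longrightarrow> measure P B = (LINT x|N. f x * indicator B x)"
proof -
  show int: "(LINT x|P. g x) = (LINT x|N. f x * g x)" if "g \<in> borel_measurable N" for g :: "'a \<Rightarrow> real"
    unfolding P_def using integral_density[OF that f(1)] f(3) by simp
  have fin: "emeasure P (space P) \<noteq> \<infinity>"
  proof -
    have "emeasure P (space P) = (\<integral>\<^sup>+x. ennreal (f x) * indicator (space N) x \<partial>N)"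
      unfolding P_def space_density using f(1) by (intro emeasure_density) auto
    also have "\<dots> = (\<integral>\<^sup>+x. ennreal (f x) \<partial>N)" by (intro nn_integral_cong) simp
    also have "\<dots> = ennreal (LINT x|N. f x)"
      using bounded_integrable[OF N f(1), of K] f by (intro nn_integral_eq_integral) auto
    finally show ?thesis by simp
  qed
  then show "finite_measure P" by (rule finite_measureI)
  show "measure P B = (LINT x|N. f x * indicator B x)" if B: "B \<in> sets N" for B
  proof -
    have "(LINT x|P. indicator B x) = measure P B"
      using sets.sets_into_space[OF B] by (simp add: P_def Int_absorb2)
    then show ?thesis using int[of "indicator B"] B by simp
  qed
qed

text \<open>
  Splitting \<open>\<mu>\<close> and \<open>f\<close> into positive and negative parts writes \<open>f \<mu>\<close> as a combination of four finite measures
  with nonnegative densities.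
\<close>

lemma
  fixes \<mu> :: "'a::euclidean_space set \<Rightarrow> real"
  assumes \<mu>: "Radon_measure \<Omega> \<mu>"
    and f: "f \<in> borel_measurable (restrict_space borel \<Omega>)" "\<And>x. x \<in> \<Omega> \<Longrightarrow> \<bar>f x\<bar> \<le> K"
  shows Radon_weighted_measure: "Radon_measure \<Omega> (weighted_measure \<Omega> f \<mu>)"
    and signed_integral_weighted_measure: "\<And>g L. g \<in> borel_measurable (restrict_space borel \<Omega>) \<Longrightarrow>
      (\<And>x. x \<in> \<Omega> \<Longrightarrow> \<bar>g x\<bar> \<le> L) \<Longrightarrow>
      signed_integral \<Omega> (weighted_measure \<Omega> f \<mu>) g = signed_integral \<Omega> \<mu> (\<lambda>x. g x * f x)"
proof -
  define p q where "p = positive_part \<Omega> \<mu>" and "q = positive_part \<Omega> (\<lambda>B. - \<mu> B)"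
  have fin: "finite_measure p" "finite_measure q"
    unfolding p_def q_def by (rule finite_measure_positive_part[OF \<mu>], rule finite_measure_positive_part[OF Radon_measure_uminus[OF \<mu>]])
  have sets: "sets p = borel_on \<Omega>" "sets q = borel_on \<Omega>" and space: "space p = \<Omega>" "space q = \<Omega>"
    by (simp_all add: p_def q_def)
  define h where "h s x = indicator \<Omega> x * max 0 (s * f x)" for s x
  have \<Omega>: "\<Omega> \<in> borel_on \<Omega>" using sets.top[of "restrict_space borel \<Omega>"] by (simp add: space_restrict_space)
  have hm: "h s \<in> borel_measurable (restrict_space borel \<Omega>)" for s
    unfolding h_def[abs_def] using f(1) \<Omega> by (intro borel_measurable_times borel_measurable_indicator borel_measurable_max) auto
  have h0: "0 \<le> h s x" for s x by (simp add: h_def)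
  have hK: "\<bar>h s x\<bar> \<le> \<bar>K\<bar>" if "x \<in> \<Omega>" "s = 1 \<or> s = -1" for s x
    using f(2)[OF that(1)] that by (auto simp: h_def)
  have hf: "f x = h 1 x - h (-1) x" if "x \<in> \<Omega>" for x using that by (simp add: h_def)
  define d where "d N s = density N (\<lambda>x. ennreal (h s x))" for N :: "'a measure" and s
  have m: "g \<in> borel_measurable N" if "sets N = borel_on \<Omega>" "g \<in> borel_measurable (restrict_space borel \<Omega>)" for N and g :: "'a \<Rightarrow> real"
    using measurable_cong_sets[OF that(1) refl] that(2) by blast
  have dens: "finite_measure (d N s)" "sets (d N s) = borel_on \<Omega>"
    "B \<in> borel_on \<Omega> \<Longrightarrow> measure (d N s) B = (LINT x|N. h s x * indicator B x)"
    "g \<in> borel_measurable (restrict_space borel \<Omega>) \<Longrightarrow> (LINT x|d N s. g x) = (LINT x|N. h s x * g x)"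
    if N: "finite_measure N" "sets N = borel_on \<Omega>" "space N = \<Omega>" and s: "s = 1 \<or> s = -1" for N s B g
  proof -
    have b: "\<And>x. x \<in> space N \<Longrightarrow> \<bar>h s x\<bar> \<le> \<bar>K\<bar>" using hK s N(3) by blast
    note F = finite_density[OF N(1) m[OF N(2) hm] b h0, folded d_def]
    show "finite_measure (d N s)" by (rule F(1))
    show "sets (d N s) = borel_on \<Omega>" by (simp add: d_def N(2))
    show "B \<in> borel_on \<Omega> \<Longrightarrow> measure (d N s) B = (LINT x|N. h s x * indicator B x)" using F(3) N(2) by simp
    show "g \<in> borel_measurable (restrict_space borel \<Omega>) \<Longrightarrow> (LINT x|d N s. g x) = (LINT x|N. h s x * g x)"
      using F(2) m[OF N(2)] by blast
  qed
  have split: "(LINT x|N. g x * f x) = (LINT x|N. h 1 x * g x) - (LINT x|N. h (-1) x * g x)"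
    if N: "finite_measure N" "sets N = borel_on \<Omega>" "space N = \<Omega>"
      and g: "g \<in> borel_measurable (restrict_space borel \<Omega>)" "\<And>x. x \<in> \<Omega> \<Longrightarrow> \<bar>g x\<bar> \<le> L" for N g L
  proof -
    have i: "integrable N (\<lambda>x. h s x * g x)" if s: "s = 1 \<or> s = -1" for s
    proof (rule bounded_integrable[OF N(1), where K="\<bar>K\<bar> * L"])
      show "(\<lambda>x. h s x * g x) \<in> borel_measurable N" by (intro borel_measurable_times m[OF N(2)] hm g)
      fix x assume "x \<in> space N"
      then have "x \<in> \<Omega>" using N(3) by simp
      then show "norm (h s x * g x) \<le> \<bar>K\<bar> * L"
        unfolding real_norm_def abs_mult using hK[OF _ s] g(2) by (intro mult_mono) auto
    qed
    have "(LINT x|N. g x * f x) = (LINT x|N. h 1 x * g x - h (-1) x * g x)"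
      by (intro Bochner_Integration.integral_cong refl) (simp only: N(3) hf, simp only: algebra_simps)
    also have "\<dots> = (LINT x|N. h 1 x * g x) - (LINT x|N. h (-1) x * g x)"
      by (rule Bochner_Integration.integral_diff[OF i i]) auto
    finally show ?thesis .
  qed
  note dp = dens[OF fin(1) sets(1) space(1)] and dq = dens[OF fin(2) sets(2) space(2)]
  have weq: "weighted_measure \<Omega> f \<mu> B = (measure (d p 1) B - measure (d p (-1)) B) + (measure (d q (-1)) B - measure (d q 1) B)" for B
  proof (cases "B \<in> borel_on \<Omega>")
    case True
    have ib: "(indicator B :: _ \<Rightarrow> real) \<in> borel_measurable (restrict_space borel \<Omega>)" "\<And>x. x \<in> \<Omega> \<Longrightarrow> \<bar>indicator B x :: real\<bar> \<le> 1"
      using True by auto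
    show ?thesis
      using split[OF fin(1) sets(1) space(1) ib] split[OF fin(2) sets(2) space(2) ib] True
      by (simp add: weighted_measure_def signed_integral_def p_def[symmetric] q_def[symmetric] dp(3) dq(3))
  next
    case False
    then show ?thesis
      using dp(2)[of 1] dp(2)[of "-1"] dq(2)[of 1] dq(2)[of "-1"]
      by (simp add: weighted_measure_def measure_notin_sets)
  qed
  then have wfun: "weighted_measure \<Omega> f \<mu> = (\<lambda>B. (measure (d p 1) B - measure (d p (-1)) B) + (measure (d q (-1)) B - measure (d q 1) B))"
    by (rule ext)
  show R: "Radon_measure \<Omega> (weighted_measure \<Omega> f \<mu>)"
    unfolding wfun by (intro Radon_measure_add Radon_measure_diff_measures dp(1,2) dq(1,2)) auto
  fix g :: "'a \<Rightarrow> real" and L :: real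
  assume g: "g \<in> borel_measurable (restrict_space borel \<Omega>)" "\<And>x. x \<in> \<Omega> \<Longrightarrow> \<bar>g x\<bar> \<le> L"
  define \<kappa> where "\<kappa> = weighted_measure \<Omega> f \<mu>"
  define M where "M i = (if i = 0 then positive_part \<Omega> \<kappa> else if i = 1 then positive_part \<Omega> (\<lambda>B. - \<kappa> B)
      else if i = 2 then d p 1 else if i = 3 then d p (-1) else if i = 4 then d q 1 else d q (-1))" for i :: nat
  define c where "c i = (if i = 0 \<or> i = 3 \<or> i = 4 then 1 else -1 :: real)" for i :: nat
  have "(\<Sum>i\<in>{0,1,2,3,4,5}. c i * (LINT x|M i. g x)) = 0"
  proof (rule integral_lincomb_eq_0[where N="restrict_space borel \<Omega>" and K=L])
    show "finite_measure (M i)" for i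
      using finite_measure_positive_part[OF R] finite_measure_positive_part[OF Radon_measure_uminus[OF R]]
        dp(1)[of 1] dp(1)[of "-1"] dq(1)[of 1] dq(1)[of "-1"]
      by (simp add: M_def \<kappa>_def)
    show "sets (M i) = borel_on \<Omega>" for i
      using dp(2)[of 1] dp(2)[of "-1"] dq(2)[of 1] dq(2)[of "-1"] by (simp add: M_def)
    show "(\<Sum>i\<in>{0,1,2,3,4,5}. c i * measure (M i) B) = 0" if B: "B \<in> borel_on \<Omega>" for B
      using Jordan_decomposition(1)[OF R B] weq[of B] by (simp add: M_def c_def \<kappa>_def)
  qed (use g in \<open>auto simp: space_restrict_space\<close>)
  then have "signed_integral \<Omega> \<kappa> g = ((LINT x|d p 1. g x) - (LINT x|d p (-1). g x)) - ((LINT x|d q 1. g x) - (LINT x|d q (-1). g x))"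
    by (simp add: signed_integral_def M_def c_def)
  also have "\<dots> = signed_integral \<Omega> \<mu> (\<lambda>x. g x * f x)"
    using split[OF fin(1) sets(1) space(1) g] split[OF fin(2) sets(2) space(2) g] g(1)
    by (simp add: signed_integral_def p_def[symmetric] q_def[symmetric] dp(4) dq(4))
  finally show "signed_integral \<Omega> (weighted_measure \<Omega> f \<mu>) g = signed_integral \<Omega> \<mu> (\<lambda>x. g x * f x)"
    by (simp only: \<kappa>_def)
qed

lemma
  fixes \<mu> :: "'a::euclidean_space set \<Rightarrow> 'b::euclidean_space"
  assumes \<mu>: "Radon_measure \<Omega> \<mu>"
    and F: "\<And>b. b \<in> Basis \<Longrightarrow> (\<lambda>x. F x \<bullet> b) \<in> borel_measurable (restrict_space borel \<Omega>)"
      "\<And>x b. x \<in> \<Omega> \<Longrightarrow> b \<in> Basis \<Longrightarrow> \<bar>F x \<bullet> b\<bar> \<le> K"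
  shows Radon_dot_measure: "Radon_measure \<Omega> (dot_measure \<Omega> F \<mu>)"
    and signed_integral_dot_measure: "\<And>g L. g \<in> borel_measurable (restrict_space borel \<Omega>) \<Longrightarrow>
      (\<And>x. x \<in> \<Omega> \<Longrightarrow> \<bar>g x\<bar> \<le> L) \<Longrightarrow>
      signed_integral \<Omega> (dot_measure \<Omega> F \<mu>) g = dot_integral \<Omega> \<mu> (\<lambda>x. g x *\<^sub>R F x)"
proof -
  let ?w = "\<lambda>b. weighted_measure \<Omega> (\<lambda>x. F x \<bullet> b) (\<lambda>B. \<mu> B \<bullet> b)"
  have w: "Radon_measure \<Omega> (?w b)" if "b \<in> Basis" for b
    by (rule Radon_weighted_measure[OF Radon_measure_inner[OF \<mu>] F(1)[OF that] F(2)[OF _ that]])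
  have eq: "dot_measure \<Omega> F \<mu> = (\<lambda>B. \<Sum>b\<in>Basis. ?w b B)"
    by (rule ext) (simp add: dot_measure_def dot_integral_def weighted_measure_def)
  show R: "Radon_measure \<Omega> (dot_measure \<Omega> F \<mu>)"
    unfolding eq by (rule Radon_measure_sum[OF finite_Basis w])
  fix g :: "'a \<Rightarrow> real" and L :: real
  assume g: "g \<in> borel_measurable (restrict_space borel \<Omega>)" "\<And>x. x \<in> \<Omega> \<Longrightarrow> \<bar>g x\<bar> \<le> L"
  define J where "J = insert None (Some ` (Basis :: 'b set))"
  define \<nu> where "\<nu> j = (case j of None \<Rightarrow> dot_measure \<Omega> F \<mu> | Some b \<Rightarrow> ?w b)" for j
  define c where "c j = (case j of None \<Rightarrow> -1 | Some (b::'b) \<Rightarrow> (1::real))" for j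
  have "(\<Sum>j\<in>J. c j * signed_integral \<Omega> (\<nu> j) g) = 0"
  proof (rule signed_integral_lincomb_eq_0[OF _ _ _ g])
    show "Radon_measure \<Omega> (\<nu> j)" if "j \<in> J" for j
      using R w that by (auto simp: \<nu>_def J_def)
    show "(\<Sum>j\<in>J. c j * \<nu> j B) = 0" for B
      by (simp add: J_def sum.reindex c_def \<nu>_def) (simp add: eq)
  qed (auto simp: J_def)
  then have "signed_integral \<Omega> (dot_measure \<Omega> F \<mu>) g = (\<Sum>b\<in>Basis. signed_integral \<Omega> (?w b) g)"
    by (simp add: J_def sum.reindex c_def \<nu>_def)
  also have "\<dots> = dot_integral \<Omega> \<mu> (\<lambda>x. g x *\<^sub>R F x)"
    unfolding dot_integral_def inner_scaleR_left
    by (rule sum.cong[OF refl])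
      (rule signed_integral_weighted_measure[OF Radon_measure_inner[OF \<mu>] F(1) F(2) g])
  finally show "signed_integral \<Omega> (dot_measure \<Omega> F \<mu>) g = dot_integral \<Omega> \<mu> (\<lambda>x. g x *\<^sub>R F x)" .
qed

section \<open>The pairing measure and the product rule\<close>

lemma Linf_norm_bound:
  assumes G: "G \<in> sets borel" and f: "f \<in> borel_measurable (lebesgue_on G)" and fin: "Linf_norm G f < \<infinity>"
  shows "AE x in lborel. x \<in> G \<longrightarrow> norm (f x) \<le> enn2real (Linf_norm G f)"
proof -
  obtain M where M: "Linf_norm G f = ennreal M" "0 \<le> M" using fin by (cases "Linf_norm G f") auto
  have "AE x in lebesgue_on G. ennreal (norm (f x)) \<le> Linf_norm G f"
    unfolding Linf_norm_def by (rule esssup_AE)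
  then have "AE x in lebesgue_on G. norm (f x) \<le> M" using M by (simp add: ennreal_le_iff)
  then show ?thesis using M by (simp add: AE_lebesgue_on_iff[OF G])
qed

lemma Linf_norm_mono:
  assumes \<Omega>: "\<Omega> \<in> sets borel" "G \<in> sets borel" "G \<subseteq> \<Omega>" and f: "f \<in> borel_measurable (lebesgue_on \<Omega>)"
  shows "Linf_norm G f \<le> Linf_norm \<Omega> f"
  unfolding Linf_norm_def
proof (rule esssup_I)
  have "f \<in> borel_measurable (lebesgue_on G)" by (rule measurable_restrict_mono[OF f \<Omega>(3)])
  then show "(\<lambda>x. ennreal (norm (f x))) \<in> borel_measurable (lebesgue_on G)" by simp
  have "AE x in lebesgue_on \<Omega>. ennreal (norm (f x)) \<le> esssup (lebesgue_on \<Omega>) (\<lambda>x. ennreal (norm (f x)))"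
    by (rule esssup_AE)
  then show "AE x in lebesgue_on G. ennreal (norm (f x)) \<le> esssup (lebesgue_on \<Omega>) (\<lambda>x. ennreal (norm (f x)))"
    unfolding AE_lebesgue_on_iff[OF \<Omega>(1)] AE_lebesgue_on_iff[OF \<Omega>(2)]
    by (rule eventually_mono) (use \<Omega>(3) in blast)
qed

context pairing_setting
begin

lemma Linf_norm_A_finite: "G \<in> sets borel \<Longrightarrow> G \<subseteq> \<Omega> \<Longrightarrow> Linf_norm G A < \<infinity>"
  using Linf_norm_mono[OF \<Omega>_borel _ _ A_meas, of G] A_DM
  by (auto simp: DM_infty_def L_infty_def intro: le_less_trans)

lemma a_Linf_bound:
  assumes G: "G \<in> sets borel" "G \<subseteq> \<Omega>"
  shows "AE x in lborel. x \<in> G \<longrightarrow> norm (a x) \<le> enn2real (Linf_norm G A)"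
proof -
  have "AE x in lborel. x \<in> G \<longrightarrow> norm (A x) \<le> enn2real (Linf_norm G A)"
    by (rule Linf_norm_bound[OF G(1) measurable_restrict_mono[OF A_meas G(2)] Linf_norm_A_finite[OF G]])
  moreover have "AE x in lborel. x \<in> \<Omega> \<longrightarrow> A x = a x" using a by (simp add: borel_version_def)
  ultimately show ?thesis by eventually_elim (use G(2) in auto)
qed

text \<open>
  The estimate for a set \<open>B\<close> inside an open \<open>G\<close> comes from test functions supported in \<open>G\<close> that approximate the
  indicator of \<open>B\<close> in \<open>L\<^sup>1(|Eu|)\<close>: on them the functional is bounded with the norm of \<open>A\<close> over \<open>G\<close>, and the global
  constant \<open>L\<close> only multiplies the approximation error.
\<close>

lemma pairing_measure:
  obtains \<nu> where "represents \<Omega> (pairing \<Omega> A u) \<nu>"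
    "\<And>G B. open G \<Longrightarrow> G \<subseteq> \<Omega> \<Longrightarrow> B \<in> borel_on G \<Longrightarrow>
      emeasure (total_variation \<Omega> \<nu>) B \<le> Linf_norm G A * emeasure (total_variation \<Omega> E) B"
proof -
  define m where "m = total_variation \<Omega> E"
  interpret m: finite_measure m unfolding m_def by (rule finite_measure_total_variation[OF E_Radon])
  have sets_m: "sets m = borel_on \<Omega>" by (simp add: m_def)
  have bound\<Omega>: "\<bar>pairing \<Omega> A u \<phi>\<bar> \<le> L * (LINT x|m. \<bar>\<phi> x\<bar>)" if "\<phi> \<in> test_functions \<Omega>" for \<phi>
    unfolding m_def by (rule pairing_bound[OF open_\<Omega> order_refl that L_nonneg]) (simp add: a_le)
  obtain \<nu> where \<nu>: "represents \<Omega> (pairing \<Omega> A u) \<nu>"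
    "\<And>B \<phi>. B \<in> borel_on \<Omega> \<Longrightarrow> \<phi> \<in> test_functions \<Omega> \<Longrightarrow>
      \<bar>\<nu> B - pairing \<Omega> A u \<phi>\<bar> \<le> L * (LINT x|m. \<bar>\<phi> x - indicator B x\<bar>)"
  proof (rule dominated_functional_extension[of \<Omega> m "pairing \<Omega> A u" L])
    show "pairing \<Omega> A u (\<lambda>x. \<phi> x + \<psi> x) = pairing \<Omega> A u \<phi> + pairing \<Omega> A u \<psi>"
      if "\<phi> \<in> test_functions \<Omega>" "\<psi> \<in> test_functions \<Omega>" for \<phi> \<psi>
      by (rule pairing_add[OF that])
    show "pairing \<Omega> A u (\<lambda>x. c * \<phi> x) = c * pairing \<Omega> A u \<phi>" if "\<phi> \<in> test_functions \<Omega>" for \<phi> c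
      by (rule pairing_scale[OF that])
    fix \<nu>
    assume 1: "represents \<Omega> (pairing \<Omega> A u) \<nu>"
      and 2: "\<And>B \<phi>. B \<in> borel_on \<Omega> \<Longrightarrow> \<phi> \<in> test_functions \<Omega> \<Longrightarrow>
        \<bar>\<nu> B - pairing \<Omega> A u \<phi>\<bar> \<le> L * (LINT x|m. \<bar>\<phi> x - indicator B x\<bar>)"
    show thesis by (rule that[OF 1 2])
  next
    show "\<bar>pairing \<Omega> A u \<phi>\<bar> \<le> L * (LINT x|m. \<bar>\<phi> x\<bar>)" if "\<phi> \<in> test_functions \<Omega>" for \<phi>
      by (rule bound\<Omega>[OF that])
  qed (rule open_\<Omega> m.finite_measure_axioms sets_m L_nonneg)+
  have R: "Radon_measure \<Omega> \<nu>" using \<nu>(1) by (simp add: represents_def)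
  have est: "\<bar>\<nu> B\<bar> \<le> enn2real (Linf_norm G A) * measure m B"
    if G: "open G" "G \<subseteq> \<Omega>" and B: "B \<in> borel_on G" for G B
  proof (rule field_le_epsilon)
    fix e :: real assume e: "0 < e"
    let ?C = "enn2real (Linf_norm G A)"
    \<comment> \<open>The summand \<open>1\<close> only prevents a division by \<open>0\<close>.\<close>
    define e' where "e' = e / (?C + L + 1)"
    have C0: "0 \<le> ?C" by simp
    have pos: "0 < ?C + L + 1" using C0 L_nonneg by linarith
    have e': "0 < e'" using e pos by (simp add: e'_def)
    obtain \<phi> where \<phi>: "\<phi> \<in> test_functions G" "(LINT x|m. \<bar>\<phi> x - indicator B x\<bar>) < e'"
      using test_functions_approximate_indicator[OF G m.finite_measure_axioms sets_m B e'] by blast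
    have \<phi>\<Omega>: "\<phi> \<in> test_functions \<Omega>" using test_functions_mono[OF G(2)] \<phi>(1) by blast
    have B\<Omega>: "B \<in> borel_on \<Omega>" using B G open_\<Omega> by (auto simp: borel_on_iff)
    have ind: "integrable m (indicat_real B)"
      by (rule integrable_real_indicator) (use B\<Omega> sets_m in \<open>auto simp: m.emeasure_eq_measure\<close>)
    have i\<phi>: "integrable m \<phi>" by (rule test_function_integrable[OF m.finite_measure_axioms sets_m \<phi>(1)])
    have "\<bar>pairing \<Omega> A u \<phi>\<bar> \<le> ?C * (LINT x|m. \<bar>\<phi> x\<bar>)"
      unfolding m_def by (rule pairing_bound[OF G \<phi>(1) C0 a_Linf_bound]) (use G in auto)
    also have "(LINT x|m. \<bar>\<phi> x\<bar>) \<le> (LINT x|m. \<bar>\<phi> x - indicator B x\<bar>) + (LINT x|m. \<bar>indicator B x - 0\<bar>)"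
      using integral_abs_triangle[OF i\<phi> ind, of "\<lambda>_. 0"] by simp
    also have "(LINT x|m. \<bar>indicator B x - 0 :: real\<bar>) = measure m B"
      using sets.sets_into_space[of B m] B\<Omega> sets_m by (simp add: Int_absorb2)
    finally have "\<bar>pairing \<Omega> A u \<phi>\<bar> \<le> ?C * ((LINT x|m. \<bar>\<phi> x - indicator B x\<bar>) + measure m B)"
      using C0 by (simp add: mult_left_mono)
    also have "\<dots> \<le> ?C * (e' + measure m B)" using \<phi>(2) C0 by (intro mult_left_mono) auto
    finally have 1: "\<bar>pairing \<Omega> A u \<phi>\<bar> \<le> ?C * e' + ?C * measure m B" by (simp add: distrib_left)
    have "\<bar>\<nu> B - pairing \<Omega> A u \<phi>\<bar> \<le> L * (LINT x|m. \<bar>\<phi> x - indicator B x\<bar>)" by (rule \<nu>(2)[OF B\<Omega> \<phi>\<Omega>])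
    also have "\<dots> \<le> L * e'" using \<phi>(2) L_nonneg by (intro mult_left_mono) auto
    finally have 2: "\<bar>\<nu> B - pairing \<Omega> A u \<phi>\<bar> \<le> L * e'" .
    have "(?C + L + 1) * e' = e" using pos by (simp add: e'_def)
    then have "?C * e' + L * e' \<le> e" using e' by (simp add: distrib_right)
    then show "\<bar>\<nu> B\<bar> \<le> ?C * measure m B + e" using 1 2 by linarith
  qed
  show ?thesis
  proof (rule that[OF \<nu>(1)])
    fix G B assume G: "open G" "G \<subseteq> \<Omega>" and B: "B \<in> borel_on G"
    have fin: "Linf_norm G A < \<infinity>" using G by (intro Linf_norm_A_finite) auto
    have B\<Omega>: "B \<in> borel_on \<Omega>" using B G open_\<Omega> by (auto simp: borel_on_iff)
    show "emeasure (total_variation \<Omega> \<nu>) B \<le> Linf_norm G A * emeasure (total_variation \<Omega> E) B"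
      unfolding m_def[symmetric]
    proof (rule total_variation_least[OF R sets_m B\<Omega>])
      fix C assume C: "C \<in> borel_on \<Omega>" "C \<subseteq> B"
      have "C \<in> borel_on G" using C B G open_\<Omega> by (auto simp: borel_on_iff)
      then have "\<bar>\<nu> C\<bar> \<le> enn2real (Linf_norm G A) * measure m C" by (rule est[OF G])
      then have "ennreal (norm (\<nu> C)) \<le> ennreal (enn2real (Linf_norm G A)) * emeasure m C"
        by (simp add: m.emeasure_eq_measure ennreal_leI flip: ennreal_mult)
      then show "ennreal (norm (\<nu> C)) \<le> Linf_norm G A * emeasure m C" using fin by (simp add: ennreal_enn2real)
    qed
  qed
qed

lemma U_inner_Basis:
  assumes "b \<in> Basis"
  shows "(\<lambda>x. U x \<bullet> b) \<in> borel_measurable (restrict_space borel \<Omega>)" "x \<in> \<Omega> \<Longrightarrow> \<bar>U x \<bullet> b\<bar> \<le> M"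
proof -
  obtain j where "b = axis j 1" using assms by (auto simp: Basis_vec_def)
  then show "(\<lambda>x. U x \<bullet> b) \<in> borel_measurable (restrict_space borel \<Omega>)" "x \<in> \<Omega> \<Longrightarrow> \<bar>U x \<bullet> b\<bar> \<le> M"
    using U_measurable[of j] U_le[of x j] by (simp_all add: inner_axis)
qed

text \<open>
  The definition of the pairing, read backwards.
\<close>

lemma div_distr_eq:
  assumes \<phi>: "\<phi> \<in> test_functions \<Omega>"
  shows "div_distr \<Omega> (\<lambda>x. A x *v u x) \<phi> = pairing \<Omega> A u \<phi> + dot_integral \<Omega> D (\<lambda>x. \<phi> x *\<^sub>R U x)"
proof -
  have mult: "(m *v w) \<bullet> g = (\<Sum>i\<in>UNIV. (\<Sum>j\<in>UNIV. m $ i $ j * w $ j) * g $ i)" for m :: "real^'n^'n" and w g :: "real^'n"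
    by (simp add: inner_vec_def matrix_vector_mult_def)
  have classical: "(a x *v v x) \<bullet> grad \<phi> x = a x \<bullet> (v x \<odot> grad \<phi> x)" for x
    unfolding mult inner_sym_prod sum_distrib_right by (subst sum.swap) (simp add: mult_ac)
  have gm: "(\<lambda>x. grad \<phi> x $ i) \<in> borel_measurable (lebesgue_on \<Omega>)" for i
    using grad_measurable[OF \<phi>] by (intro measurable_restrict_space1 measurable_completion) simp
  have "(LINT x|lebesgue_on \<Omega>. (A x *v u x) \<bullet> grad \<phi> x) = (LINT x|lborel. indicator \<Omega> x *\<^sub>R (a x \<bullet> (v x \<odot> grad \<phi> x)))"
  proof (rule integral_lebesgue_on_eq_lborel[OF \<Omega>_borel])
    show "(\<lambda>x. (A x *v u x) \<bullet> grad \<phi> x) \<in> borel_measurable (lebesgue_on \<Omega>)"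
      unfolding mult
      by (intro borel_measurable_sum borel_measurable_times gm
          measurable_compose[OF u_meas component_measurable(1)] measurable_compose[OF A_meas component_measurable(2)])
    show "(\<lambda>x. a x \<bullet> (v x \<odot> grad \<phi> x)) \<in> borel_measurable borel"
      unfolding inner_sym_prod
      by (intro borel_measurable_sum borel_measurable_times grad_measurable[OF \<phi>] vi_meas aij_meas)
    have "AE y in lborel. y \<in> \<Omega> \<longrightarrow> A y = a y" "AE y in lborel. y \<in> \<Omega> \<longrightarrow> u y = v y"
      using a v by (auto simp: borel_version_def)
    then show "AE x in lborel. x \<in> \<Omega> \<longrightarrow> (A x *v u x) \<bullet> grad \<phi> x = a x \<bullet> (v x \<odot> grad \<phi> x)"
      by eventually_elim (simp add: classical)
  qed
  also have "\<dots> = (LINT x|lborel. a x \<bullet> (v x \<odot> grad \<phi> x))"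
    using a by (intro Bochner_Integration.integral_cong refl) (auto simp: borel_version_def indicator_def)
  finally have 1: "div_distr \<Omega> (\<lambda>x. A x *v u x) \<phi> = - (LINT x|lborel. a x \<bullet> (v x \<odot> grad \<phi> x))"
    by (simp add: div_distr_def)
  have "dot_integral \<Omega> D (\<lambda>x. \<phi> x *\<^sub>R U x) = (\<Sum>j\<in>UNIV. signed_integral \<Omega> (Dj j) (\<lambda>x. \<phi> x * U x $ j))"
    by (simp add: dot_integral_def sum_Basis_vec inner_axis)
  then show ?thesis using 1 pairing_eq[OF \<phi>] by simp
qed

lemma div_represents:
  assumes \<nu>: "represents \<Omega> (pairing \<Omega> A u) \<nu>"
  shows "represents \<Omega> (div_distr \<Omega> (\<lambda>x. A x *v u x)) (\<lambda>B. dot_measure \<Omega> U D B + \<nu> B)"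
proof -
  note Um = U_inner_Basis
  have R1: "Radon_measure \<Omega> (dot_measure \<Omega> U D)" by (rule Radon_dot_measure[OF D_Radon Um])
  have R2: "Radon_measure \<Omega> \<nu>" using \<nu> by (simp add: represents_def)
  have R: "Radon_measure \<Omega> (\<lambda>B. dot_measure \<Omega> U D B + \<nu> B)" by (rule Radon_measure_add[OF R1 R2])
  have "div_distr \<Omega> (\<lambda>x. A x *v u x) \<phi> = signed_integral \<Omega> (\<lambda>B. dot_measure \<Omega> U D B + \<nu> B) \<phi>"
    if \<phi>: "\<phi> \<in> test_functions \<Omega>" for \<phi>
  proof -
    obtain K where K: "\<And>x. \<bar>\<phi> x\<bar> \<le> K" using test_function_bounded[OF \<phi>] by metis
    define \<sigma> where "\<sigma> i = (if i = 0 then (\<lambda>B. dot_measure \<Omega> U D B + \<nu> B) else if i = 1 then dot_measure \<Omega> U D else \<nu>)" for i :: nat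
    define c where "c i = (if i = 0 then -1 else 1 :: real)" for i :: nat
    have "(\<Sum>i\<in>{0,1,2}. c i * signed_integral \<Omega> (\<sigma> i) \<phi>) = 0"
      by (rule signed_integral_lincomb_eq_0[OF _ _ _ test_function_measurable(1)[OF \<phi>] K])
        (use R R1 R2 in \<open>auto simp: \<sigma>_def c_def\<close>)
    then have "signed_integral \<Omega> (\<lambda>B. dot_measure \<Omega> U D B + \<nu> B) \<phi> = signed_integral \<Omega> (dot_measure \<Omega> U D) \<phi> + signed_integral \<Omega> \<nu> \<phi>"
      by (simp add: \<sigma>_def c_def)
    moreover have "signed_integral \<Omega> (dot_measure \<Omega> U D) \<phi> = dot_integral \<Omega> D (\<lambda>x. \<phi> x *\<^sub>R U x)"
      by (rule signed_integral_dot_measure[OF D_Radon Um test_function_measurable(1)[OF \<phi>] K])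
    moreover have "signed_integral \<Omega> \<nu> \<phi> = pairing \<Omega> A u \<phi>"
      using \<nu> \<phi> by (simp add: represents_def)
    ultimately show ?thesis using div_distr_eq[OF \<phi>] by simp
  qed
  then show ?thesis using R by (simp add: represents_def)
qed

end

text \<open>
  The representative of \<open>A\<close> is set to \<open>0\<close> on the null set where it fails to be symmetric. The condition is
  written with a norm so that its Borel measurability is that of a real function.
\<close>

lemma exists_pairing_setting:
  fixes \<Omega> :: "(real^'n) set" and A :: "real^'n \<Rightarrow> real^'n^'n" and u :: "real^'n \<Rightarrow> real^'n"
  assumes \<Omega>: "open \<Omega>" and A: "A \<in> DM_infty \<Omega>" and u: "u \<in> BD \<Omega> \<inter> L_infty \<Omega>"
    and S: "disc_set \<Omega> u - jump_set \<Omega> u \<in> null_sets (total_variation \<Omega> (singular_part \<Omega> (Div_measure \<Omega> A)))"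
  obtains a v L M where "pairing_setting \<Omega> A u a v L M"
proof -
  have \<Omega>b: "\<Omega> \<in> sets borel" using \<Omega> by simp
  obtain v M where v: "borel_version \<Omega> u v" "\<And>y. norm (v y) \<le> M"
    using exists_borel_version[OF \<Omega>b, of u] u by blast
  obtain b L where b: "borel_version \<Omega> A b" "\<And>y. norm (b y) \<le> L"
    using exists_borel_version[OF \<Omega>b, of A] A unfolding DM_infty_def by blast
  define a where "a x = (if norm (transpose (b x) - b x) \<le> 0 then b x else 0)" for x
  have bm: "b \<in> borel_measurable borel" using b(1) by (simp add: borel_version_def)
  have "continuous_on UNIV (\<lambda>m :: real^'n^'n. norm (transpose m - m))"
    unfolding transpose_def by (intro continuous_intros)
  then have tm: "(\<lambda>x. norm (transpose (b x) - b x)) \<in> borel_measurable borel"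
    by (intro measurable_compose[OF bm] borel_measurable_continuous_onI)
  have "{x \<in> space borel. norm (transpose (b x) - b x) \<le> 0} \<in> sets borel" using tm by measurable
  then have "a \<in> borel_measurable borel"
    unfolding a_def[abs_def] by (rule measurable_If[OF bm borel_measurable_const])
  moreover have "AE y in lborel. y \<in> \<Omega> \<longrightarrow> A y = a y"
  proof -
    have "AE x in lebesgue_on \<Omega>. transpose (A x) = A x" using A by (simp add: DM_infty_def)
    then have "AE x in lborel. x \<in> \<Omega> \<longrightarrow> transpose (A x) = A x" by (simp only: AE_lebesgue_on_iff[OF \<Omega>b])
    moreover have "AE y in lborel. y \<in> \<Omega> \<longrightarrow> A y = b y" using b(1) by (simp add: borel_version_def)
    ultimately show ?thesis by eventually_elim (auto simp: a_def)
  qed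
  ultimately have a: "borel_version \<Omega> A a" using b(1) by (simp add: borel_version_def a_def)
  have "0 \<le> L" using order_trans[OF norm_ge_zero b(2)] .
  then have aL: "norm (a x) \<le> L" for x using b(2) by (simp add: a_def)
  have "transpose (0 :: real^'n^'n) = 0" by (simp add: transpose_def vec_eq_iff)
  then have "transpose (a x) = a x" for x by (simp add: a_def)
  then have "pairing_setting \<Omega> A u a v L M"
    using \<Omega> A u S v a aL by unfold_locales auto
  then show ?thesis by (rule that)
qed

theorem theorem5p3:
  fixes \<Omega> :: "(real^'n) set" and A :: "real^'n \<Rightarrow> real^'n^'n" and u :: "real^'n \<Rightarrow> real^'n"
  assumes "open \<Omega>"
    and "A \<in> DM_infty \<Omega>"
    and "u \<in> BD \<Omega> \<inter> L_infty \<Omega>"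
    and "disc_set \<Omega> u - jump_set \<Omega> u
           \<in> null_sets (total_variation \<Omega> (singular_part \<Omega> (Div_measure \<Omega> A)))"
  shows "is_Radon_measure \<Omega> (pairing \<Omega> A u) \<and>
         absolutely_continuous (total_variation \<Omega> (E_measure \<Omega> u))
           (total_variation \<Omega> (the_measure \<Omega> (pairing \<Omega> A u))) \<and>
         (\<forall>U B. open U \<and> compact (closure U) \<and> closure U \<subseteq> \<Omega> \<and> B \<in> sets borel \<and> B \<subseteq> U \<longrightarrow>
            emeasure (total_variation \<Omega> (the_measure \<Omega> (pairing \<Omega> A u))) B
              \<le> Linf_norm U A * emeasure (total_variation \<Omega> (E_measure \<Omega> u)) B) \<and>
         is_Radon_measure \<Omega> (div_distr \<Omega> (\<lambda>x. A x *v u x)) \<and>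
         the_measure \<Omega> (div_distr \<Omega> (\<lambda>x. A x *v u x)) =
           (\<lambda>B. dot_measure \<Omega> (precise_rep \<Omega> u) (Div_measure \<Omega> A) B
                 + the_measure \<Omega> (pairing \<Omega> A u) B)"
proof -
  obtain a v L M where "pairing_setting \<Omega> A u a v L M"
    using exists_pairing_setting[OF assms] by blast
  then interpret pairing_setting \<Omega> A u a v L M .
  obtain \<nu> where \<nu>: "represents \<Omega> (pairing \<Omega> A u) \<nu>"
    and bound: "\<And>G B. open G \<Longrightarrow> G \<subseteq> \<Omega> \<Longrightarrow> B \<in> borel_on G \<Longrightarrow>
      emeasure (total_variation \<Omega> \<nu>) B \<le> Linf_norm G A * emeasure (total_variation \<Omega> (E_measure \<Omega> u)) B"
    by (rule pairing_measure) blast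
  have the_\<nu>: "the_measure \<Omega> (pairing \<Omega> A u) = \<nu>" by (rule the_measure_eqI[OF assms(1) \<nu>])
  note div = div_represents[OF \<nu>]
  show ?thesis
    unfolding the_\<nu>
  proof (intro conjI allI impI)
    show "is_Radon_measure \<Omega> (pairing \<Omega> A u)" using \<nu> by (auto simp: is_Radon_measure_def)
    show "absolutely_continuous (total_variation \<Omega> (E_measure \<Omega> u)) (total_variation \<Omega> \<nu>)"
      unfolding absolutely_continuous_def
    proof
      fix B assume B: "B \<in> null_sets (total_variation \<Omega> (E_measure \<Omega> u))"
      then have Bb: "B \<in> borel_on \<Omega>" by (auto dest: null_setsD2)
      have "emeasure (total_variation \<Omega> \<nu>) B \<le> 0"
        using bound[OF assms(1) order_refl Bb] null_setsD1[OF B] by simp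
      then show "B \<in> null_sets (total_variation \<Omega> \<nu>)" using Bb by (auto simp: null_sets_def)
    qed
    fix U B
    assume UB: "open U \<and> compact (closure U) \<and> closure U \<subseteq> \<Omega> \<and> B \<in> sets borel \<and> B \<subseteq> U"
    then have "U \<subseteq> \<Omega>" using closure_subset by blast
    then show "emeasure (total_variation \<Omega> \<nu>) B \<le> Linf_norm U A * emeasure (total_variation \<Omega> (E_measure \<Omega> u)) B"
      using UB by (intro bound) (auto simp: borel_on_iff)
  next
    show "is_Radon_measure \<Omega> (div_distr \<Omega> (\<lambda>x. A x *v u x))" using div by (auto simp: is_Radon_measure_def)
    show "the_measure \<Omega> (div_distr \<Omega> (\<lambda>x. A x *v u x)) =
        (\<lambda>B. dot_measure \<Omega> (precise_rep \<Omega> u) (Div_measure \<Omega> A) B + \<nu> B)"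
      by (rule the_measure_eqI[OF assms(1) div])
  qed
qed

end
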